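(* Let $M$ be a closed oriented smooth manifold. If $H^1(M;\mathbb{Z})\neq0$ then $M$ contains a connected isolated unstable global attractor having no external explosions; that is, there exist a continuous flow on $M$ and a subset $K\subseteq M$ which is a connected isolated unstable global attractor with no external explosions for this flow.
   Context: Closed means compact and without boundary. A continuous flow is a continuous action $M\times\mathbb{R}\to M$, $(x,t)\mapsto x\cdot t$; $\omega(x)$ is the usual (positive) limit set of $x$, and $J^{+}(x)=\bigcap_{U,\,t\ge 0}\overline{U\cdot[t,+\infty)}$, where $U$ ranges over the open neighbourhoods of $x$ in $M$. A compact invariant set $K$ is isolated if it has a compact neighbourhood $N$ such that $K=\{x\in N: x\cdot\mathbb{R}\subseteq N\}$. An isolated attractor is an isolated compact invariant set $K$ such that its basin of attraction $\mathcal{A}(K)=\{x\in M:\emptyset\ne\omega(x)\subseteq K\}$ is a neighbourhood of $K$; it is global if $\mathcal{A}(K)=M$; it is stable if it has a neighbourhood basis of positively invariant sets, and unstable otherwise. An isolated attractor $K$ has no external explosions if $J^{+}(x)\subseteq K$ for all $x\in\mathcal{A}(K)-K$.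
   Formalization: M is additionally assumed connected; for disconnected M (e.g. two disjoint circles) the claim fails, since a global attractor meets every component of M and so cannot be connected. *)

theory Defs
  imports "HOL-Analysis.Analysis" "HOL-Homology.Homology"
begin

section \<open>Oriented smooth manifolds\<close>

text \<open>Meant for open \<open>S\<close>, where the derivative at a point is unique. In finite dimension, being
  \<open>C\<^sup>k\<^sup>+\<^sup>1\<close> amounts to being differentiable with all directional derivatives \<open>C\<^sup>k\<close>.\<close>

primrec C_k_on ::
  "nat \<Rightarrow> 'a::euclidean_space set \<Rightarrow> ('a \<Rightarrow> 'b::euclidean_space) \<Rightarrow> bool" where
  "C_k_on 0 S f \<longleftrightarrow> continuous_on S f"
| "C_k_on (Suc k) S f \<longleftrightarrow>
     (\<forall>x\<in>S. f differentiable (at x)) \<and> (\<forall>v. C_k_on k S (\<lambda>x. frechet_derivative f (at x) v))"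

definition smooth_on ::
  "'a::euclidean_space set \<Rightarrow> ('a \<Rightarrow> 'b::euclidean_space) \<Rightarrow> bool" where
  "smooth_on S f \<longleftrightarrow> (\<forall>k. C_k_on k S f)"

text \<open>A chart is a pair of its domain and a map whose values off that domain are irrelevant.\<close>

type_synonym ('a, 'n) chart = "'a set \<times> ('a \<Rightarrow> real ^ 'n)"

definition chart_of :: "'a topology \<Rightarrow> ('a, 'n::finite) chart \<Rightarrow> bool" where
  "chart_of M c \<longleftrightarrow>
     (case c of (U, f) \<Rightarrow>
        openin M U \<and> open (f ` U) \<and>
        homeomorphic_map (subtopology M U) (top_of_set (f ` U)) f)"

definition transition_dom :: "('a, 'n::finite) chart \<Rightarrow> ('a, 'n) chart \<Rightarrow> (real ^ 'n) set" where
  "transition_dom c d = snd c ` (fst c \<inter> fst d)"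

definition transition_map ::
  "('a, 'n::finite) chart \<Rightarrow> ('a, 'n) chart \<Rightarrow> real ^ 'n \<Rightarrow> real ^ 'n" where
  "transition_map c d = snd d \<circ> inv_into (fst c) (snd c)"

definition smooth_atlas :: "'a topology \<Rightarrow> ('a, 'n::finite) chart set \<Rightarrow> bool" where
  "smooth_atlas M A \<longleftrightarrow>
     (\<forall>c\<in>A. chart_of M c) \<and> (\<Union>c\<in>A. fst c) = topspace M \<and>
     (\<forall>c\<in>A. \<forall>d\<in>A. smooth_on (transition_dom c d) (transition_map c d))"

text \<open>An orientation is given by an atlas whose transition maps all have positive Jacobian
  determinant.\<close>

definition oriented_atlas :: "('a, 'n::finite) chart set \<Rightarrow> bool" where
  "oriented_atlas A \<longleftrightarrow>
     (\<forall>c\<in>A. \<forall>d\<in>A. \<forall>y\<in>transition_dom c d.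
        det (matrix (frechet_derivative (transition_map c d) (at y))) > 0)"

definition oriented_smooth_manifold :: "'a topology \<Rightarrow> ('a, 'n::finite) chart set \<Rightarrow> bool" where
  "oriented_smooth_manifold M A \<longleftrightarrow>
     Hausdorff_space M \<and> second_countable M \<and> smooth_atlas M A \<and> oriented_atlas A"

text \<open>The model space is \<open>real ^ 'n\<close>, so charts map onto open sets of Euclidean space and there is
  no boundary.\<close>

definition closed_oriented_smooth_manifold ::
  "'a topology \<Rightarrow> ('a, 'n::finite) chart set \<Rightarrow> bool" where
  "closed_oriented_smooth_manifold M A \<longleftrightarrow> oriented_smooth_manifold M A \<and> compact_space M"


section \<open>Integral singular cohomology\<close>

text \<open>Cochains are extensional, so that two cochains are equal iff they agree on all chains.\<close>

definition cochain_group :: "nat \<Rightarrow> 'a topology \<Rightarrow> ('a chain \<Rightarrow> int) monoid" where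
  "cochain_group p X =
     \<lparr>carrier = hom (chain_group p X) integer_group \<inter> extensional (singular_chain_set p X),
      monoid.mult = (\<lambda>a b. \<lambda>c\<in>singular_chain_set p X. a c + b c),
      one = (\<lambda>c\<in>singular_chain_set p X. 0)\<rparr>"

definition coboundary :: "nat \<Rightarrow> 'a topology \<Rightarrow> ('a chain \<Rightarrow> int) \<Rightarrow> ('a chain \<Rightarrow> int)" where
  "coboundary p X a = (\<lambda>c\<in>singular_chain_set (Suc p) X. a (chain_boundary (Suc p) c))"

definition cocycle_set :: "nat \<Rightarrow> 'a topology \<Rightarrow> ('a chain \<Rightarrow> int) set" where
  "cocycle_set p X =
     {a \<in> carrier (cochain_group p X). coboundary p X a = \<one>\<^bsub>cochain_group (Suc p) X\<^esub>}"

definition coboundary_set :: "nat \<Rightarrow> 'a topology \<Rightarrow> ('a chain \<Rightarrow> int) set" where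
  "coboundary_set p X =
     (case p of 0 \<Rightarrow> {\<one>\<^bsub>cochain_group 0 X\<^esub>}
      | Suc q \<Rightarrow> coboundary q X ` carrier (cochain_group q X))"

definition cocycle_group :: "nat \<Rightarrow> 'a topology \<Rightarrow> ('a chain \<Rightarrow> int) monoid" where
  "cocycle_group p X = (cochain_group p X)\<lparr>carrier := cocycle_set p X\<rparr>"

definition cohomology_group :: "nat \<Rightarrow> 'a topology \<Rightarrow> ('a chain \<Rightarrow> int) set monoid" where
  "cohomology_group p X = cocycle_group p X Mod coboundary_set p X"

lemma carrier_cochain_group:
  "a \<in> carrier (cochain_group p X) \<longleftrightarrow>
     (\<forall>c d. singular_chain p X c \<longrightarrow> singular_chain p X d \<longrightarrow> a (c + d) = a c + a d) \<and>
     a \<in> extensional (singular_chain_set p X)"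
  by (auto simp: cochain_group_def hom_def integer_group_def)

lemma comm_group_cochain_group: "comm_group (cochain_group p X)"
proof (rule comm_groupI)
  show "\<exists>b\<in>carrier (cochain_group p X). b \<otimes>\<^bsub>cochain_group p X\<^esub> a = \<one>\<^bsub>cochain_group p X\<^esub>"
    if "a \<in> carrier (cochain_group p X)" for a
  proof (rule bexI)
    show "(\<lambda>c\<in>singular_chain_set p X. - a c) \<in> carrier (cochain_group p X)"
      using that by (auto simp: carrier_cochain_group singular_chain_add)
  qed (auto simp: cochain_group_def)
next
  show "\<one>\<^bsub>cochain_group p X\<^esub> \<otimes>\<^bsub>cochain_group p X\<^esub> a = a"
    if "a \<in> carrier (cochain_group p X)" for a
    using that by (fastforce simp: cochain_group_def extensional_def)
qed (auto simp: carrier_cochain_group singular_chain_add cochain_group_def hom_def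
        integer_group_def algebra_simps)

lemma coboundary_hom: "coboundary p X \<in> hom (cochain_group p X) (cochain_group (Suc p) X)"
  by (auto simp: hom_def integer_group_def coboundary_def cochain_group_def chain_boundary_add
      singular_chain_add singular_chain_boundary_alt)

lemma coboundary_coboundary:
  assumes "a \<in> carrier (cochain_group p X)"
  shows "coboundary (Suc p) X (coboundary p X a) = \<one>\<^bsub>cochain_group (Suc (Suc p)) X\<^esub>"
proof -
  have "a (0 + 0) = a 0 + a 0"
    using assms by (metis carrier_cochain_group singular_chain_0)
  then have "a 0 = 0" by simp
  then show ?thesis
    by (auto simp: coboundary_def cochain_group_def chain_boundary_boundary_alt
        singular_chain_boundary_alt)
qed

lemma coboundary_group_hom:
  "group_hom (cochain_group p X) (cochain_group (Suc p) X) (coboundary p X)"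
  by (simp add: group_hom_def group_hom_axioms_def coboundary_hom
      comm_group.axioms(2) comm_group_cochain_group)

lemma subgroup_cocycle_set: "subgroup (cocycle_set p X) (cochain_group p X)"
  using group_hom.subgroup_kernel[OF coboundary_group_hom, of p X]
  by (simp add: kernel_def cocycle_set_def)

lemma comm_group_cocycle_group: "comm_group (cocycle_group p X)"
  unfolding cocycle_group_def
proof (rule group.group_comm_groupI)
  show "group ((cochain_group p X)\<lparr>carrier := cocycle_set p X\<rparr>)"
    by (intro subgroup.subgroup_is_group subgroup_cocycle_set comm_group.axioms(2) comm_group_cochain_group)
qed (auto simp: cocycle_set_def cochain_group_def add.commute)

lemma coboundary_subset_cocycle: "coboundary_set p X \<subseteq> cocycle_set p X"
proof (cases p)
  case 0
  then show ?thesis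
    using subgroup.one_closed[OF subgroup_cocycle_set] by (auto simp: coboundary_set_def)
next
  case (Suc q)
  then show ?thesis
    using coboundary_hom[of q X]
    by (auto simp: coboundary_set_def cocycle_set_def coboundary_coboundary hom_def Pi_iff)
qed

lemma subgroup_coboundary_set: "subgroup (coboundary_set p X) (cochain_group p X)"
proof (cases p)
  case 0
  then show ?thesis
    by (simp add: coboundary_set_def group.triv_subgroup comm_group.axioms(2) comm_group_cochain_group)
next
  case (Suc q)
  then show ?thesis
    using group_hom.img_is_subgroup[OF coboundary_group_hom, of q X]
    by (simp add: coboundary_set_def)
qed

lemma group_cohomology_group: "group (cohomology_group p X)"
proof -
  have "subgroup (coboundary_set p X) (cocycle_group p X)"
    unfolding cocycle_group_def
    by (intro group.subgroup_incl subgroup_coboundary_set subgroup_cocycle_set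
        coboundary_subset_cocycle comm_group.axioms(2) comm_group_cochain_group)
  then show ?thesis
    by (simp add: cohomology_group_def normal.factorgroup_is_group
        comm_group.normal_iff_subgroup comm_group_cocycle_group)
qed


section \<open>Flows and attractors\<close>

definition continuous_flow :: "'a topology \<Rightarrow> ('a \<Rightarrow> real \<Rightarrow> 'a) \<Rightarrow> bool" where
  "continuous_flow M \<phi> \<longleftrightarrow>
     continuous_map (prod_topology M euclideanreal) M (\<lambda>(x, t). \<phi> x t) \<and>
     (\<forall>x\<in>topspace M. \<phi> x 0 = x) \<and>
     (\<forall>x\<in>topspace M. \<forall>s t. \<phi> (\<phi> x s) t = \<phi> x (s + t))"

definition set_neighbourhood :: "'a topology \<Rightarrow> 'a set \<Rightarrow> 'a set \<Rightarrow> bool" where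
  "set_neighbourhood M N K \<longleftrightarrow> N \<subseteq> topspace M \<and> K \<subseteq> M interior_of N"

definition omega_limit :: "'a topology \<Rightarrow> ('a \<Rightarrow> real \<Rightarrow> 'a) \<Rightarrow> 'a \<Rightarrow> 'a set" where
  "omega_limit M \<phi> x = (\<Inter>t\<in>{0..}. M closure_of (\<phi> x ` {t..}))"

definition J_plus :: "'a topology \<Rightarrow> ('a \<Rightarrow> real \<Rightarrow> 'a) \<Rightarrow> 'a \<Rightarrow> 'a set" where
  "J_plus M \<phi> x =
     (\<Inter>U\<in>{U. openin M U \<and> x \<in> U}. \<Inter>t\<in>{0..}. M closure_of (\<Union>y\<in>U. \<phi> y ` {t..}))"

definition invariant_set :: "('a \<Rightarrow> real \<Rightarrow> 'a) \<Rightarrow> 'a set \<Rightarrow> bool" where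
  "invariant_set \<phi> K \<longleftrightarrow> (\<forall>x\<in>K. \<forall>t. \<phi> x t \<in> K)"

definition positively_invariant :: "('a \<Rightarrow> real \<Rightarrow> 'a) \<Rightarrow> 'a set \<Rightarrow> bool" where
  "positively_invariant \<phi> K \<longleftrightarrow> (\<forall>x\<in>K. \<forall>t\<ge>0. \<phi> x t \<in> K)"

definition isolated_invariant :: "'a topology \<Rightarrow> ('a \<Rightarrow> real \<Rightarrow> 'a) \<Rightarrow> 'a set \<Rightarrow> bool" where
  "isolated_invariant M \<phi> K \<longleftrightarrow>
     compactin M K \<and> invariant_set \<phi> K \<and>
     (\<exists>N. compactin M N \<and> set_neighbourhood M N K \<and> K = {x \<in> N. range (\<phi> x) \<subseteq> N})"

definition basin :: "'a topology \<Rightarrow> ('a \<Rightarrow> real \<Rightarrow> 'a) \<Rightarrow> 'a set \<Rightarrow> 'a set" where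
  "basin M \<phi> K = {x \<in> topspace M. omega_limit M \<phi> x \<noteq> {} \<and> omega_limit M \<phi> x \<subseteq> K}"

definition isolated_attractor :: "'a topology \<Rightarrow> ('a \<Rightarrow> real \<Rightarrow> 'a) \<Rightarrow> 'a set \<Rightarrow> bool" where
  "isolated_attractor M \<phi> K \<longleftrightarrow>
     isolated_invariant M \<phi> K \<and> set_neighbourhood M (basin M \<phi> K) K"

definition global_attractor :: "'a topology \<Rightarrow> ('a \<Rightarrow> real \<Rightarrow> 'a) \<Rightarrow> 'a set \<Rightarrow> bool" where
  "global_attractor M \<phi> K \<longleftrightarrow> isolated_attractor M \<phi> K \<and> basin M \<phi> K = topspace M"

definition stable_set :: "'a topology \<Rightarrow> ('a \<Rightarrow> real \<Rightarrow> 'a) \<Rightarrow> 'a set \<Rightarrow> bool" where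
  "stable_set M \<phi> K \<longleftrightarrow>
     (\<forall>N. set_neighbourhood M N K \<longrightarrow>
        (\<exists>P. set_neighbourhood M P K \<and> P \<subseteq> N \<and> positively_invariant \<phi> P))"

definition no_external_explosions :: "'a topology \<Rightarrow> ('a \<Rightarrow> real \<Rightarrow> 'a) \<Rightarrow> 'a set \<Rightarrow> bool" where
  "no_external_explosions M \<phi> K \<longleftrightarrow> (\<forall>x\<in>basin M \<phi> K - K. J_plus M \<phi> x \<subseteq> K)"

end

theory Submission
  imports Defs
begin

text \<open>A cocycle \<open>a\<close> of degree one that is not a coboundary has integer primitives \<open>g i\<close> on finitely many
  chart balls \<open>W i\<close>, and on overlaps they differ by locally constant integers. A partition of unity
  combines them into a function \<open>U\<close> for which each \<open>U - g i\<close> is twice differentiable on \<open>W i\<close>; thus \<open>U\<close> is a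
  circle-valued function with the periods of \<open>a\<close>. After a generic perturbation in each chart, the level
  \<open>{x. U x \<in> \<int>}\<close> contains no critical points. Moving this level in one chart after another, along
  directions in which \<open>U\<close> increases, gives a two-sided collar of it.

  Some component \<open>C\<close> of the level does not separate the manifold: otherwise the indicators of the upper
  sides of the finitely many components would remove the jumps of \<open>\<lfloor>U\<rfloor>\<close>, and \<open>a\<close> would be a coboundary. Let
  the flow run across the collar \<open>C \<times> {-1<..<1}\<close> from the lower to the upper side and fix all points of its
  complement \<open>K\<close>. Orbits outside \<open>K\<close> leave \<open>K\<close> at the lower side and return to it at the upper side, so \<open>K\<close>
  is an unstable global attractor, and it is connected.\<close>

section \<open>Cocycles of degree one\<close>

text \<open>Two constructions replace the usual tools. Regularity of the level comes from maps into
  a space of one more dimension, whose images are null as soon as the maps are differentiable: a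
  bump times an affine function has a slope and a constant as parameters, one more than the
  dimension. These maps contain one gradient, which is why two derivatives of \<open>U\<close> are
  carried along. The collar is built without vector fields. In \<open>M\<close> times an interval,
  the pairs \<open>(x, t)\<close> with \<open>U x - t * \<Lambda> x\<close> an integer form a tube.
  For weight 0 it is the product of the level and the interval; for a weight positive on the level,
  and a short interval, it is a graph over an open neighbourhood of the level. Raising the weight by
  one bump at a time changes the tube in one chart only, where points are moved along a fixed
  direction. Since \<open>t\<close> is preserved, the sign of the collar coordinate is the sign of
  \<open>U\<close> minus the nearest integer, so \<open>\<lfloor>U\<rfloor>\<close> jumps exactly at
  the middle of the collar.\<close>

abbreviation vertex :: "nat \<Rightarrow> nat \<Rightarrow> real" where
  "vertex i \<equiv> (\<lambda>j. if j = i then 1 else 0)"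

text \<open>Singular simplices are extensional, hence the restriction to the standard
  simplex.\<close>

definition point_simplex :: "'a \<Rightarrow> (nat \<Rightarrow> real) \<Rightarrow> 'a" where
  "point_simplex x = (\<lambda>_\<in>standard_simplex 0. x)"

lemma singular_simplex_0_iff:
  "singular_simplex 0 X \<sigma> \<longleftrightarrow> (\<exists>x\<in>topspace X. \<sigma> = point_simplex x)"
proof
  assume s: "singular_simplex 0 X \<sigma>"
  then have "\<sigma> (vertex 0) \<in> topspace X"
    unfolding singular_simplex_def continuous_map_def by (auto simp: Pi_iff)
  moreover have "\<sigma> = point_simplex (\<sigma> (vertex 0))"
    using s unfolding singular_simplex_def point_simplex_def standard_simplex_0
    by (intro ext) (simp add: extensional_def)
  ultimately show "\<exists>x\<in>topspace X. \<sigma> = point_simplex x" by blast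
next
  assume "\<exists>x\<in>topspace X. \<sigma> = point_simplex x"
  then show "singular_simplex 0 X \<sigma>"
    by (auto simp: singular_simplex_def point_simplex_def)
qed

lemma point_simplex_vertex [simp]: "point_simplex x (vertex 0) = x"
  by (simp add: point_simplex_def)

text \<open>Faces are restricted to the 0-simplex, which is a single point, so they are point
  simplices for any function \<sigma>.\<close>

lemma chain_boundary_1:
  "chain_boundary (Suc 0) (frag_of \<sigma>) = frag_of (point_simplex (\<sigma> (vertex 1))) - frag_of (point_simplex (\<sigma> (vertex 0)))"
proof -
  have "singular_face (Suc 0) 0 \<sigma> = point_simplex (\<sigma> (vertex 1))"
       "singular_face (Suc 0) 1 \<sigma> = point_simplex (\<sigma> (vertex 0))"
    by (auto simp: singular_face_def point_simplex_def standard_simplex_0 simplical_face_def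
        fun_eq_iff intro!: arg_cong[where f=\<sigma>])
  then show ?thesis
    by (simp add: chain_boundary_of)
qed

section \<open>Primitives of a cocycle on a contractible set\<close>

lemma ex_path_simplex:
  assumes "path_connected_space X" "x \<in> topspace X" "y \<in> topspace X"
  obtains \<sigma> where "singular_simplex (Suc 0) X \<sigma>" "\<sigma> (vertex 0) = x" "\<sigma> (vertex 1) = y"
proof -
  obtain g where g: "pathin X g" "g 0 = x" "g 1 = y"
    using assms unfolding path_connected_space_def by blast
  \<comment> \<open>The barycentric coordinate \<open>v 1\<close> identifies the 1-simplex with the
    unit interval.\<close>
  let ?\<sigma> = "\<lambda>v\<in>standard_simplex (Suc 0). g (v 1)"
  have "continuous_map (subtopology (powertop_real UNIV) (standard_simplex (Suc 0))) (top_of_set {0..1}) (\<lambda>v. v 1)"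
    using standard_simplex_01[of "Suc 0"]
    by (auto simp: continuous_map_in_subtopology continuous_map_from_subtopology PiE_def Pi_iff subset_iff
        intro!: continuous_map_from_subtopology continuous_map_product_projection)
  then have "continuous_map (subtopology (powertop_real UNIV) (standard_simplex (Suc 0))) X (g \<circ> (\<lambda>v. v 1))"
    using g(1) unfolding pathin_def by (rule continuous_map_compose)
  then have "singular_simplex (Suc 0) X ?\<sigma>"
    unfolding singular_simplex_def
    by (auto intro: continuous_map_eq)
  then show thesis
    using g(2,3) by (intro that[of ?\<sigma>]) auto
qed

text \<open>The homotopy from the identity to a constant map makes the cycle homologous to its image
  in a one-point space, and there every chain of odd degree is a boundary.\<close>

lemma contractible_cycle_is_boundary:
  assumes "contractible_space X" "singular_chain (Suc 0) X c" "chain_boundary (Suc 0) c = 0"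
  obtains d where "singular_chain (Suc (Suc 0)) X d" "chain_boundary (Suc (Suc 0)) d = c"
proof -
  obtain z where z: "homotopic_with (\<lambda>x. True) X X id (\<lambda>x. z)"
    using assms(1) unfolding contractible_space_def by blast
  have rc: "singular_relcycle (Suc 0) X {} c"
    using assms by (simp add: singular_cycle)
  have hom: "homologous_rel (Suc 0) X {} (chain_map (Suc 0) id c) (chain_map (Suc 0) (\<lambda>x. z) c)"
    by (rule homotopic_imp_homologous_rel_chain_maps[OF _ rc]) (use z in auto)
  have "singular_relboundary (Suc 0) X {} (chain_map (Suc 0) (\<lambda>x. z) c)"
  proof (cases "topspace X = {}")
    \<comment> \<open>In an empty space the homotopy says nothing about where \<open>z\<close>
      lies.\<close>
    case True
    with assms(2) have "c = 0" by (simp add: singular_chain_empty)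
    then show ?thesis by simp
  next
    case False
    then have zX: "z \<in> topspace X"
      using homotopic_with_imp_continuous_maps[OF z] by (auto simp: continuous_map_def)
    let ?Z = "subtopology X {z}"
    have "singular_chain (Suc 0) ?Z (chain_map (Suc 0) (\<lambda>x. z) c)"
      by (rule singular_chain_chain_map[OF assms(2)]) (use zX in auto)
    then have "singular_relboundary (Suc 0) ?Z {} (chain_map (Suc 0) (\<lambda>x. z) c)"
      using singular_boundary_singleton[of ?Z z "Suc 0"] zX by simp
    then show ?thesis
      using singular_boundary_mono[of "{z}" UNIV "Suc 0" X] by simp
  qed
  moreover have "chain_map (Suc 0) id c = c"
    using assms(2) by (rule chain_map_id_gen) auto
  ultimately have "singular_relboundary (Suc 0) X {} c"
    using hom unfolding homologous_rel_def
    by (metis add.commute diff_add_cancel singular_relboundary_add)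
  then show thesis
    using that by (auto simp: singular_boundary)
qed

lemma cocycle_add:
  assumes "a \<in> carrier (cochain_group p M)"
  shows "singular_chain p M c \<Longrightarrow> singular_chain p M d \<Longrightarrow> a (c + d) = a c + a d"
    and "a 0 = 0"
    and "singular_chain p M c \<Longrightarrow> a (- c) = - a c"
    and "singular_chain p M c \<Longrightarrow> singular_chain p M d \<Longrightarrow> a (c - d) = a c - a d"
proof -
  show add: "a (c + d) = a c + a d" if "singular_chain p M c" "singular_chain p M d" for c d
    using assms carrier_cochain_group that by blast
  show z: "a 0 = 0" using add[of 0 0] by simp
  show neg: "a (- c) = - a c" if "singular_chain p M c" for c
    using add[of c "-c"] that z by (simp add: singular_chain_minus)
  show "a (c - d) = a c - a d" if "singular_chain p M c" "singular_chain p M d" for c d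
    using add[of c "-d"] neg[of d] that by (simp add: singular_chain_minus)
qed

lemma cocycle_boundary:
  assumes "a \<in> cocycle_set p M" "singular_chain (Suc p) M c"
  shows "a (chain_boundary (Suc p) c) = 0"
proof -
  have "coboundary p M a c = 0"
    using assms by (simp add: cocycle_set_def cochain_group_def)
  then show ?thesis using assms(2) by (simp add: coboundary_def)
qed

text \<open>Integrate \<open>a\<close> along chosen paths from a base point \<open>z\<close>. An
  edge and the chosen paths to its two ends form a cycle; it bounds, and \<open>a\<close> vanishes
  on boundaries.\<close>

lemma cocycle_primitive:
  assumes a: "a \<in> cocycle_set 1 M" and W: "contractible_space (subtopology M W)"
  obtains g :: "'a \<Rightarrow> int" where
    "\<And>\<sigma>. singular_simplex 1 (subtopology M W) \<sigma> \<Longrightarrow> a (frag_of \<sigma>) = g (\<sigma> (vertex 1)) - g (\<sigma> (vertex 0))"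
proof -
  let ?X = "subtopology M W"
  have ac: "a \<in> carrier (cochain_group 1 M)" using a by (simp add: cocycle_set_def)
  have pc: "path_connected_space ?X"
    using W by (rule contractible_imp_path_connected_space)
  obtain z where z: "z \<in> topspace ?X \<or> topspace ?X = {}" by blast
  define \<gamma> where "\<gamma> x = (SOME \<sigma>. singular_simplex (Suc 0) ?X \<sigma> \<and> \<sigma> (vertex 0) = z \<and> \<sigma> (vertex 1) = x)" for x
  have \<gamma>: "singular_simplex (Suc 0) ?X (\<gamma> x)" "\<gamma> x (vertex 0) = z" "\<gamma> x (vertex 1) = x"
    if x: "x \<in> topspace ?X" for x
  proof -
    have "\<exists>\<sigma>. singular_simplex (Suc 0) ?X \<sigma> \<and> \<sigma> (vertex 0) = z \<and> \<sigma> (vertex 1) = x"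
      using ex_path_simplex[OF pc _ x, of z] x z by blast
    from someI_ex[OF this]
    show "singular_simplex (Suc 0) ?X (\<gamma> x)" "\<gamma> x (vertex 0) = z" "\<gamma> x (vertex 1) = x"
      unfolding \<gamma>_def by blast+
  qed
  show thesis
  proof (rule that[of "\<lambda>x. a (frag_of (\<gamma> x))"])
    fix \<sigma> assume s: "singular_simplex 1 ?X \<sigma>"
    then have v: "\<sigma> (vertex 0) \<in> topspace ?X" "\<sigma> (vertex 1) \<in> topspace ?X"
      unfolding singular_simplex_def continuous_map_def by (auto simp: Pi_iff)
    let ?c = "frag_of \<sigma> + frag_of (\<gamma> (\<sigma> (vertex 0))) - frag_of (\<gamma> (\<sigma> (vertex 1)))"
    have ch: "singular_chain (Suc 0) ?X (frag_of \<sigma>)" "singular_chain (Suc 0) ?X (frag_of (\<gamma> (\<sigma> (vertex 0))))"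
      "singular_chain (Suc 0) ?X (frag_of (\<gamma> (\<sigma> (vertex 1))))"
      using s \<gamma> v by (auto simp: singular_chain_of)
    then have c: "singular_chain (Suc 0) ?X ?c"
      by (intro singular_chain_add singular_chain_diff)
    have "chain_boundary (Suc 0) ?c = 0"
      using \<gamma>[OF v(1)] \<gamma>[OF v(2)] by (simp only: chain_boundary_add chain_boundary_diff chain_boundary_1) simp
    then obtain d where d: "singular_chain (Suc (Suc 0)) ?X d" "chain_boundary (Suc (Suc 0)) d = ?c"
      using contractible_cycle_is_boundary[OF W c] by blast
    have M: "singular_chain p ?X e \<Longrightarrow> singular_chain p M e" for p e
      by (simp add: singular_chain_subtopology)
    have "a ?c = 0"
      using cocycle_boundary[of a "Suc 0" M d] a M d by simp
    moreover have "a ?c = a (frag_of \<sigma>) + a (frag_of (\<gamma> (\<sigma> (vertex 0)))) - a (frag_of (\<gamma> (\<sigma> (vertex 1))))"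
      using cocycle_add[OF ac] ch[THEN M] by (simp add: singular_chain_add)
    ultimately show "a (frag_of \<sigma>) = a (frag_of (\<gamma> (\<sigma> (vertex 1)))) - a (frag_of (\<gamma> (\<sigma> (vertex 0))))"
      by simp
  qed
qed

text \<open>The additive extension of \<beta> to chains. Since \<open>frag_extend\<close> takes
  values in a free abelian group, integers are encoded as multiples of the generator of the one on
  \<open>unit\<close>.\<close>

definition chain_eval :: "('b \<Rightarrow> int) \<Rightarrow> ('b \<Rightarrow>\<^sub>0 int) \<Rightarrow> int" where
  "chain_eval \<beta> c = Poly_Mapping.lookup (frag_extend (\<lambda>\<sigma>. frag_cmul (\<beta> \<sigma>) (frag_of ())) c) ()"

lemma chain_eval_simps [simp]:
  "chain_eval \<beta> (frag_of \<sigma>) = \<beta> \<sigma>"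
  "chain_eval \<beta> (c + d) = chain_eval \<beta> c + chain_eval \<beta> d"
  "chain_eval \<beta> (c - d) = chain_eval \<beta> c - chain_eval \<beta> d"
  "chain_eval \<beta> 0 = 0"
  by (simp_all add: chain_eval_def frag_extend_add frag_extend_diff lookup_add lookup_minus)

text \<open>Barycentric subdivision reduces the claim to simplices inside the sets of the cover; the
  subdivision homotopy is natural in the space, so its value at a point is a chain in that point.\<close>

lemma cocycle_exact_if_locally_exact:
  assumes a: "a \<in> cocycle_set 1 M"
    and W: "\<And>i. i \<in> I \<Longrightarrow> openin M (W i)" "topspace M \<subseteq> (\<Union>i\<in>I. W i)"
    and b: "\<And>i \<sigma>. i \<in> I \<Longrightarrow> singular_simplex 1 (subtopology M (W i)) \<sigma> \<Longrightarrow>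
              a (frag_of \<sigma>) = b (\<sigma> (vertex 1)) - b (\<sigma> (vertex 0))"
  shows "a \<in> coboundary_set 1 M"
proof -
  have ac: "a \<in> carrier (cochain_group 1 M)" using a by (simp add: cocycle_set_def)
  define B where "B = chain_eval (\<lambda>\<sigma>. b (\<sigma> (vertex 0)))"
  \<comment> \<open>\<alpha> measures how far \<open>a\<close> is from the coboundary of
    \<open>B\<close>; the goal is that it vanishes on all 1-chains.\<close>
  define \<alpha> where "\<alpha> c = a c - B (chain_boundary (Suc 0) c)" for c
  have B_edge: "B (chain_boundary (Suc 0) (frag_of \<sigma>)) = b (\<sigma> (vertex 1)) - b (\<sigma> (vertex 0))" for \<sigma>
    by (simp add: B_def chain_boundary_1)
  have \<alpha>_diff: "\<alpha> (c - d) = \<alpha> c - \<alpha> d" if "singular_chain 1 M c" "singular_chain 1 M d" for c d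
    using cocycle_add[OF ac] that by (simp add: \<alpha>_def B_def chain_boundary_diff)
  have \<alpha>_0: "\<alpha> 0 = 0"
    using cocycle_add[OF ac] by (simp add: \<alpha>_def B_def)
  have \<alpha>_add: "\<alpha> (c + d) = \<alpha> c + \<alpha> d" if "singular_chain 1 M c" "singular_chain 1 M d" for c d
    using cocycle_add[OF ac] that by (simp add: \<alpha>_def B_def chain_boundary_add)
  have small: "\<alpha> c = 0" if "singular_chain 1 M c"
      "Poly_Mapping.keys c \<subseteq> {\<sigma>. \<exists>i\<in>I. singular_simplex 1 (subtopology M (W i)) \<sigma>}" for c
  proof -
    have "singular_chain 1 M c \<and> \<alpha> c = 0"
      using that(2)
    proof (induction rule: frag_induction)
      case (one \<sigma>)
      then show ?case
        using b B_edge[of \<sigma>] by (auto simp: \<alpha>_def singular_chain_of singular_simplex_subtopology)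
    qed (auto simp: \<alpha>_0 \<alpha>_diff singular_chain_diff)
    then show ?thesis by simp
  qed
  have edge: "\<alpha> (frag_of \<sigma>) = 0" if \<sigma>: "singular_simplex 1 M \<sigma>" for \<sigma>
  proof -
    have c: "singular_chain (Suc 0) M (frag_of \<sigma>)" using \<sigma> by (simp add: singular_chain_of)
    obtain n where n: "\<And>m f. \<lbrakk>n \<le> m; f \<in> Poly_Mapping.keys ((singular_subdivision (Suc 0) ^^ m) (frag_of \<sigma>))\<rbrakk>
                      \<Longrightarrow> \<exists>V \<in> W ` I. f \<in> standard_simplex (Suc 0) \<rightarrow> V"
      by (rule sufficient_iterated_singular_subdivision_exists[of "W ` I" M "Suc 0" "frag_of \<sigma>"])
        (use W c in auto)
    obtain h where hd: "\<And>p c1 c2. h p (c1-c2) = h p c1 - (h p c2 :: 'a chain)"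
      and hc: "\<And>p X c. singular_chain p X c \<Longrightarrow> singular_chain (Suc p) X (h p c)"
      and hb: "\<And>p X c. singular_chain p X c
                 \<Longrightarrow> chain_boundary (Suc p) (h p c) + h (p - Suc 0) (chain_boundary p c)
                   = (singular_subdivision p ^^ n) c - c"
      using chain_homotopic_iterated_singular_subdivision[of n] by metis
    let ?s = "(singular_subdivision (Suc 0) ^^ n) (frag_of \<sigma>)"
    have s: "singular_chain 1 M ?s"
    proof -
      have "singular_chain (Suc 0) M ((singular_subdivision (Suc 0) ^^ k) (frag_of \<sigma>))" for k
        by (induction k) (auto simp: singular_chain_singular_subdivision c)
      then show ?thesis by simp
    qed
    have "\<alpha> ?s = 0"
    proof (rule small[OF s], clarsimp)
      fix f assume f: "f \<in> Poly_Mapping.keys ?s"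
      with n[OF order_refl f] s show "\<exists>i\<in>I. singular_simplex (Suc 0) (subtopology M (W i)) f"
        by (auto simp: singular_simplex_subtopology singular_chain_def)
    qed
    have pt: "\<alpha> (h 0 (frag_of (point_simplex x))) = 0" if x: "x \<in> topspace M" for x
    proof -
      obtain i where i: "i \<in> I" "x \<in> W i" using W(2) x by blast
      have "singular_chain 0 (subtopology M (W i)) (frag_of (point_simplex x))"
        using x i by (auto simp: singular_chain_of singular_simplex_0_iff)
      from hc[OF this] have k: "singular_chain 1 (subtopology M (W i)) (h 0 (frag_of (point_simplex x)))" by simp
      show ?thesis
      proof (rule small)
        show "singular_chain 1 M (h 0 (frag_of (point_simplex x)))"
          using k by (simp add: singular_chain_subtopology)
      qed (use k i in \<open>auto simp: singular_chain_def\<close>)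
    qed
    have v: "\<sigma> (vertex 0) \<in> topspace M" "\<sigma> (vertex 1) \<in> topspace M"
      using \<sigma> unfolding singular_simplex_def continuous_map_def by (auto simp: Pi_iff)
    have hpt: "singular_chain 1 M (h 0 (frag_of (point_simplex x)))" if "x \<in> topspace M" for x
      using hc[of 0 M "frag_of (point_simplex x)"] that by (auto simp: singular_chain_of singular_simplex_0_iff)
    have hbd: "\<alpha> (h 0 (chain_boundary (Suc 0) (frag_of \<sigma>))) = 0"
      using pt v hpt by (simp only: chain_boundary_1 hd \<alpha>_diff) 
    have hbc: "singular_chain 1 M (h 0 (chain_boundary (Suc 0) (frag_of \<sigma>)))"
      using hpt v by (simp only: chain_boundary_1 hd singular_chain_diff)
    have h2: "singular_chain (Suc 1) M (h 1 (frag_of \<sigma>))"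
      using hc c by simp
    then have bd: "singular_chain 1 M (chain_boundary (Suc 1) (h 1 (frag_of \<sigma>)))"
      using singular_chain_boundary_alt by blast
    have "\<alpha> (chain_boundary (Suc 1) (h 1 (frag_of \<sigma>))) = 0"
      using cocycle_boundary[OF a h2] chain_boundary_boundary_alt[of "Suc 0" M "h 1 (frag_of \<sigma>)"] h2
      by (simp add: \<alpha>_def B_def)
    \<comment> \<open>The homotopy formula solved for the edge. On the right, \<alpha> kills the
      subdivision because its simplices are small, the boundary because \<open>a\<close> is a
      cocycle, and the last chain because it comes from the end points.\<close>
    moreover have "frag_of \<sigma> = ?s - (chain_boundary (Suc 1) (h 1 (frag_of \<sigma>)) + h 0 (chain_boundary (Suc 0) (frag_of \<sigma>)))"
      using hb[OF c] by simp
    ultimately show ?thesis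
      using \<alpha>_diff[OF s] \<alpha>_add[OF bd hbc] hbd \<open>\<alpha> ?s = 0\<close> singular_chain_add[OF bd hbc]
      by (metis add_0 diff_self)
  qed
  have zero: "\<alpha> c = 0" if "singular_chain 1 M c" for c
  proof -
    have "singular_chain 1 M c \<and> \<alpha> c = 0"
      using that unfolding singular_chain_def
    proof (induction rule: frag_induction)
      case (one \<sigma>) then show ?case using edge by auto
    next
      case (diff c d)
      then show ?case using \<alpha>_diff[of c d] singular_chain_diff[of 1 M c d] unfolding singular_chain_def by simp
    qed (simp add: \<alpha>_0)
    then show ?thesis by simp
  qed
  define \<beta> where "\<beta> = (\<lambda>c\<in>singular_chain_set 0 M. B c)"
  have "\<beta> \<in> carrier (cochain_group 0 M)"
    by (auto simp: carrier_cochain_group \<beta>_def B_def singular_chain_add)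
  moreover have "a = coboundary 0 M \<beta>"
  proof
    fix c show "a c = coboundary 0 M \<beta> c"
    proof (cases "singular_chain 1 M c")
      case True
      then show ?thesis using zero[OF True] singular_chain_boundary_alt[of 0 M c]
        by (simp add: coboundary_def \<beta>_def \<alpha>_def)
    next
      case False
      then show ?thesis using ac by (auto simp: carrier_cochain_group coboundary_def extensional_def)
    qed
  qed
  ultimately show ?thesis
    by (auto simp: coboundary_set_def)
qed

section \<open>From a nonzero class to local primitives\<close>

lemma ex_nonexact_cocycle:
  assumes "\<not> trivial_group (cohomology_group 1 M)"
  obtains a where "a \<in> cocycle_set 1 M" "a \<notin> coboundary_set 1 M"
proof -
  have "trivial_group (cohomology_group 1 M)" if sub: "cocycle_set 1 M \<subseteq> coboundary_set 1 M"
  proof -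
    have eq: "coboundary_set 1 M = carrier (cocycle_group 1 M)"
      using sub coboundary_subset_cocycle[of 1 M] by (simp add: cocycle_group_def)
    interpret G: comm_group "cocycle_group 1 M" by (rule comm_group_cocycle_group)
    have "carrier (cocycle_group 1 M) #>\<^bsub>cocycle_group 1 M\<^esub> x = carrier (cocycle_group 1 M)"
      if "x \<in> carrier (cocycle_group 1 M)" for x
      using that G.coset_join2 G.subgroup_self by blast
    then have "carrier (cohomology_group 1 M) = {carrier (cocycle_group 1 M)}"
      unfolding cohomology_group_def eq using G.one_closed
      by (auto simp: FactGroup_def RCOSETS_def)
    then show ?thesis
      using group_cohomology_group[of 1 M] unfolding trivial_group_def
      by (metis group.is_monoid monoid.one_closed singletonD)
  qed
  then show thesis using assms that by blast
qed

text \<open>Two primitives of the same cocycle differ by a constant on path connected sets. The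
  second conclusion is the form in which nontriviality of the class is kept: if some
  \<open>b\<close> made every \<open>b + g i\<close> constant, then \<open>- b\<close> would be a
  primitive of \<open>a\<close> on every \<open>W i\<close>.\<close>

lemma ex_local_primitives:
  assumes nt: "\<not> trivial_group (cohomology_group 1 M)"
    and W: "\<And>i. i \<in> I \<Longrightarrow> openin M (W i)" "topspace M \<subseteq> (\<Union>i\<in>I. W i)"
    and contr: "\<And>i. i \<in> I \<Longrightarrow> contractible_space (subtopology M (W i))"
  obtains g :: "'i \<Rightarrow> 'a \<Rightarrow> int" where
    "\<And>i j V x y. \<lbrakk>i \<in> I; j \<in> I; path_connectedin M V; V \<subseteq> W i \<inter> W j; x \<in> V; y \<in> V\<rbrakk>
        \<Longrightarrow> g i x - g j x = g i y - g j y"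
    "\<And>b. \<exists>i\<in>I. \<exists>x\<in>W i. \<exists>y\<in>W i. b x + g i x \<noteq> b y + g i y"
proof -
  obtain a where a: "a \<in> cocycle_set 1 M" "a \<notin> coboundary_set 1 M"
    using ex_nonexact_cocycle[OF nt] .
  define g where "g i = (SOME g. \<forall>\<sigma>. singular_simplex 1 (subtopology M (W i)) \<sigma> \<longrightarrow>
      a (frag_of \<sigma>) = g (\<sigma> (vertex 1)) - g (\<sigma> (vertex 0)))" for i
  have g: "a (frag_of \<sigma>) = g i (\<sigma> (vertex 1)) - g i (\<sigma> (vertex 0))"
    if "i \<in> I" "singular_simplex 1 (subtopology M (W i)) \<sigma>" for i \<sigma>
  proof -
    have "\<exists>g. \<forall>\<sigma>. singular_simplex 1 (subtopology M (W i)) \<sigma> \<longrightarrow>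
      a (frag_of \<sigma>) = g (\<sigma> (vertex 1)) - g (\<sigma> (vertex 0))"
      using cocycle_primitive[OF a(1) contr[OF that(1)]] by metis
    from someI_ex[OF this] show ?thesis
      using that(2) unfolding g_def by blast
  qed
  show thesis
  proof (rule that[of g])
    fix i j V x y
    assume ij: "i \<in> I" "j \<in> I" and V: "path_connectedin M V" "V \<subseteq> W i \<inter> W j" "x \<in> V" "y \<in> V"
    then have "path_connected_space (subtopology M V)" "x \<in> topspace (subtopology M V)" "y \<in> topspace (subtopology M V)"
      by (auto simp: path_connectedin_def)
    then obtain \<sigma> where \<sigma>: "singular_simplex (Suc 0) (subtopology M V) \<sigma>" "\<sigma> (vertex 0) = x" "\<sigma> (vertex 1) = y"
      by (rule ex_path_simplex)
    then have "singular_simplex 1 (subtopology M (W i)) \<sigma>" "singular_simplex 1 (subtopology M (W j)) \<sigma>"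
      using V(2) singular_simplex_mono[of "Suc 0" M V \<sigma>] by auto
    then show "g i x - g j x = g i y - g j y"
      using g[of i \<sigma>] g[of j \<sigma>] ij \<sigma>(2,3) by simp
  next
    fix b
    show "\<exists>i\<in>I. \<exists>x\<in>W i. \<exists>y\<in>W i. b x + g i x \<noteq> b y + g i y"
    proof (rule ccontr)
      assume const: "\<not> ?thesis"
      have "a \<in> coboundary_set 1 M"
      proof (rule cocycle_exact_if_locally_exact[OF a(1) W])
        fix i \<sigma> assume i: "i \<in> I" and \<sigma>: "singular_simplex 1 (subtopology M (W i)) \<sigma>"
        have "\<sigma> (vertex 0) \<in> W i" "\<sigma> (vertex 1) \<in> W i"
          using \<sigma> unfolding singular_simplex_def continuous_map_def by (auto simp: Pi_iff)
        then have "b (\<sigma> (vertex 0)) + g i (\<sigma> (vertex 0)) = b (\<sigma> (vertex 1)) + g i (\<sigma> (vertex 1))"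
          using const i by blast
        then show "a (frag_of \<sigma>) = - b (\<sigma> (vertex 1)) - - b (\<sigma> (vertex 0))"
          using g[OF i \<sigma>] by simp
      qed auto
      then show False using a(2) by simp
    qed
  qed
qed

section \<open>The flow along a collar\<close>

text \<open>The flow \<open>tanh (artanh r + t)\<close> on \<open>{-1<..<1}\<close>, in a form that extends to the end points.\<close>

definition segment_flow :: "real \<Rightarrow> real \<Rightarrow> real" where
  "segment_flow r t = (r + tanh t) / (1 + r * tanh t)"

lemma segment_flow_denom:
  assumes "\<bar>r\<bar> \<le> 1" shows "1 + r * tanh t > (0::real)"
proof -
  have "\<bar>r * tanh t\<bar> \<le> \<bar>tanh t\<bar>"
    using assms by (simp add: abs_mult mult_left_le_one_le)
  moreover have "\<bar>tanh t\<bar> < 1"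
    using tanh_real_lt_1[of t] tanh_real_gt_neg1[of t] by linarith
  ultimately show ?thesis by linarith
qed

lemma segment_flow_0 [simp]: "segment_flow r 0 = r"
  by (simp add: segment_flow_def)

lemma segment_flow_1 [simp]: "segment_flow 1 t = 1"
  using segment_flow_denom[of 1 t] by (simp add: segment_flow_def)

lemma segment_flow_minus_1 [simp]: "segment_flow (-1) t = -1"
  using segment_flow_denom[of "-1" t] by (simp add: segment_flow_def field_simps)

lemma tanh_artanh_real:
  assumes "\<bar>x\<bar> < (1::real)" shows "tanh (artanh x) = x"
proof -
  have "exp (- (2 * artanh x)) = (1 - x) / (1 + x)"
    using assms by (simp add: artanh_def exp_minus)
  then have "tanh (artanh x) = (1 - (1 - x) / (1 + x)) / (1 + (1 - x) / (1 + x))"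
    by (simp add: tanh_real_altdef mult.commute)
  also have "\<dots> = x" using assms by (simp add: field_simps)
  finally show ?thesis .
qed

lemma segment_flow_tanh:
  assumes "\<bar>r\<bar> < 1" shows "segment_flow r t = tanh (artanh r + t)"
  using assms by (simp add: segment_flow_def tanh_add tanh_artanh_real)

lemma segment_flow_bounds:
  assumes "\<bar>r\<bar> < 1" shows "\<bar>segment_flow r t\<bar> < 1"
  unfolding segment_flow_tanh[OF assms] using tanh_real_lt_1 tanh_real_gt_neg1 by (simp add: abs_less_iff minus_less_iff)

lemma segment_flow_cases:
  assumes "\<bar>r\<bar> \<le> (1::real)" obtains "r = 1" | "r = -1" | "\<bar>r\<bar> < 1"
  using assms by linarith

lemma segment_flow_bounds_le:
  assumes "\<bar>r\<bar> \<le> 1" shows "\<bar>segment_flow r t\<bar> \<le> 1"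
  using assms by (cases rule: segment_flow_cases) (auto dest: segment_flow_bounds[of r t])

lemma segment_flow_add:
  assumes "\<bar>r\<bar> \<le> 1" shows "segment_flow (segment_flow r s) t = segment_flow r (s + t)"
  using assms
proof (cases rule: segment_flow_cases)
  case 3
  have "segment_flow r s = tanh (artanh r + s)" by (rule segment_flow_tanh[OF 3])
  then show ?thesis
    using segment_flow_bounds[OF 3, of s] 3 by (simp add: segment_flow_tanh artanh_tanh_real add.assoc)
qed auto

text \<open>The waiting time depends on \<open>r0\<close> and \<open>c\<close> but not on
  \<open>r\<close>. This uniformity controls all orbits starting near a point, as
  \<open>J_plus\<close> requires.\<close>

lemma segment_flow_tail:
  assumes "-1 < r0" "r0 < r" "r < 1" "-1 < c" "c < 1" "artanh c - artanh r0 \<le> t"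
  shows "c \<le> segment_flow r t"
proof -
  have "artanh r0 \<le> artanh r"
    using assms by (smt (verit) artanh_tanh_real tanh_artanh_real tanh_real_le_iff)
  then have "tanh (artanh c) \<le> tanh (artanh r + t)"
    using assms by simp
  then show ?thesis
    using assms by (simp add: segment_flow_tanh tanh_artanh_real)
qed

lemma continuous_on_segment_flow:
  "continuous_on ({-1..1} \<times> UNIV) (\<lambda>(r, t). segment_flow r t)"
  unfolding segment_flow_def case_prod_beta
  by (intro continuous_intros) (auto simp: less_imp_neq[OF segment_flow_denom, symmetric] abs_le_iff
      dest!: segment_flow_denom[unfolded abs_le_iff])

section \<open>Two-sided collars\<close>

abbreviation cylinder :: "'a topology \<Rightarrow> 'a set \<Rightarrow> ('a \<times> real) topology" where
  "cylinder M C \<equiv> prod_topology (subtopology M C) (top_of_set {-2<..<2})"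

text \<open>The parameter runs over \<open>{-2<..<2}\<close> so that the closed part over
  \<open>{-1..1}\<close>, which carries the flow, is a compact subset of an open one.\<close>

definition open_collar :: "'a topology \<Rightarrow> 'a set \<Rightarrow> ('a \<times> real \<Rightarrow> 'a) \<Rightarrow> ('a \<Rightarrow> 'a \<times> real) \<Rightarrow> bool" where
  "open_collar M C h k \<longleftrightarrow> compactin M C \<and> openin M (h ` (C \<times> {-2<..<2})) \<and>
     homeomorphic_maps (cylinder M C)
       (subtopology M (h ` (C \<times> {-2<..<2}))) h k"

context
  fixes M :: "'a topology" and C h k
  assumes comp: "compact_space M" and haus: "Hausdorff_space M" and coll: "open_collar M C h k"
begin

lemma collar_subset: "C \<subseteq> topspace M"
  using coll by (simp add: open_collar_def compactin_subset_topspace)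

lemma collar_cont: "continuous_map (cylinder M C) M h"
  using coll by (auto simp: open_collar_def homeomorphic_maps_def continuous_map_in_subtopology)

lemma collar_inv_cont: "continuous_map (subtopology M (h ` (C \<times> {-2<..<2})))
    (cylinder M C) k"
  using coll by (auto simp: open_collar_def homeomorphic_maps_def)

lemma collar_inv [simp]: "s \<in> C \<Longrightarrow> -2 < r \<Longrightarrow> r < 2 \<Longrightarrow> k (h (s, r)) = (s, r)"
  using coll collar_subset by (auto simp: open_collar_def homeomorphic_maps_def)

lemma collar_mem_iff:
  assumes "s \<in> C" "-2 < r" "r < 2" "D \<subseteq> C" "\<And>r. r \<in> J \<Longrightarrow> -2 < r \<and> r < 2"
  shows "h (s, r) \<in> h ` (D \<times> J) \<longleftrightarrow> s \<in> D \<and> r \<in> J"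
proof
  assume "h (s, r) \<in> h ` (D \<times> J)"
  then obtain s' r' where "s' \<in> D" "r' \<in> J" "h (s, r) = h (s', r')" by auto
  then have "(s, r) = (s', r')"
    using collar_inv[of s r] collar_inv[of s' r'] assms by (metis subsetD)
  then show "s \<in> D \<and> r \<in> J" using \<open>s' \<in> D\<close> \<open>r' \<in> J\<close> by auto
qed auto

lemma openin_collar_base: "openin (subtopology M C) C"
  using collar_subset openin_topspace[of "subtopology M C"] by (simp add: inf.absorb2)

lemma collar_in_topspace: "s \<in> C \<Longrightarrow> -2 < r \<Longrightarrow> r < 2 \<Longrightarrow> h (s, r) \<in> topspace M"
  using collar_cont collar_subset by (auto simp: continuous_map_def Pi_iff)

lemma collar_compact:
  assumes "compact J" "J \<subseteq> {-2<..<2}" "compactin M D" "D \<subseteq> C"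
  shows "compactin M (h ` (D \<times> J))"
proof (rule image_compactin[OF _ collar_cont])
  show "compactin (cylinder M C) (D \<times> J)"
    using assms coll by (auto simp: compactin_Times compactin_subtopology open_collar_def)
qed

lemma collar_closed:
  assumes "compact J" "J \<subseteq> {-2<..<2}" "compactin M D" "D \<subseteq> C"
  shows "closedin M (h ` (D \<times> J))"
  by (rule compactin_imp_closedin[OF haus collar_compact[OF assms]])

lemma collar_open:
  assumes "open J" "J \<subseteq> {-2<..<2}" "openin (subtopology M C) D"
  shows "openin M (h ` (D \<times> J))"
proof -
  have "homeomorphic_map (cylinder M C) (subtopology M (h ` (C \<times> {-2<..<2}))) h"
    using coll by (auto simp: open_collar_def homeomorphic_map_maps)
  moreover have "openin (cylinder M C) (D \<times> J)"
    using assms by (auto simp: openin_prod_Times_iff intro: open_subset)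
  ultimately have "openin (subtopology M (h ` (C \<times> {-2<..<2}))) (h ` (D \<times> J))"
    using homeomorphic_imp_open_map open_map_def by blast
  then show ?thesis
    using coll by (auto simp: open_collar_def intro: openin_trans_full)
qed

section \<open>The flow across the collar and its limit sets\<close>

definition collar_flow :: "'a \<Rightarrow> real \<Rightarrow> 'a" where
  "collar_flow x t = (if x \<in> h ` (C \<times> {-1..1}) then h (fst (k x), segment_flow (snd (k x)) t) else x)"

lemma collar_flow_h:
  assumes "s \<in> C" "\<bar>r\<bar> \<le> 1" shows "collar_flow (h (s, r)) t = h (s, segment_flow r t)"
proof -
  have "h (s, r) \<in> h ` (C \<times> {-1..1})" using assms by (auto simp: abs_le_iff)
  then show ?thesis using assms by (simp add: collar_flow_def)
qed

lemma collar_cases: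
  assumes "x \<in> topspace M"
  obtains (inside) s r where "s \<in> C" "\<bar>r\<bar> < 1" "x = h (s, r)"
    | (outside) "x \<in> topspace M - h ` (C \<times> {-1<..<1})"
  using assms by (force simp: abs_less_iff)

lemma collar_flow_outside:
  assumes "x \<in> topspace M - h ` (C \<times> {-1<..<1})"
  shows "collar_flow x t = x"
proof (cases "x \<in> h ` (C \<times> {-1..1})")
  case True
  then obtain s r where sr: "s \<in> C" "-1 \<le> r" "r \<le> 1" "x = h (s, r)" by auto
  then have "r \<notin> {-1<..<1}" using assms by blast
  then have "r = 1 \<or> r = -1" using sr by auto
  then show ?thesis using collar_flow_h[of s r t] sr by auto
qed (simp add: collar_flow_def)

text \<open>Two closed sets are pasted: the closed collar part \<open>B\<close>, with the end
  levels, and the complement \<open>K\<close> of the open part. They meet in the end levels, which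
  \<open>segment_flow\<close> fixes, so the two formulas agree there.\<close>

lemma continuous_flow_collar_flow: "continuous_flow M collar_flow"
  unfolding continuous_flow_def
proof (intro conjI ballI allI)
  define B where "B = h ` (C \<times> {-1..1})"
  define K where "K = topspace M - h ` (C \<times> {-1<..<1})"
  let ?P = "prod_topology M euclideanreal"
  let ?T = "\<lambda>b. if b then B \<times> UNIV else K \<times> UNIV"
  let ?F = "\<lambda>b. if b then \<lambda>(x, t). h (fst (k x), segment_flow (snd (k x)) t) else fst"
  have C: "compactin M C" using coll by (simp add: open_collar_def)
  have clB: "closedin M B" unfolding B_def by (rule collar_closed[OF _ _ C]) auto
  have opB: "openin M (h ` (C \<times> {-1<..<1}))"
    by (rule collar_open) (auto simp: openin_collar_base)
  have BK: "topspace M \<subseteq> B \<union> K"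
    unfolding B_def K_def by auto
  have flow_B: "collar_flow x t = h (fst (k x), segment_flow (snd (k x)) t)" if "x \<in> B" for x t
    using that by (simp add: collar_flow_def B_def)
  have flow_K: "collar_flow x t = x" if "x \<in> K" for x t
    using that by (simp add: collar_flow_outside K_def)
  have k_B: "snd (k x) \<in> {-1..1}" if "x \<in> B" for x
    using that by (auto simp: B_def)
  show "continuous_map ?P M (\<lambda>(x, t). collar_flow x t)"
  proof (rule pasting_lemma_closed[where I="{True,False}" and T="?T" and f="?F"])
    show "closedin ?P (?T b)" for b
      using clB opB by (auto simp: closedin_prod_Times_iff K_def)
    have kB: "continuous_map (subtopology M B) (prod_topology (subtopology M C) (top_of_set {-1..1})) k"
    proof -
      have "continuous_map (subtopology M B) (cylinder M C) k"
        by (rule continuous_map_from_subtopology_mono[OF collar_inv_cont]) (auto simp: B_def)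
      then have "continuous_map (subtopology M B) (subtopology M C) (fst \<circ> k)"
        "continuous_map (subtopology M B) euclideanreal (snd \<circ> k)"
        by (auto simp: continuous_map_pairwise continuous_map_in_subtopology)
      then show ?thesis
        using k_B by (auto simp: continuous_map_pairwise continuous_map_in_subtopology)
    qed
    have seg: "continuous_map (prod_topology (top_of_set {-1..1}) euclideanreal) (top_of_set {-1..1}) (\<lambda>(r, t). segment_flow r t)"
    proof -
      have "prod_topology (top_of_set {-1..1::real}) euclideanreal = top_of_set ({-1..1} \<times> UNIV)"
        using subtopology_Times[of euclideanreal euclideanreal "{-1..1}" UNIV] by simp
      then show ?thesis
        using continuous_on_segment_flow segment_flow_bounds_le
        by (auto simp: continuous_map_in_subtopology abs_le_iff)
    qed
    show "continuous_map (subtopology ?P (?T b)) M (?F b)" if "b \<in> {True,False}" for b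
    proof (cases b)
      case True
      let ?Q = "prod_topology (subtopology M B) euclideanreal"
      let ?s = "\<lambda>z. segment_flow (snd (k (fst z))) (snd z)"
      have Q: "subtopology ?P (B \<times> UNIV) = ?Q"
        by (simp add: subtopology_Times)
      have "continuous_map ?Q (prod_topology (subtopology M C) (top_of_set {-1..1})) (k \<circ> fst)"
        by (rule continuous_map_compose[OF continuous_map_fst kB])
      then have f: "continuous_map ?Q (subtopology M C) (\<lambda>z. fst (k (fst z)))"
        and s: "continuous_map ?Q (top_of_set {-1..1}) (\<lambda>z. snd (k (fst z)))"
        by (auto simp: continuous_map_pairwise o_def)
      have "continuous_map ?Q (prod_topology (top_of_set {-1..1}) euclideanreal) (\<lambda>z. (snd (k (fst z)), snd z))"
        using s by (simp add: continuous_map_pairwise o_def continuous_map_snd)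
      from continuous_map_compose[OF this seg]
      have "continuous_map ?Q (top_of_set {-1..1}) ?s"
        by (simp add: o_def)
      then have i: "continuous_map ?Q euclideanreal ?s"
        "?s \<in> topspace ?Q \<rightarrow> {-1..1}"
        unfolding continuous_map_in_subtopology by blast+
      have "?s \<in> topspace ?Q \<rightarrow> {-2<..<2}"
      proof
        fix z assume "z \<in> topspace ?Q"
        with i(2) have "?s z \<in> {-1..1}" by blast
        then show "?s z \<in> {-2<..<2}" by simp
      qed
      with i(1) have "continuous_map ?Q (top_of_set {-2<..<2}) ?s"
        unfolding continuous_map_in_subtopology by blast
      then have "continuous_map ?Q (cylinder M C)
          (\<lambda>z. (fst (k (fst z)), ?s z))"
        using f by (simp add: continuous_map_pairwise o_def)
      from continuous_map_compose[OF this collar_cont]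
      show ?thesis using True Q by (simp add: o_def case_prod_unfold)
    next
      case False
      then show ?thesis using continuous_map_from_subtopology[OF continuous_map_fst] by auto
    qed
    show "?F b z = ?F c z"
      if "b \<in> {True,False}" "c \<in> {True,False}"
        and z: "z \<in> topspace ?P \<inter> ?T b \<inter> ?T c" for b c z
      using z flow_B[of "fst z" "snd z"] flow_K[of "fst z" "snd z"]
      by (cases b; cases c) (auto simp: case_prod_unfold)
    show "\<exists>b. b \<in> {True,False} \<and> z \<in> ?T b \<and> (case z of (x, t) \<Rightarrow> collar_flow x t) = ?F b z"
      if z: "z \<in> topspace ?P" for z
    proof -
      consider "fst z \<in> B" | "fst z \<in> K" using z BK by auto
      then show ?thesis
      proof cases
        case 1
        then show ?thesis by (intro exI[of _ True]) (simp add: flow_B case_prod_unfold mem_Times_iff)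
      next
        case 2
        then show ?thesis by (intro exI[of _ False]) (simp add: flow_K case_prod_unfold mem_Times_iff)
      qed
    qed
  qed simp
next
  fix x assume x: "x \<in> topspace M"
  show "collar_flow x 0 = x"
    using x by (cases rule: collar_cases) (auto simp: collar_flow_h collar_flow_outside)
  fix s t
  show "collar_flow (collar_flow x s) t = collar_flow x (s + t)"
    using x
  proof (cases rule: collar_cases)
    case (inside c r)
    then show ?thesis using segment_flow_bounds_le[of r s]
      by (simp add: collar_flow_h segment_flow_add)
  qed (simp add: collar_flow_outside)
qed

text \<open>All points near \<open>h (s, r)\<close> have height above one \<open>r0 > -1\<close>, so
  for every \<open>c < 1\<close> a common waiting time lifts them to height at least
  \<open>c\<close>. The part of the collar with heights from \<open>c\<close> to 1 is closed and so
  contains \<open>J_plus\<close>; then let \<open>c\<close> tend to 1.\<close>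

lemma J_plus_collar_flow:
  assumes s: "s \<in> C" and r: "\<bar>r\<bar> < 1"
  shows "J_plus M collar_flow (h (s, r)) \<subseteq> h ` (C \<times> {1})"
proof
  fix y assume y: "y \<in> J_plus M collar_flow (h (s, r))"
  have C: "compactin M C" using coll by (simp add: open_collar_def)
  \<comment> \<open>The midpoint of -1 and \<open>r\<close>.\<close>
  define r0 where "r0 = (r - 1) / 2"
  have r0: "-1 < r0" "r0 < r" using r by (auto simp: r0_def)
  let ?U = "h ` (C \<times> {r0<..<1})"
  have U: "openin M ?U" "h (s, r) \<in> ?U"
    using r r0 s by (auto intro!: collar_open simp: openin_collar_base)
  have c: "y \<in> h ` (C \<times> {c..1})" if "-1 < c" "c < 1" for c
  proof -
    let ?t = "max 0 (artanh c - artanh r0)"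
    have "(\<Union>z\<in>?U. collar_flow z ` {?t..}) \<subseteq> h ` (C \<times> {c..1})"
    proof clarsimp
      fix s' r' t
      assume "s' \<in> C" "r0 < r'" "r' < 1" "0 \<le> t" "artanh c - artanh r0 \<le> t"
      moreover have "\<bar>r'\<bar> < 1" using r0 \<open>r0 < r'\<close> \<open>r' < 1\<close> by linarith
      ultimately have "segment_flow r' t \<in> {c..1}" "collar_flow (h (s', r')) t = h (s', segment_flow r' t)"
        using segment_flow_tail[of r0 r' c t] segment_flow_bounds[of r' t] r0 that
        by (auto simp: collar_flow_h abs_less_iff)
      with \<open>s' \<in> C\<close> show "collar_flow (h (s', r')) t \<in> h ` (C \<times> {c..1})"
        by simp
    qed
    moreover have "closedin M (h ` (C \<times> {c..1}))"
      using that by (intro collar_closed[OF _ _ C]) auto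
    ultimately have "M closure_of (\<Union>z\<in>?U. collar_flow z ` {?t..}) \<subseteq> h ` (C \<times> {c..1})"
      by (simp add: closure_of_minimal)
    moreover have "y \<in> M closure_of (\<Union>z\<in>?U. collar_flow z ` {?t..})"
      using y U unfolding J_plus_def by fastforce
    ultimately show ?thesis by blast
  qed
  obtain s' r' where y': "s' \<in> C" "0 \<le> r'" "r' \<le> 1" "y = h (s', r')"
    using c[of 0] by auto
  have "r' = 1"
  proof (rule ccontr)
    assume "r' \<noteq> 1"
    \<comment> \<open>The midpoint of \<open>r'\<close> and 1 is an admissible \<open>c\<close> that
      exceeds the height of \<open>y\<close>.\<close>
    then have "y \<in> h ` (C \<times> {(r'+1)/2..1})" using y' by (intro c) auto
    then have "r' \<in> {(r'+1)/2..1}"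
      using collar_mem_iff[of s' r' C "{(r'+1)/2..1}"] y' by auto
    then show False using \<open>r' \<noteq> 1\<close> y' by auto
  qed
  then show "y \<in> h ` (C \<times> {1})" using y' by auto
qed

lemma omega_limit_subset_J_plus:
  assumes "x \<in> topspace M" shows "omega_limit M \<phi> x \<subseteq> J_plus M \<phi> x"
  unfolding omega_limit_def J_plus_def by (blast intro: subsetD[OF closure_of_mono])

text \<open>Finitely many closures of tails have a common point, namely the orbit at a time beyond
  all the starting times; compactness does the rest.\<close>

lemma omega_limit_nonempty:
  assumes "continuous_flow M \<phi>" "x \<in> topspace M"
  shows "omega_limit M \<phi> x \<noteq> {}"
proof -
  have "(x, t) \<in> topspace (prod_topology M euclideanreal)" for t using assms by simp
  then have in_top: "\<phi> x t \<in> topspace M" for t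
    using assms unfolding continuous_flow_def continuous_map_def by (auto simp: Pi_iff)
  let ?F = "(\<lambda>t. M closure_of (\<phi> x ` {t..})) ` {0..}"
  have "\<Inter>\<F> \<noteq> {}" if "finite \<F>" "\<F> \<subseteq> ?F" for \<F>
  proof -
    have "\<exists>T\<subseteq>{0..}. finite T \<and> \<F> = (\<lambda>t. M closure_of (\<phi> x ` {t..})) ` T"
      by (rule finite_subset_image[OF that])
    then obtain T where T: "finite T" "T \<subseteq> {0..}" "\<F> = (\<lambda>t. M closure_of (\<phi> x ` {t..})) ` T"
      by blast
    obtain m where m: "\<And>t. t \<in> T \<Longrightarrow> t \<le> m"
      using T(1) by (meson bdd_above.unfold bdd_above_finite)
    have "\<phi> x m \<in> M closure_of (\<phi> x ` {t..})" if "t \<in> T" for t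
      using that m in_top by (intro subsetD[OF closure_of_subset]) auto
    then show ?thesis using T(3) by auto
  qed
  then have "\<Inter>?F \<noteq> {}"
    by (intro comp[unfolded compact_space_fip, rule_format]) auto
  then show ?thesis by (simp add: omega_limit_def)
qed

lemma collar_top_boundary: "h ` (C \<times> {1}) \<subseteq> topspace M - h ` (C \<times> {-1<..<1})"
proof
  fix x assume "x \<in> h ` (C \<times> {1})"
  then obtain s where "s \<in> C" "x = h (s, 1)" by auto
  then show "x \<in> topspace M - h ` (C \<times> {-1<..<1})"
    using collar_in_topspace[of s 1] collar_mem_iff[of s 1 C "{-1<..<1}"] by auto
qed

lemma omega_limit_collar_flow:
  assumes x: "x \<in> topspace M"
  shows "omega_limit M collar_flow x \<subseteq> topspace M - h ` (C \<times> {-1<..<1})"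
  using x
proof (cases rule: collar_cases)
  case (inside s r)
  have "omega_limit M collar_flow x \<subseteq> h ` (C \<times> {1})"
    using subset_trans[OF omega_limit_subset_J_plus[OF x] J_plus_collar_flow[OF inside(1,2), folded inside(3)]] .
  also have "\<dots> \<subseteq> topspace M - h ` (C \<times> {-1<..<1})"
    using collar_top_boundary .
  finally show ?thesis .
next
  case outside
  then have "collar_flow x ` {0..} = {x}" by (force simp: collar_flow_outside)
  then have "omega_limit M collar_flow x \<subseteq> M closure_of {x}"
    unfolding omega_limit_def by (metis INT_lower atLeast_iff order_refl)
  also have "\<dots> = {x}"
    using x haus by (simp add: closure_of_eq closedin_Hausdorff_singleton)
  finally show ?thesis using outside by blast
qed

text \<open>Every orbit off \<open>K\<close> passes through the middle of the collar, outside the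
  neighbourhood \<open>N\<close>, which isolates \<open>K\<close>. Just above the lower end level
  there are points arbitrarily close to \<open>K\<close> that reach the middle in positive time,
  which makes \<open>K\<close> unstable. Explosions are excluded because \<open>J_plus\<close> of a
  moving point lies in the upper end level.\<close>

lemma collar_complement_attractor:
  assumes ne: "C \<noteq> {}" and conn: "connectedin M (topspace M - h ` (C \<times> {-1<..<1}))"
  shows "\<exists>\<phi> K. continuous_flow M \<phi> \<and> K \<subseteq> topspace M \<and> connectedin M K \<and>
           isolated_attractor M \<phi> K \<and> global_attractor M \<phi> K \<and>
           \<not> stable_set M \<phi> K \<and> no_external_explosions M \<phi> K"
proof -
  define K where "K = topspace M - h ` (C \<times> {-1<..<1})"
  \<comment> \<open>A neighbourhood of \<open>K\<close> that still misses the middle level; the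
    bound 1/2 is an arbitrary choice between 0 and 1.\<close>
  define N where "N = topspace M - h ` (C \<times> {-1/2<..<1/2})"
  have C: "compactin M C" using coll by (simp add: open_collar_def)
  have compl: "compactin M (topspace M - h ` (C \<times> {a<..<b}))" if "-2 \<le> a" "b \<le> 2" for a b
  proof -
    have "openin M (h ` (C \<times> {a<..<b}))"
      using that by (intro collar_open) (auto simp: openin_collar_base)
    then show ?thesis using comp closedin_compact_space by fastforce
  qed
  have K_top: "K \<subseteq> topspace M" by (simp add: K_def)
  have "omega_limit M collar_flow x \<noteq> {}" "omega_limit M collar_flow x \<subseteq> K" if "x \<in> topspace M" for x
    using omega_limit_nonempty[OF continuous_flow_collar_flow that] omega_limit_collar_flow[OF that] by (auto simp: K_def)
  then have basin: "basin M collar_flow K = topspace M" by (auto simp: basin_def)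
  have fixK: "collar_flow x t = x" if "x \<in> K" for x t
    using that by (simp add: K_def collar_flow_outside)
  have KN: "set_neighbourhood M N K"
  proof -
    have "closedin M (h ` (C \<times> {-1/2..1/2}))" by (intro collar_closed[OF _ _ C]) auto
    then have "openin M (topspace M - h ` (C \<times> {-1/2..1/2}))" by auto
    then have "topspace M - h ` (C \<times> {-1/2..1/2}) \<subseteq> M interior_of N"
      unfolding N_def by (rule interior_of_maximal[rotated]) (intro Diff_mono order_refl image_mono; force)
    moreover have "K \<subseteq> topspace M - h ` (C \<times> {-1/2..1/2})"
      unfolding K_def by (intro Diff_mono order_refl image_mono) force
    ultimately have "K \<subseteq> M interior_of N" by blast
    then show ?thesis by (simp add: set_neighbourhood_def N_def)
  qed
  have crosses: "\<exists>t. collar_flow (h (s, r)) t \<notin> N \<and> (r \<le> 0 \<longrightarrow> 0 \<le> t)" if "s \<in> C" "\<bar>r\<bar> < 1" for s r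
  proof (intro exI conjI impI)
    \<comment> \<open>At this time the orbit is at height 0.\<close>
    show "collar_flow (h (s, r)) (- artanh r) \<notin> N"
      using that by (simp add: collar_flow_h segment_flow_tanh N_def)
    assume "r \<le> 0"
    then have "tanh (artanh r) \<le> tanh 0" using that by (simp add: tanh_artanh_real)
    then show "0 \<le> - artanh r" by (simp only: tanh_real_le_iff)
  qed
  have "K = {x \<in> N. range (collar_flow x) \<subseteq> N}"
  proof (intro equalityI subsetI)
    fix x assume "x \<in> K"
    moreover have "K \<subseteq> N" using KN subset_trans[OF _ interior_of_subset[of M N]] unfolding set_neighbourhood_def by blast
    ultimately show "x \<in> {x \<in> N. range (collar_flow x) \<subseteq> N}" by (auto simp: fixK)
  next
    fix x assume x: "x \<in> {x \<in> N. range (collar_flow x) \<subseteq> N}"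
    then have "x \<in> topspace M" by (simp add: N_def)
    then show "x \<in> K"
    proof (cases rule: collar_cases)
      case (inside s r)
      then obtain t where "collar_flow x t \<notin> N" using crosses[of s r] by blast
      then show ?thesis using x by blast
    qed (simp add: K_def)
  qed
  moreover have "compactin M N" "compactin M K"
    unfolding N_def K_def by (intro compl; simp)+
  ultimately have iso: "isolated_invariant M collar_flow K"
    using KN fixK unfolding isolated_invariant_def invariant_set_def by metis
  have "set_neighbourhood M (topspace M) K"
    using K_top by (simp add: set_neighbourhood_def)
  with iso have att: "isolated_attractor M collar_flow K" "global_attractor M collar_flow K"
    by (simp_all add: isolated_attractor_def global_attractor_def basin)
  have "\<not> stable_set M collar_flow K"
  proof
    assume "stable_set M collar_flow K"
    then obtain P where P: "set_neighbourhood M P K" "P \<subseteq> N" "positively_invariant collar_flow P"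
      using KN unfolding stable_set_def by blast
    obtain s where s: "s \<in> C" using ne by blast
    have "h (s, -1) \<in> K"
      using s collar_in_topspace[of s "-1"] collar_mem_iff[of s "-1" C "{-1<..<1}"] by (auto simp: K_def)
    then have hP: "h (s, -1) \<in> M interior_of P" using P(1) by (auto simp: set_neighbourhood_def)
    have "continuous_map (top_of_set {-2<..<2}) (cylinder M C) (\<lambda>r. (s, r))"
      using s collar_subset by (auto simp: continuous_map_pairwise o_def)
    from continuous_map_compose[OF this collar_cont]
    have "openin (top_of_set {-2<..<2}) {r \<in> {-2<..<2}. h (s, r) \<in> M interior_of P}"
      by (auto simp: continuous_map_def o_def)
    then have "open {r \<in> {-2<..<2}. h (s, r) \<in> M interior_of P}"
      by (rule openin_open_trans) simp
    moreover have "(-1::real) \<in> {r \<in> {-2<..<2}. h (s, r) \<in> M interior_of P}" using hP by simp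
    ultimately obtain e where e: "e > 0" "ball (-1) e \<subseteq> {r \<in> {-2<..<2}. h (s, r) \<in> M interior_of P}"
      using open_contains_ball by blast
    \<comment> \<open>Within \<open>e\<close> of the lower end, and at most -1/2, so that the middle
      lies in the future of the point.\<close>
    define r where "r = -1 + min (e/2) (1/2)"
    have r: "\<bar>r\<bar> < 1" "r \<le> 0" "r \<in> ball (-1) e" using e by (auto simp: r_def dist_real_def min_def)
    then have "h (s, r) \<in> M interior_of P" using e by blast
    then have "h (s, r) \<in> P" by (rule subsetD[OF interior_of_subset])
    moreover obtain t where "collar_flow (h (s, r)) t \<notin> N" "0 \<le> t" using crosses[of s r] r s by blast
    ultimately show False using P by (auto simp: positively_invariant_def)
  qed
  moreover have "no_external_explosions M collar_flow K"
    unfolding no_external_explosions_def basin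
  proof
    fix x assume x: "x \<in> topspace M - K"
    then obtain s r where sr: "s \<in> C" "-1 < r" "r < 1" "x = h (s, r)" by (auto simp: K_def)
    have "h ` (C \<times> {1}) \<subseteq> K"
      using collar_top_boundary by (simp add: K_def)
    then show "J_plus M collar_flow x \<subseteq> K"
      using J_plus_collar_flow[of s r] sr by (auto simp: abs_less_iff)
  qed
  ultimately show ?thesis
    using continuous_flow_collar_flow K_top conn att unfolding K_def by blast
qed

end

section \<open>A nonseparating component of a collar\<close>

lemma openin_locally_const_sum:
  assumes "finite I" "x \<in> topspace M"
    and "\<And>i. i \<in> I \<Longrightarrow> \<exists>V. openin M V \<and> x \<in> V \<and> (\<forall>y\<in>V. f i y = f i x)"
  shows "\<exists>V. openin M V \<and> x \<in> V \<and> (\<forall>y\<in>V. (\<Sum>i\<in>I. f i y) = (\<Sum>i\<in>I. f i x))"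
  using assms(1,3)
proof (induction I rule: finite_induct)
  case empty
  then show ?case using assms(2) by auto
next
  case (insert i I)
  have "\<exists>V. openin M V \<and> x \<in> V \<and> (\<forall>y\<in>V. (\<Sum>i\<in>I. f i y) = (\<Sum>i\<in>I. f i x))"
    by (rule insert.IH) (rule insert.prems, simp)
  then obtain V where V: "openin M V" "x \<in> V" "\<And>y. y \<in> V \<Longrightarrow> (\<Sum>i\<in>I. f i y) = (\<Sum>i\<in>I. f i x)"
    by blast
  obtain V' where V': "openin M V'" "x \<in> V'" "\<And>y. y \<in> V' \<Longrightarrow> f i y = f i x"
    using insert.prems[of i] by blast
  show ?case
  proof (intro exI[of _ "V \<inter> V'"] conjI ballI)
    fix y assume "y \<in> V \<inter> V'"
    then show "(\<Sum>i\<in>insert i I. f i y) = (\<Sum>i\<in>insert i I. f i x)"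
      using V(3)[of y] V'(3)[of y] insert.hyps by simp
  qed (use V(1,2) V'(1,2) in auto)
qed

lemma connectedin_locally_const_imp_const:
  assumes "connectedin M W" and "\<And>x. x \<in> W \<Longrightarrow> \<exists>V. openin M V \<and> x \<in> V \<and> (\<forall>y\<in>V \<inter> W. f y = f x)"
    and "x \<in> W" "y \<in> W"
  shows "f x = f y"
proof (rule ccontr)
  assume ne: "f x \<noteq> f y"
  have op: "openin (subtopology M W) {z \<in> W. P (f z)}" for P
  proof (subst openin_subopen, intro ballI)
    fix z assume z: "z \<in> {z \<in> W. P (f z)}"
    then obtain V where V: "openin M V" "z \<in> V" "\<And>y. y \<in> V \<inter> W \<Longrightarrow> f y = f z"
      using assms(2)[of z] by blast
    have "V \<inter> W \<subseteq> {z \<in> W. P (f z)}"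
      using z V(3) by (metis (mono_tags, lifting) IntE mem_Collect_eq subsetI)
    then show "\<exists>T. openin (subtopology M W) T \<and> z \<in> T \<and> T \<subseteq> {z \<in> W. P (f z)}"
      using z V(1,2) by (intro exI[of _ "V \<inter> W"]) (simp add: openin_subtopology_Int)
  qed
  have "topspace (subtopology M W) \<subseteq> {z \<in> W. f z = f x} \<union> {z \<in> W. f z \<noteq> f x}"
    "{z \<in> W. f z = f x} \<inter> {z \<in> W. f z \<noteq> f x} = {}"
    "x \<in> {z \<in> W. f z = f x}" "y \<in> {z \<in> W. f z \<noteq> f x}"
    using assms(3,4) ne by auto
  moreover have "connected_space (subtopology M W)" using assms(1) by (simp add: connectedin_def)
  ultimately show False
    using op[of "\<lambda>u. u = f x"] op[of "\<lambda>u. u \<noteq> f x"] unfolding connected_space_def by blast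
qed

text \<open>Split the disconnected complement into closed parts. Each end level is connected and
  lies in one part; they lie in different parts, as otherwise the whole space would be disconnected.
  The indicator of the part with the upper end level, together with the upper half of the collar,
  then jumps only at height 0.\<close>

lemma separating_collar_indicator:
  assumes cs: "compact_space M" and haus: "Hausdorff_space M" and conn: "connected_space M"
    and coll: "open_collar M C h k" and C: "connectedin M C" "C \<noteq> {}"
    and sep: "\<not> connectedin M (topspace M - h ` (C \<times> {-1<..<1}))"
  obtains b :: "'a \<Rightarrow> int" where
    "\<And>x. x \<in> topspace M \<Longrightarrow> x \<notin> h ` (C \<times> {0}) \<Longrightarrow> \<exists>V. openin M V \<and> x \<in> V \<and> (\<forall>y\<in>V. b y = b x)"
    "\<And>s r. s \<in> C \<Longrightarrow> -1 < r \<Longrightarrow> r < 1 \<Longrightarrow> b (h (s, r)) = (if 0 \<le> r then 1 else 0)"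
proof -
  define K where "K = topspace M - h ` (C \<times> {-1<..<1})"
  have notK: "h (s, r) \<notin> K" if "s \<in> C" "-1 < r" "r < 1" for s r
    using that by (auto simp: K_def)
  have comp: "compactin M C" using coll by (simp add: open_collar_def)
  note mem = collar_mem_iff[OF cs haus coll] and top = collar_in_topspace[OF cs haus coll]
  have cl: "closedin M (h ` (C \<times> {a..b}))" if "-2 < a" "b < 2" for a b
    using that by (intro collar_closed[OF cs haus coll _ _ comp]) auto
  have clK: "closedin M K"
    unfolding K_def using collar_open[OF cs haus coll _ _ openin_collar_base[OF cs haus coll], of "{-1<..<1}"] by fastforce
  obtain E1 E2 where E: "closedin M E1" "closedin M E2" "K \<subseteq> E1 \<union> E2" "E1 \<inter> E2 \<inter> K = {}"
      "E1 \<inter> K \<noteq> {}" "E2 \<inter> K \<noteq> {}"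
    using sep closedin_subset[OF clK] unfolding connectedin_closedin K_def[symmetric] by auto
  have conn_level: "connectedin M (h ` (C \<times> {r}))" if "-2 < r" "r < 2" for r
  proof -
    have "connectedin (cylinder M C) (C \<times> {r})"
      using that C by (simp add: connectedin_Times connectedin_subtopology)
    then show ?thesis by (rule connectedin_continuous_map_image[OF collar_cont[OF cs haus coll]])
  qed
  have level_K: "h ` (C \<times> {r}) \<subseteq> K" if "r = 1 \<or> r = -1" for r
  proof
    fix x assume "x \<in> h ` (C \<times> {r})"
    then obtain s where "s \<in> C" "x = h (s, r)" by auto
    then show "x \<in> K" unfolding K_def using top[of s r] mem[of s r C "{-1<..<1}"] that by auto
  qed
  have side: "h ` (C \<times> {r}) \<subseteq> A \<or> h ` (C \<times> {r}) \<subseteq> B"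
    if "closedin M A" "closedin M B" "A \<union> B = K" "A \<inter> B = {}" "r = 1 \<or> r = -1" for A B r
  proof -
    have "connectedin M (h ` (C \<times> {r}))" using that conn_level[of r] by auto
    moreover have "h ` (C \<times> {r}) \<subseteq> A \<union> B" using level_K that by simp
    moreover have "A \<inter> B \<inter> h ` (C \<times> {r}) = {}" using that(4) by simp
    ultimately have "A \<inter> h ` (C \<times> {r}) = {} \<or> B \<inter> h ` (C \<times> {r}) = {}"
      using that(1,2) unfolding connectedin_closedin by meson
    with \<open>h ` (C \<times> {r}) \<subseteq> A \<union> B\<close> show ?thesis by blast
  qed
  have not_same: "\<not> (h ` (C \<times> {1}) \<subseteq> A \<and> h ` (C \<times> {-1}) \<subseteq> A)"
    if AB: "closedin M A" "closedin M B" "A \<union> B = K" "A \<inter> B = {}" "B \<noteq> {}" for A B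
  proof
    assume P: "h ` (C \<times> {1}) \<subseteq> A \<and> h ` (C \<times> {-1}) \<subseteq> A"
    \<comment> \<open>The collar is absorbed into \<open>A\<close>, and \<open>B\<close> remains as
      a nonempty closed complement.\<close>
    have "closedin M (A \<union> h ` (C \<times> {-1..1}))" using AB cl by auto
    moreover have "topspace M \<subseteq> (A \<union> h ` (C \<times> {-1..1})) \<union> B"
    proof -
      have "h ` (C \<times> {-1<..<1}) \<subseteq> h ` (C \<times> {-1..1})" by (intro image_mono) force
      moreover have "topspace M \<subseteq> K \<union> h ` (C \<times> {-1<..<1})" by (auto simp: K_def)
      ultimately show ?thesis using AB(3) by blast
    qed
    moreover have "(A \<union> h ` (C \<times> {-1..1})) \<inter> B = {}"
    proof -
      have "h (s, r) \<notin> B" if "s \<in> C" "-1 \<le> r" "r \<le> 1" for s r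
      proof (cases "r = 1 \<or> r = -1")
        case True
        then have "h (s, r) \<in> A" using P that by auto
        then show ?thesis using AB(4) by auto
      next
        case False
        then show ?thesis using AB(3) notK[of s r] that by auto
      qed
      then show ?thesis using AB(4) by auto
    qed
    moreover have "A \<union> h ` (C \<times> {-1..1}) \<noteq> {}" using C(2) by auto
    ultimately show False
      using conn AB(2,5) unfolding connected_space_closedin by blast
  qed
  \<comment> \<open>The two parts play symmetric roles and are named so that the flow direction
    leads from \<open>A\<close> to \<open>B\<close>.\<close>
  obtain A B where AB: "closedin M A" "closedin M B" "A \<union> B = K" "A \<inter> B = {}"
    "h ` (C \<times> {-1}) \<subseteq> A" "h ` (C \<times> {1}) \<subseteq> B"
  proof -
    let ?A = "E1 \<inter> K" and ?B = "E2 \<inter> K"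
    have 1: "closedin M ?A" "closedin M ?B" "?A \<union> ?B = K" "?A \<inter> ?B = {}" using E clK by auto
    have 2: "?B \<union> ?A = K" "?B \<inter> ?A = {}" using 1 by auto
    have "\<not> (h ` (C \<times> {1}) \<subseteq> ?A \<and> h ` (C \<times> {-1}) \<subseteq> ?A)" "\<not> (h ` (C \<times> {1}) \<subseteq> ?B \<and> h ` (C \<times> {-1}) \<subseteq> ?B)"
      using not_same[OF 1 E(6)] not_same[OF 1(2,1) 2 E(5)] .
    moreover have "h ` (C \<times> {1}) \<subseteq> ?A \<or> h ` (C \<times> {1}) \<subseteq> ?B" "h ` (C \<times> {-1}) \<subseteq> ?A \<or> h ` (C \<times> {-1}) \<subseteq> ?B"
      by (rule side[OF 1], simp)+
    ultimately show thesis
      using that[OF 1] that[OF 1(2,1) 2] by argo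
  qed
  \<comment> \<open>Height 0 belongs to the upper side, in agreement with the floor function, which
    jumps on reaching an integer.\<close>
  define b :: "'a \<Rightarrow> int" where "b x = (if x \<in> B \<union> h ` (C \<times> {0..<1}) then 1 else 0)" for x
  show thesis
  proof (rule that[of b])
    fix x assume x: "x \<in> topspace M" "x \<notin> h ` (C \<times> {0})"
    \<comment> \<open>On these open sets \<open>b\<close> is 0 and 1 respectively, and together they
      miss only the points of height 0.\<close>
    let ?V1 = "topspace M - (B \<union> h ` (C \<times> {0..1}))" and ?V2 = "topspace M - (A \<union> h ` (C \<times> {-1..0}))"
    have op: "openin M ?V1" "openin M ?V2"
      using AB(1,2) cl[of 0 1] cl[of "-1" 0] by (simp_all add: openin_diff closedin_Un)
    have b1: "b y = 0" if "y \<in> ?V1" for y using that by (auto simp: b_def)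
    have b2: "b y = 1" if "y \<in> ?V2" for y
    proof -
      have "y \<in> K \<or> y \<in> h ` (C \<times> {-1<..<1})" using that by (auto simp: K_def)
      then have "y \<in> B \<or> y \<in> h ` (C \<times> {-1<..<1})" using that AB(3) by auto
      then show ?thesis
      proof
        assume "y \<in> h ` (C \<times> {-1<..<1})"
        then obtain s r where sr: "s \<in> C" "-1 < r" "r < 1" "y = h (s, r)" by auto
        then have "\<not> r \<le> 0" using that by force
        then show ?thesis using sr by (auto simp: b_def)
      qed (simp add: b_def)
    qed
    have "x \<in> ?V1 \<or> x \<in> ?V2"
    proof (rule ccontr)
      assume "\<not> ?thesis"
      then have n: "x \<in> B \<or> x \<in> h ` (C \<times> {0..1})" "x \<in> A \<or> x \<in> h ` (C \<times> {-1..0})" using x by auto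
      show False
      proof (cases "x \<in> h ` (C \<times> {-1..1})")
        case True
        then obtain s r where sr: "s \<in> C" "-1 \<le> r" "r \<le> 1" "x = h (s, r)" by auto
        have r0: "r \<noteq> 0" using x(2) sr by auto
        have "x \<in> h ` (C \<times> {0..1}) \<longleftrightarrow> 0 \<le> r" "x \<in> h ` (C \<times> {-1..0}) \<longleftrightarrow> r \<le> 0"
          using mem[of s r C "{0..1}"] mem[of s r C "{-1..0}"] sr by auto
        moreover have "x \<in> A \<longrightarrow> r = -1" "x \<in> B \<longrightarrow> r = 1"
        proof -
          have "r = 1 \<or> r = -1" if "x \<in> A \<or> x \<in> B"
          proof -
            have "h (s, r) \<in> K" using that AB(3) sr by auto
            then show ?thesis using sr notK[of s r] by linarith
          qed
          moreover have "r = 1 \<longrightarrow> x \<in> B" "r = -1 \<longrightarrow> x \<in> A" using AB(5,6) sr by auto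
          ultimately show "x \<in> A \<longrightarrow> r = -1" "x \<in> B \<longrightarrow> r = 1" using AB(4) by blast+
        qed
        ultimately show False using n r0 by auto
      next
        case False
        moreover have "h ` (C \<times> {0..1}) \<subseteq> h ` (C \<times> {-1..1})" "h ` (C \<times> {-1..0}) \<subseteq> h ` (C \<times> {-1..1})"
          by (intro image_mono; force)+
        ultimately show False using n AB(4) by blast
      qed
    qed
    then show "\<exists>V. openin M V \<and> x \<in> V \<and> (\<forall>y\<in>V. b y = b x)"
    proof
      assume "x \<in> ?V1"
      then show ?thesis using op(1) b1 by (intro exI[of _ ?V1]) simp
    next
      assume "x \<in> ?V2"
      then show ?thesis using op(2) b2 by (intro exI[of _ ?V2]) simp
    qed
  next
    fix s and r :: real assume sr: "s \<in> C" "-1 < r" "r < 1"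
    have "h (s, r) \<in> h ` (C \<times> {0..<1}) \<longleftrightarrow> 0 \<le> r"
      using mem[of s r C "{0..<1}"] sr by auto
    moreover have "h (s, r) \<notin> B" using AB(3) notK sr by auto
    ultimately show "b (h (s, r)) = (if 0 \<le> r then 1 else 0)" by (simp add: b_def)
  qed
qed

text \<open>Openness of \<open>C\<close> in the base makes its part of the collar open in
  \<open>M\<close>; closedness makes \<open>C\<close> compact.\<close>

lemma open_collar_component:
  assumes cs: "compact_space M" and haus: "Hausdorff_space M" and coll: "open_collar M T h k"
    and C: "openin (subtopology M T) C" "closedin (subtopology M T) C"
  shows "open_collar M C h k"
  unfolding open_collar_def
proof (intro conjI)
  have CT: "C \<subseteq> T" using C(1) openin_subset by fastforce
  have "compactin M T" using coll by (simp add: open_collar_def)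
  then show "compactin M C"
    using C(2) CT by (meson closed_compactin closedin_trans_full compactin_imp_closedin haus)
  show op: "openin M (h ` (C \<times> {-2<..<2}))"
    by (rule collar_open[OF cs haus coll _ _ C(1)]) auto
  have "homeomorphic_maps (subtopology (cylinder M T) (C \<times> UNIV))
      (subtopology (subtopology M (h ` (T \<times> {-2<..<2}))) (h ` (C \<times> {-2<..<2}))) h k"
  proof (rule homeomorphic_maps_subtopologies)
    show "homeomorphic_maps (cylinder M T)
       (subtopology M (h ` (T \<times> {-2<..<2}))) h k"
      using coll by (simp add: open_collar_def)
    have "h ` (C \<times> {-2<..<2}) \<subseteq> h ` (T \<times> {-2<..<2})" using CT by (intro image_mono) auto
    moreover have "h ` (C \<times> {-2<..<2}) \<subseteq> topspace M" using op by (rule openin_subset)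
    moreover have "topspace (cylinder M T) \<inter> (C \<times> UNIV) = C \<times> {-2<..<2}"
      using CT collar_subset[OF cs haus coll] by auto
    ultimately show "h ` (topspace (cylinder M T) \<inter> (C \<times> UNIV)) =
        topspace (subtopology M (h ` (T \<times> {-2<..<2}))) \<inter> h ` (C \<times> {-2<..<2})"
      by (simp only: topspace_subtopology) blast
  qed
  moreover have "subtopology (cylinder M T) (C \<times> UNIV) =
      cylinder M C"
    using CT by (simp add: subtopology_Times subtopology_subtopology inf.absorb2)
  moreover have "h ` (T \<times> {-2<..<2}) \<inter> h ` (C \<times> {-2<..<2}) = h ` (C \<times> {-2<..<2})"
    using CT by (intro inf.absorb2 image_mono) auto
  ultimately show "homeomorphic_maps (cylinder M C)
       (subtopology M (h ` (C \<times> {-2<..<2}))) h k"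
    by (simp add: subtopology_subtopology)
qed

text \<open>The base is a factor of a space homeomorphic to an open subset of \<open>M\<close>, so
  it inherits local connectedness. Its components are therefore open, and finitely many of them
  cover the compact base.\<close>

lemma collar_base_components:
  assumes cs: "compact_space M" and haus: "Hausdorff_space M" and lc: "locally_connected_space M"
    and coll: "open_collar M T h k"
  shows "finite (connected_components_of (subtopology M T))"
    and "\<And>C. C \<in> connected_components_of (subtopology M T) \<Longrightarrow> openin (subtopology M T) C"
proof -
  let ?X = "subtopology M T"
  have lcT: "locally_connected_space ?X"
  proof (cases "T = {}")
    case True
    then show ?thesis by (simp add: locally_connected_space_discrete_topology)
  next
    case False
    let ?P = "prod_topology ?X (top_of_set {-2<..<2::real})"
    have "locally_connected_space (subtopology M (h ` (T \<times> {-2<..<2})))"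
      using coll lc by (intro locally_connected_space_open_subset) (auto simp: open_collar_def)
    moreover have "?P homeomorphic_space subtopology M (h ` (T \<times> {-2<..<2}))"
      using coll unfolding open_collar_def homeomorphic_space_def by blast
    ultimately have "locally_connected_space ?P"
      using homeomorphic_locally_connected_space by blast
    moreover have "topspace ?P \<noteq> {}" using False collar_subset[OF cs haus coll] by (auto intro: exI[of _ 0])
    ultimately show ?thesis
      using locally_connected_space_prod_topology[of ?X "top_of_set {-2<..<2::real}"] by fastforce
  qed
  show op: "openin ?X C" if "C \<in> connected_components_of ?X" for C
    using openin_connected_components_of_locally_connected_space[OF lcT that] .
  have "compact_space ?X"
    using coll by (simp add: open_collar_def compactin_subspace)
  then obtain \<F> where F: "finite \<F>" "\<F> \<subseteq> connected_components_of ?X" "topspace ?X \<subseteq> \<Union>\<F>"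
    using op Union_connected_components_of[of ?X] unfolding compact_space_alt by (metis order_refl)
  have "connected_components_of ?X \<subseteq> \<F>"
  proof
    fix C assume C: "C \<in> connected_components_of ?X"
    then obtain x where "x \<in> C" "x \<in> topspace ?X"
      using nonempty_connected_components_of connected_components_of_subset by blast
    then obtain D where "D \<in> \<F>" "x \<in> D" using F(3) by blast
    then have "C = D"
      using C F(2) \<open>x \<in> C\<close> connected_components_of_overlap[of C ?X D] by blast
    then show "C \<in> \<F>" using \<open>D \<in> \<F>\<close> by simp
  qed
  then show "finite (connected_components_of ?X)" using F(1) finite_subset by blast
qed

text \<open>If every component of the base separated, subtracting from \<open>\<lfloor>U\<rfloor>\<close> the indicators of the upper
  sides of the components would leave an integer function that does not jump across the collar,
  trivialising the multivalued function \<open>U\<close>.\<close>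

lemma nonseparating_component:
  fixes U :: "'a \<Rightarrow> real" and g :: "'i \<Rightarrow> 'a \<Rightarrow> int"
  assumes cs: "compact_space M" and haus: "Hausdorff_space M" and conn: "connected_space M"
    and lc: "locally_connected_space M" and coll: "open_collar M T h k"
    and W: "\<And>i. i \<in> I \<Longrightarrow> openin M (W i)" "\<And>i. i \<in> I \<Longrightarrow> connectedin M (W i)"
    and U: "\<And>i. i \<in> I \<Longrightarrow> continuous_map (subtopology M (W i)) euclideanreal (\<lambda>x. U x - real_of_int (g i x))"
    and nontriv: "\<And>b. \<exists>i\<in>I. \<exists>x\<in>W i. \<exists>y\<in>W i. b x + g i x \<noteq> b y + g i y"
    and height: "\<And>s r. s \<in> T \<Longrightarrow> -2 < r \<Longrightarrow> r < 2 \<Longrightarrow>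
        \<exists>n::int. \<bar>U (h (s, r)) - n\<bar> < 1/2 \<and> (0 \<le> r \<longleftrightarrow> n \<le> U (h (s, r))) \<and> (r = 0 \<longleftrightarrow> U (h (s, r)) = n)"
    and level: "\<And>x. x \<in> topspace M \<Longrightarrow> U x \<in> \<int> \<Longrightarrow> x \<in> h ` (T \<times> {0})"
  obtains C where "C \<noteq> {}" "open_collar M C h k" "connectedin M (topspace M - h ` (C \<times> {-1<..<1}))"
proof -
  let ?CC = "connected_components_of (subtopology M T)"
  have fin: "finite ?CC" and opC: "\<And>C. C \<in> ?CC \<Longrightarrow> openin (subtopology M T) C"
    using collar_base_components[OF cs haus lc coll] by blast+
  have CT: "C \<subseteq> T" if "C \<in> ?CC" for C using connected_components_of_subset[OF that] by simp
  have collC: "open_collar M C h k" if "C \<in> ?CC" for C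
    using open_collar_component[OF cs haus coll opC[OF that] closedin_connected_components_of[OF that]] .
  have conC: "connectedin M C" "C \<noteq> {}" if "C \<in> ?CC" for C
    using connectedin_connected_components_of[OF that] nonempty_connected_components_of[OF that]
    by (auto simp: connectedin_subtopology)
  have "\<exists>C\<in>?CC. connectedin M (topspace M - h ` (C \<times> {-1<..<1}))"
  proof (rule ccontr)
    assume "\<not> ?thesis"
    then have sep: "\<not> connectedin M (topspace M - h ` (C \<times> {-1<..<1}))" if "C \<in> ?CC" for C using that by blast
    have "\<exists>b::'a \<Rightarrow> int. (\<forall>x. x \<in> topspace M \<longrightarrow> x \<notin> h ` (C \<times> {0}) \<longrightarrow> (\<exists>V. openin M V \<and> x \<in> V \<and> (\<forall>y\<in>V. b y = b x))) \<and>
       (\<forall>s r. s \<in> C \<longrightarrow> -1 < r \<longrightarrow> r < 1 \<longrightarrow> b (h (s, r)) = (if 0 \<le> r then 1 else 0))" if C: "C \<in> ?CC" for C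
      by (rule separating_collar_indicator[OF cs haus conn collC[OF C] conC[OF C] sep[OF C]]) blast
    then obtain b :: "'a set \<Rightarrow> 'a \<Rightarrow> int" where
      b: "\<And>C x. C \<in> ?CC \<Longrightarrow> x \<in> topspace M \<Longrightarrow> x \<notin> h ` (C \<times> {0}) \<Longrightarrow> \<exists>V. openin M V \<and> x \<in> V \<and> (\<forall>y\<in>V. b C y = b C x)"
      and bh: "\<And>C s r. C \<in> ?CC \<Longrightarrow> s \<in> C \<Longrightarrow> -1 < r \<Longrightarrow> r < 1 \<Longrightarrow> b C (h (s, r)) = (if 0 \<le> r then 1 else 0)"
      by metis
    \<comment> \<open>Every \<open>B + g i\<close> turns out to be locally constant on the connected
      set \<open>W i\<close>, against \<open>nontriv\<close>.\<close>
    define B where "B x = (\<Sum>C\<in>?CC. b C x) - \<lfloor>U x\<rfloor>" for x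
    have loc: "\<exists>V. openin M V \<and> x \<in> V \<and> (\<forall>y\<in>V \<inter> W i. B y + g i y = B x + g i x)"
      if i: "i \<in> I" and x: "x \<in> W i" for i x
    proof -
      have xM: "x \<in> topspace M" using W(1)[OF i] x openin_subset by blast
      define v where "v y = U y - real_of_int (g i y)" for y
      have vop: "openin M {y \<in> W i. v y \<in> S}" if "open S" for S
      proof -
        have "openin (subtopology M (W i)) {y \<in> topspace (subtopology M (W i)). v y \<in> S}"
          using U[OF i] that unfolding v_def by (intro openin_continuous_map_preimage) auto
        moreover have "topspace (subtopology M (W i)) = W i"
          using W(1)[OF i] openin_subset by auto
        ultimately show ?thesis using W(1)[OF i] openin_trans_full by metis
      qed
      show ?thesis
      proof (cases "U x \<in> \<int>")
        case False
        have nC: "x \<notin> h ` (C \<times> {0})" if C: "C \<in> ?CC" for C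
        proof
          assume "x \<in> h ` (C \<times> {0})"
          then obtain s where "s \<in> T" "x = h (s, 0)" using CT[OF C] by auto
          then show False using height[of s 0] False by auto
        qed
        obtain V where V: "openin M V" "x \<in> V" "\<And>y. y \<in> V \<Longrightarrow> (\<Sum>C\<in>?CC. b C y) = (\<Sum>C\<in>?CC. b C x)"
          using openin_locally_const_sum[OF fin xM, of b] b xM nC by metis
        \<comment> \<open>Off the integer level, the branch \<open>v\<close> stays between two
          consecutive integers near \<open>x\<close>, so \<open>\<lfloor>U\<rfloor> - g i\<close> is
          constant there.\<close>
        let ?S = "{real_of_int \<lfloor>v x\<rfloor><..<real_of_int \<lfloor>v x\<rfloor> + 1}"
        have "v x \<notin> \<int>" using False unfolding v_def by (metis Ints_add Ints_of_int diff_add_cancel)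
        then have "v x \<noteq> real_of_int \<lfloor>v x\<rfloor>" by (metis Ints_of_int)
        then have vx: "v x \<in> ?S" by simp linarith
        show ?thesis
        proof (intro exI[of _ "V \<inter> {y \<in> W i. v y \<in> ?S}"] conjI ballI)
          show "openin M (V \<inter> {y \<in> W i. v y \<in> ?S})" using V(1) vop[of ?S] by (intro openin_Int) auto
          show "x \<in> V \<inter> {y \<in> W i. v y \<in> ?S}" using V(2) x vx by simp
          fix y assume y: "y \<in> V \<inter> {y \<in> W i. v y \<in> ?S} \<inter> W i"
          have "\<lfloor>v y\<rfloor> = \<lfloor>v x\<rfloor>" using y by (intro floor_unique) auto
          then have "\<lfloor>U y\<rfloor> - g i y = \<lfloor>U x\<rfloor> - g i x" by (simp add: v_def)
          then show "B y + g i y = B x + g i x" using V(3)[of y] y by (simp add: B_def)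
        qed
      next
        case True
        then obtain s0 where s0: "s0 \<in> T" "x = h (s0, 0)" using level xM by auto
        have "s0 \<in> topspace (subtopology M T)" using s0 collar_subset[OF cs haus coll] by auto
        then obtain D where D: "D \<in> ?CC" "s0 \<in> D" using Union_connected_components_of[of "subtopology M T"] by blast
        have nC: "x \<notin> h ` (C \<times> {0})" if "C \<in> ?CC - {D}" for C
        proof
          assume "x \<in> h ` (C \<times> {0})"
          then have "s0 \<in> C"
            using collar_mem_iff[OF cs haus coll s0(1), of 0 C "{0}"] CT that s0(2) by auto
          then show False using connected_components_of_overlap[of C "subtopology M T" D] D that by blast
        qed
        obtain V where V: "openin M V" "x \<in> V" "\<And>y. y \<in> V \<Longrightarrow> (\<Sum>C\<in>?CC-{D}. b C y) = (\<Sum>C\<in>?CC-{D}. b C x)"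
          using openin_locally_const_sum[of "?CC - {D}" x M b] fin b xM nC by (metis DiffD1 finite_Diff)
        let ?R = "h ` (D \<times> {-1<..<1})" and ?S = "ball (v x) (1/2)"
        have "v x \<in> \<int>" using True by (simp add: v_def)
        then obtain m :: int where m: "v x = m" by (auto elim: Ints_cases)
        have opR: "openin M ?R" by (rule collar_open[OF cs haus coll _ _ opC[OF D(1)]]) auto
        \<comment> \<open>\<open>v\<close> stays within 1/2 of \<open>m\<close> and \<open>U\<close>
          within 1/2 of the integer \<open>n\<close> supplied by \<open>height\<close>, which forces
          \<open>n = g i y + m\<close>. The floor rises by 1 at height 0 and so does
          \<open>b D\<close>, so the difference does not jump.\<close>
        have key: "b D y - \<lfloor>U y\<rfloor> + g i y = 1 - m" if y: "y \<in> ?R" "y \<in> W i" "v y \<in> ?S" for y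
        proof -
          obtain s r where sr: "s \<in> D" "-1 < r" "r < 1" "y = h (s, r)" using y(1) by auto
          then obtain n :: int where n: "\<bar>U y - n\<bar> < 1/2" "0 \<le> r \<longleftrightarrow> n \<le> U y"
            using height[of s r] CT[OF D(1)] by auto
          have "\<bar>U y - g i y - m\<bar> < 1/2" using y(3) m by (simp add: v_def dist_real_def abs_minus_commute)
          then have "\<bar>real_of_int (n - g i y - m)\<bar> < 1"
            using n(1) unfolding of_int_diff by linarith
          then have nm: "n = g i y + m" by linarith
          have "\<lfloor>U y\<rfloor> = (if 0 \<le> r then n else n - 1)"
            using n by (cases "0 \<le> r") (auto intro!: floor_unique simp: abs_less_iff)
          then show ?thesis using bh[OF D(1) sr(1-3)] sr(4) nm by auto
        qed
        show ?thesis
        proof (intro exI[of _ "V \<inter> ?R \<inter> {y \<in> W i. v y \<in> ?S}"] conjI ballI)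
          show "openin M (V \<inter> ?R \<inter> {y \<in> W i. v y \<in> ?S})" using V(1) opR vop[of ?S] by (intro openin_Int) auto
          have xR: "x \<in> ?R" using s0(2) D(2) by simp
          then show "x \<in> V \<inter> ?R \<inter> {y \<in> W i. v y \<in> ?S}" using V(2) x by simp
          fix y assume y: "y \<in> V \<inter> ?R \<inter> {y \<in> W i. v y \<in> ?S} \<inter> W i"
          have "(\<Sum>C\<in>?CC. b C z) = b D z + (\<Sum>C\<in>?CC-{D}. b C z)" for z
            using fin D(1) by (simp add: sum.remove)
          then show "B y + g i y = B x + g i x"
            using V(3)[of y] key[of y] key[of x] y x xR unfolding B_def by simp
        qed
      qed
    qed
    obtain i x y where "i \<in> I" "x \<in> W i" "y \<in> W i" "B x + g i x \<noteq> B y + g i y"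
      using nontriv[of B] by blast
    then show False
      using connectedin_locally_const_imp_const[OF W(2), of i "\<lambda>z. B z + g i z" x y] loc by blast
  qed
  then show thesis using that collC conC by blast
qed

section \<open>Sliding level tubes\<close>

text \<open>Steepness in \<open>r\<close> bounds the movement of the root by
  \<open>\<bar>H z (R z0)\<bar> / c\<close>, which tends to 0 by continuity in \<open>z\<close> at
  the fixed value \<open>R z0\<close>.\<close>

lemma continuous_on_implicit_root:
  fixes H :: "'x::metric_space \<Rightarrow> real \<Rightarrow> real"
  assumes R: "\<And>z. z \<in> D \<Longrightarrow> R z \<in> J" "\<And>z. z \<in> D \<Longrightarrow> H z (R z) = 0"
    and cont: "\<And>r. r \<in> J \<Longrightarrow> continuous_on D (\<lambda>z. H z r)"
    and slope: "\<And>z r r'. z \<in> D \<Longrightarrow> r \<in> J \<Longrightarrow> r' \<in> J \<Longrightarrow> c * \<bar>r - r'\<bar> \<le> \<bar>H z r - H z r'\<bar>"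
    and c: "c > 0"
  shows "continuous_on D R"
  unfolding continuous_on_def
proof
  fix z0 assume z0: "z0 \<in> D"
  have "((\<lambda>z. H z (R z0)) \<longlongrightarrow> H z0 (R z0)) (at z0 within D)"
    using cont[OF R(1)[OF z0]] z0 by (simp add: continuous_on_def)
  then have "((\<lambda>z. \<bar>H z (R z0)\<bar> / c) \<longlongrightarrow> 0) (at z0 within D)"
    using R(2)[OF z0] c by (auto intro!: tendsto_eq_intros)
  moreover have "\<forall>\<^sub>F z in at z0 within D. norm (R z - R z0) \<le> \<bar>H z (R z0)\<bar> / c"
    unfolding eventually_at_filter
  proof (intro always_eventually allI impI)
    fix z assume "z \<in> D"
    then show "norm (R z - R z0) \<le> \<bar>H z (R z0)\<bar> / c"
      using slope[of z "R z" "R z0"] R z0 c by (simp add: field_simps)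
  qed
  ultimately have "((\<lambda>z. R z - R z0) \<longlongrightarrow> 0) (at z0 within D)"
    by (rule Lim_null_comparison[rotated])
  then show "(R \<longlongrightarrow> R z0) (at z0 within D)" by (simp add: LIM_zero_iff)
qed

definition level_tube :: "'a topology \<Rightarrow> ('a \<Rightarrow> real) \<Rightarrow> real \<Rightarrow> ('a \<Rightarrow> real) \<Rightarrow> ('a \<times> real) set" where
  "level_tube M U eps \<Lambda> = {(x, t). x \<in> topspace M \<and> \<bar>t\<bar> < eps \<and> U x - t * \<Lambda> x \<in> \<int>}"

abbreviation tube_topology where
  "tube_topology M U eps \<Lambda> \<equiv> subtopology (prod_topology M euclideanreal) (level_tube M U eps \<Lambda>)"

lemma topspace_tube [simp]: "topspace (tube_topology M U eps \<Lambda>) = level_tube M U eps \<Lambda>"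
  by (auto simp: level_tube_def)

text \<open>The inverse \<open>p\<close> is part of the data, so that functions on \<open>M\<close>
  can be treated as functions on the open set \<open>Dom\<close> by composing with
  \<open>p\<close>.\<close>

locale open_chart =
  fixes M :: "'a topology" and W :: "'a set" and f :: "'a \<Rightarrow> 'b::euclidean_space" and p :: "'b \<Rightarrow> 'a" and Dom :: "'b set"
  assumes haus: "Hausdorff_space M" and W: "openin M W" and Dom_open: "open Dom"
    and hom: "homeomorphic_maps (subtopology M W) (top_of_set Dom) f p"
begin

lemma p_cont: "continuous_map (top_of_set Dom) M p" and f_cont: "continuous_map (subtopology M W) (top_of_set Dom) f"
  using hom by (auto simp: homeomorphic_maps_def continuous_map_in_subtopology)

lemma fp [simp]: "y \<in> Dom \<Longrightarrow> f (p y) = y"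
  using hom by (auto simp: homeomorphic_maps_def)

lemma p_in: "y \<in> Dom \<Longrightarrow> p y \<in> W" "y \<in> Dom \<Longrightarrow> p y \<in> topspace M"
  using hom by (auto simp: homeomorphic_maps_def continuous_map_def Pi_iff)

lemma p_mem_iff: "y \<in> Dom \<Longrightarrow> D \<subseteq> Dom \<Longrightarrow> p y \<in> p ` D \<longleftrightarrow> y \<in> D"
  by (metis fp imageE image_eqI subsetD)

lemma p_open:
  assumes "open D" "D \<subseteq> Dom" shows "openin M (p ` D)"
proof -
  have "homeomorphic_map (top_of_set Dom) (subtopology M W) p"
    using hom by (meson homeomorphic_map_maps homeomorphic_maps_sym)
  moreover have "openin (top_of_set Dom) D" using assms by (simp add: open_subset)
  ultimately have "openin (subtopology M W) (p ` D)"
    using homeomorphic_imp_open_map open_map_def by blast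
  then show ?thesis using W openin_trans_full by blast
qed

lemma p_closed:
  assumes "compact D" "D \<subseteq> Dom" shows "closedin M (p ` D)"
proof (rule compactin_imp_closedin[OF haus image_compactin[OF _ p_cont]])
  show "compactin (top_of_set Dom) D" using assms by (simp add: compactin_subtopology)
qed

lemma pf [simp]: "x \<in> W \<Longrightarrow> p (f x) = x"
  using hom openin_subset[OF W] by (auto simp: homeomorphic_maps_def)

lemma f_in: "x \<in> W \<Longrightarrow> f x \<in> Dom"
  using hom openin_subset[OF W] by (auto simp: homeomorphic_maps_def continuous_map_def Pi_iff)

lemma p_vimage_open:
  assumes "openin M V" shows "open {y \<in> Dom. p y \<in> V}"
proof -
  have "openin (top_of_set Dom) {y \<in> topspace (top_of_set Dom). p y \<in> V}"
    by (rule openin_continuous_map_preimage[OF p_cont assms])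
  then have "openin (top_of_set Dom) {y \<in> Dom. p y \<in> V}" by simp
  then show ?thesis using Dom_open by (rule openin_open_trans)
qed

end

text \<open>If two weights \<open>\<Lambda>\<close>, \<open>\<Lambda>'\<close> differ only near \<open>y0\<close> and both functions \<open>U - t * \<Lambda>\<close>, \<open>U - t * \<Lambda>'\<close>
  increase strictly in the direction \<open>e\<close>, then sliding along \<open>e\<close> carries one level tube onto the other.
  The displacement vanishes where the weights agree, so no transport between charts is needed.\<close>

locale slide_box = open_chart M W f p Dom
  for M :: "'a topology" and W and f :: "'a \<Rightarrow> 'b::euclidean_space" and p and Dom +
  fixes U :: "'a \<Rightarrow> real" and y0 e :: 'b and \<rho> c eps :: real and w :: "'b \<Rightarrow> real" and \<Lambda> \<Lambda>' :: "'a \<Rightarrow> real"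
  assumes Dom: "cball y0 \<rho> \<subseteq> Dom" and pos: "\<rho> > 0" "c > 0" and e: "norm e = 1"
    and eps: "eps \<le> c * \<rho> / 8"
    and cont: "continuous_map M euclideanreal \<Lambda>" "continuous_map M euclideanreal \<Lambda>'" "continuous_on Dom w"
    and agree: "\<And>x. x \<in> topspace M \<Longrightarrow> x \<notin> p ` ball y0 (\<rho>/4) \<Longrightarrow> \<Lambda> x = \<Lambda>' x"
    and close: "\<And>x. x \<in> topspace M \<Longrightarrow> \<bar>\<Lambda> x - \<Lambda>' x\<bar> \<le> 1"
    and level: "\<And>y t. y \<in> cball y0 \<rho> \<Longrightarrow> \<bar>t\<bar> < eps \<Longrightarrow> U (p y) - t * \<Lambda> (p y) \<in> \<int> \<longleftrightarrow> w y = t * \<Lambda> (p y)"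
      "\<And>y t. y \<in> cball y0 \<rho> \<Longrightarrow> \<bar>t\<bar> < eps \<Longrightarrow> U (p y) - t * \<Lambda>' (p y) \<in> \<int> \<longleftrightarrow> w y = t * \<Lambda>' (p y)"
    and slope: "\<And>y r t. y \<in> cball y0 \<rho> \<Longrightarrow> y + r *\<^sub>R e \<in> cball y0 \<rho> \<Longrightarrow> 0 \<le> r \<Longrightarrow> \<bar>t\<bar> < eps \<Longrightarrow>
         w y - t * \<Lambda> (p y) + c * r \<le> w (y + r *\<^sub>R e) - t * \<Lambda> (p (y + r *\<^sub>R e))"
      "\<And>y r t. y \<in> cball y0 \<rho> \<Longrightarrow> y + r *\<^sub>R e \<in> cball y0 \<rho> \<Longrightarrow> 0 \<le> r \<Longrightarrow> \<bar>t\<bar> < eps \<Longrightarrow>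
         w y - t * \<Lambda>' (p y) + c * r \<le> w (y + r *\<^sub>R e) - t * \<Lambda>' (p (y + r *\<^sub>R e))"
begin

text \<open>The hypotheses are symmetric in the two weights, so the inverse slide is the slide of
  the exchanged box.\<close>

lemma flipped: "slide_box M W f p Dom U y0 e \<rho> c eps w \<Lambda>' \<Lambda>"
  using haus W Dom_open hom Dom pos e eps cont agree close level slope
  by unfold_locales (simp_all add: abs_minus_commute)

text \<open>Moving by at most \<open>\<rho>/8\<close> carries the ball of radius
  \<open>\<rho>/4\<close>, outside which the weights agree, into the ball of radius
  \<open>\<rho>/2\<close>, and that one into the ball of radius \<rho> where the slope is
  controlled.\<close>

definition shift :: "'b \<Rightarrow> real \<Rightarrow> real" where
  "shift y t = (THE r. \<bar>r\<bar> \<le> \<rho>/8 \<and> w (y + r *\<^sub>R e) = t * \<Lambda>' (p (y + r *\<^sub>R e)))"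

lemma dist_move: "dist y0 (y + r *\<^sub>R e) \<le> dist y0 y + \<bar>r\<bar>"
  using dist_triangle[of y0 "y + r *\<^sub>R e" y] e by (simp add: dist_norm)

lemma move_in: "y \<in> ball y0 (\<rho>/2) \<Longrightarrow> \<bar>r\<bar> \<le> \<rho>/8 \<Longrightarrow> y + r *\<^sub>R e \<in> ball y0 \<rho>"
  using dist_move[of y r] pos(1) unfolding mem_ball by linarith

lemma half_ball_Dom: "r \<le> \<rho> \<Longrightarrow> ball y0 r \<subseteq> Dom" "r \<le> \<rho> \<Longrightarrow> cball y0 r \<subseteq> Dom"
  using Dom by (auto simp: subset_iff)

lemma move_in_Dom: "y \<in> ball y0 (\<rho>/2) \<Longrightarrow> \<bar>r\<bar> \<le> \<rho>/8 \<Longrightarrow> y + r *\<^sub>R e \<in> Dom"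
  using move_in half_ball_Dom(1)[OF order_refl] by blast

lemma slope_abs:
  assumes "y \<in> ball y0 (\<rho>/2)" "\<bar>r\<bar> \<le> \<rho>/8" "\<bar>r'\<bar> \<le> \<rho>/8" "\<bar>t\<bar> < eps" "r \<le> r'"
  shows "w (y + r *\<^sub>R e) - t * \<Lambda>' (p (y + r *\<^sub>R e)) + c * (r' - r) \<le> w (y + r' *\<^sub>R e) - t * \<Lambda>' (p (y + r' *\<^sub>R e))"
proof -
  have eq: "y + r *\<^sub>R e + (r' - r) *\<^sub>R e = y + r' *\<^sub>R e" by (simp add: algebra_simps)
  show ?thesis
    using slope(2)[of "y + r *\<^sub>R e" "r' - r" t, unfolded eq] move_in[OF assms(1,2)] move_in[OF assms(1,3)]
      assms(4,5) by (simp add: less_imp_le)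
qed

lemma shift_unique:
  assumes "y \<in> ball y0 (\<rho>/2)" "\<bar>r\<bar> \<le> \<rho>/8" "\<bar>t\<bar> < eps" "w (y + r *\<^sub>R e) = t * \<Lambda>' (p (y + r *\<^sub>R e))"
  shows "shift y t = r"
  unfolding shift_def
proof (rule the_equality)
  fix r' assume r': "\<bar>r'\<bar> \<le> \<rho>/8 \<and> w (y + r' *\<^sub>R e) = t * \<Lambda>' (p (y + r' *\<^sub>R e))"
  have "c * (r' - r) \<le> 0" if "r \<le> r'"
    using slope_abs[OF assms(1,2) _ assms(3) that] r' assms(4) by simp
  moreover have "c * (r - r') \<le> 0" if "r' \<le> r"
    using slope_abs[OF assms(1) _ assms(2,3) that] r' assms(4) by simp
  ultimately show "r' = r" using pos(2) by (cases "r \<le> r'") (auto simp: mult_le_0_iff)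
qed (use assms in auto)

definition slice :: "('b \<times> real) set" where
  "slice = {(y, t). y \<in> ball y0 (\<rho>/2) \<and> \<bar>t\<bar> < eps \<and> w y = t * \<Lambda> (p y)}"

lemma in_ball_Dom: "y \<in> ball y0 r \<Longrightarrow> r \<le> \<rho> \<Longrightarrow> y \<in> Dom"
  using Dom by (auto simp: subset_iff)

lemma line_cont:
  assumes "y \<in> ball y0 (\<rho>/2)"
  shows "continuous_on {-\<rho>/8..\<rho>/8} (\<lambda>r. w (y + r *\<^sub>R e) - t * \<Lambda>' (p (y + r *\<^sub>R e)))"
proof -
  have im: "(\<lambda>r. y + r *\<^sub>R e) ` {-\<rho>/8..\<rho>/8} \<subseteq> Dom"
    using move_in_Dom[OF assms] by (auto simp: abs_le_iff simp del: mem_ball)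
  have L: "continuous_on Dom (\<lambda>y. \<Lambda>' (p y))"
    using continuous_map_compose[OF p_cont cont(2)] by (simp add: o_def)
  have l: "continuous_on {-\<rho>/8..\<rho>/8} (\<lambda>r. y + r *\<^sub>R e)" by (intro continuous_intros)
  show ?thesis
    using continuous_on_compose2[OF cont(3) l im] continuous_on_compose2[OF L l im]
    by (intro continuous_intros) auto
qed

text \<open>Unmoved, the point misses the new equation by
  \<open>t * (\<Lambda> - \<Lambda>')\<close>, which is smaller than \<open>eps\<close> and hence
  than \<open>c * \<rho> / 8\<close>. With slope at least \<open>c\<close>, displacements of
  \<open>\<rho>/8\<close> in the two directions compensate this, and the intermediate value theorem
  gives a root.\<close>

lemma shift_root:
  assumes "(y, t) \<in> slice"
  shows "\<bar>shift y t\<bar> \<le> \<rho>/8" "w (y + shift y t *\<^sub>R e) = t * \<Lambda>' (p (y + shift y t *\<^sub>R e))"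
proof -
  have y: "y \<in> ball y0 (\<rho>/2)" "\<bar>t\<bar> < eps" "w y = t * \<Lambda> (p y)" using assms by (auto simp: slice_def)
  let ?H = "\<lambda>r. w (y + r *\<^sub>R e) - t * \<Lambda>' (p (y + r *\<^sub>R e))"
  have "?H 0 = t * (\<Lambda> (p y) - \<Lambda>' (p y))" using y(3) by (simp add: algebra_simps)
  moreover have "p y \<in> topspace M" using p_in(2) in_ball_Dom[OF y(1)] pos by simp
  then have "\<bar>t * (\<Lambda> (p y) - \<Lambda>' (p y))\<bar> \<le> \<bar>t\<bar>"
    using close[of "p y"] by (simp add: abs_mult mult_left_le)
  ultimately have H0: "\<bar>?H 0\<bar> \<le> c * \<rho> / 8" using y(2) eps by linarith
  have "?H 0 + c * (\<rho>/8) \<le> ?H (\<rho>/8)" "?H (-\<rho>/8) + c * (\<rho>/8) \<le> ?H 0"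
    using slope_abs[OF y(1) _ _ y(2), of 0 "\<rho>/8"] slope_abs[OF y(1) _ _ y(2), of "-\<rho>/8" 0] pos(1) by simp_all
  then have "?H (-\<rho>/8) \<le> 0" "0 \<le> ?H (\<rho>/8)" using H0 by linarith+
  then obtain r where r: "-\<rho>/8 \<le> r" "r \<le> \<rho>/8" "?H r = 0"
    using IVT'[OF _ _ _ line_cont[OF y(1), of t], of 0] pos(1) by auto
  then have "shift y t = r" using y by (intro shift_unique) auto
  then show "\<bar>shift y t\<bar> \<le> \<rho>/8" "w (y + shift y t *\<^sub>R e) = t * \<Lambda>' (p (y + shift y t *\<^sub>R e))"
    using r by (auto simp: abs_le_iff)
qed

lemma shift_0:
  assumes "(y, t) \<in> slice" "y \<notin> ball y0 (\<rho>/4)" shows "shift y t = 0"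
proof -
  have y: "y \<in> ball y0 (\<rho>/2)" "\<bar>t\<bar> < eps" "w y = t * \<Lambda> (p y)" using assms by (auto simp: slice_def)
  have yO: "y \<in> Dom" using in_ball_Dom[OF y(1)] pos by simp
  have "p y \<notin> p ` ball y0 (\<rho>/4)"
    using p_mem_iff[OF yO half_ball_Dom(1)[of "\<rho>/4"]] assms(2) pos by simp
  then have "\<Lambda> (p y) = \<Lambda>' (p y)" using agree p_in(2)[OF yO] by blast
  then show ?thesis using y pos by (intro shift_unique) auto
qed

lemma shifted_in_half_ball:
  assumes "(y, t) \<in> slice" shows "y + shift y t *\<^sub>R e \<in> ball y0 (\<rho>/2)"
proof (cases "y \<in> ball y0 (\<rho>/4)")
  case True
  then show ?thesis
    using dist_move[of y "shift y t"] pos(1) shift_root(1)[OF assms] unfolding mem_ball by linarith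
next
  case False
  then show ?thesis using shift_0[OF assms] assms by (simp add: slice_def)
qed

lemma shift_cont: "continuous_on slice (\<lambda>z. shift (fst z) (snd z))"
proof (rule continuous_on_implicit_root[where J="{-\<rho>/8..\<rho>/8}" and c=c and
      H="\<lambda>z r. w (fst z + r *\<^sub>R e) - snd z * \<Lambda>' (p (fst z + r *\<^sub>R e))"])
  fix z assume z: "z \<in> slice"
  then show "shift (fst z) (snd z) \<in> {-\<rho>/8..\<rho>/8}"
    "w (fst z + shift (fst z) (snd z) *\<^sub>R e) - snd z * \<Lambda>' (p (fst z + shift (fst z) (snd z) *\<^sub>R e)) = 0"
    using shift_root[of "fst z" "snd z"] by (auto simp: abs_le_iff)
  fix r r' assume r: "r \<in> {-\<rho>/8..\<rho>/8}" "r' \<in> {-\<rho>/8..\<rho>/8}"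
  let ?H = "\<lambda>r. w (fst z + r *\<^sub>R e) - snd z * \<Lambda>' (p (fst z + r *\<^sub>R e))"
  have z': "fst z \<in> ball y0 (\<rho>/2)" "\<bar>snd z\<bar> < eps" using z by (auto simp: slice_def)
  have ab: "\<bar>r\<bar> \<le> \<rho>/8" "\<bar>r'\<bar> \<le> \<rho>/8" using r by (auto simp: abs_le_iff)
  show "c * \<bar>r - r'\<bar> \<le> \<bar>?H r - ?H r'\<bar>"
    using slope_abs[OF z'(1) ab z'(2)] slope_abs[OF z'(1) ab(2,1) z'(2)]
    by (cases "r \<le> r'") (simp_all add: abs_if)
next
  fix r assume r: "r \<in> {-\<rho>/8..\<rho>/8}"
  have im: "(\<lambda>z. fst z + r *\<^sub>R e) ` slice \<subseteq> Dom"
    using move_in_Dom r by (auto simp: abs_le_iff slice_def simp del: mem_ball)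
  have L: "continuous_on Dom (\<lambda>y. \<Lambda>' (p y))"
    using continuous_map_compose[OF p_cont cont(2)] by (simp add: o_def)
  have l: "continuous_on slice (\<lambda>z. fst z + r *\<^sub>R e)" by (intro continuous_intros)
  show "continuous_on slice (\<lambda>z. w (fst z + r *\<^sub>R e) - snd z * \<Lambda>' (p (fst z + r *\<^sub>R e)))"
    using continuous_on_compose2[OF cont(3) l im] continuous_on_compose2[OF L l im]
    by (intro continuous_intros) auto
qed (rule pos)

definition slide :: "'a \<times> real \<Rightarrow> 'a \<times> real" where
  "slide z = (if fst z \<in> p ` ball y0 (\<rho>/2) then p (f (fst z) + shift (f (fst z)) (snd z) *\<^sub>R e) else fst z, snd z)"

lemma slide_cases:
  assumes "z \<in> level_tube M U eps \<Lambda>"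
  obtains (inside) y t where "z = (p y, t)" "(y, t) \<in> slice" "slide z = (p (y + shift y t *\<^sub>R e), t)" "y \<in> Dom"
  | (outside) "fst z \<notin> p ` ball y0 (\<rho>/2)" "slide z = z" "\<Lambda> (fst z) = \<Lambda>' (fst z)"
proof (cases "fst z \<in> p ` ball y0 (\<rho>/2)")
  case True
  then obtain y where y: "y \<in> ball y0 (\<rho>/2)" "fst z = p y" by auto
  have yO: "y \<in> Dom" using in_ball_Dom[OF y(1)] pos by simp
  have "y \<in> cball y0 \<rho>" using y(1) pos by auto
  then have "(y, snd z) \<in> slice"
    using assms y level(1)[of y "snd z"] by (auto simp: slice_def level_tube_def)
  moreover have "slide z = (p (y + shift y (snd z) *\<^sub>R e), snd z)"
    using True y yO by (simp add: slide_def)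
  ultimately show thesis using inside[of y "snd z"] y yO by (metis prod.collapse)
next
  case False
  have "p ` ball y0 (\<rho>/4) \<subseteq> p ` ball y0 (\<rho>/2)" using pos by (intro image_mono) auto
  then have "fst z \<notin> p ` ball y0 (\<rho>/4)" using False by blast
  moreover have "fst z \<in> topspace M" using assms by (auto simp: level_tube_def)
  ultimately have "\<Lambda> (fst z) = \<Lambda>' (fst z)" using agree by blast
  then show thesis using outside False by (simp add: slide_def)
qed

lemma slide_in:
  assumes z: "z \<in> level_tube M U eps \<Lambda>" shows "slide z \<in> level_tube M U eps \<Lambda>'" "snd (slide z) = snd z"
proof -
  show "snd (slide z) = snd z" by (simp add: slide_def)
  show "slide z \<in> level_tube M U eps \<Lambda>'"
    using z
  proof (cases rule: slide_cases)
    case (inside y t)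
    let ?y = "y + shift y t *\<^sub>R e"
    have b: "?y \<in> ball y0 (\<rho>/2)" by (rule shifted_in_half_ball[OF inside(2)])
    then have "?y \<in> cball y0 \<rho>" "?y \<in> Dom" using half_ball_Dom[of "\<rho>/2"] pos by auto
    moreover have "\<bar>t\<bar> < eps" using inside(2) by (simp add: slice_def)
    ultimately show ?thesis
      using level(2)[of ?y t] shift_root(2)[OF inside(2)] p_in(2)[of ?y] inside(3) by (simp add: level_tube_def)
  next
    case outside
    then show ?thesis using z by (auto simp: level_tube_def)
  qed
qed

lemma slide_inverse:
  assumes z: "z \<in> level_tube M U eps \<Lambda>"
  shows "slide_box.slide f p y0 e \<rho> w \<Lambda> (slide z) = z"
proof -
  interpret F: slide_box M W f p Dom U y0 e \<rho> c eps w \<Lambda>' \<Lambda> by (rule flipped)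
  show ?thesis
    using z
  proof (cases rule: slide_cases)
    case (inside y t)
    let ?y = "y + shift y t *\<^sub>R e"
    have b: "?y \<in> ball y0 (\<rho>/2)" by (rule shifted_in_half_ball[OF inside(2)])
    then have yO: "?y \<in> Dom" using half_ball_Dom[of "\<rho>/2"] pos by auto
    \<comment> \<open>Moving back solves the exchanged equation, and its root is unique.\<close>
    have "F.shift ?y t = - shift y t"
      using inside(2) shift_root(1)[OF inside(2)] b by (intro F.shift_unique) (auto simp: slice_def)
    then show ?thesis using b yO inside(1,3) by (simp add: F.slide_def)
  next
    case outside
    then show ?thesis by (simp add: F.slide_def prod_eq_iff)
  qed
qed

text \<open>Two open sets are pasted: the half ball, where the chart formula applies, and the
  complement of the closed ball of radius \<open>3*\<rho>/8\<close>, where the slide is the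
  identity. The radius 3/8 lies between 1/4, beyond which nothing moves, and 1/2.\<close>

lemma slide_cont: "continuous_map (tube_topology M U eps \<Lambda>) (prod_topology M euclideanreal) slide"
proof -
  let ?X = "tube_topology M U eps \<Lambda>"
  define T1 where "T1 = {z \<in> level_tube M U eps \<Lambda>. fst z \<in> p ` ball y0 (\<rho>/2)}"
  define T2 where "T2 = {z \<in> level_tube M U eps \<Lambda>. fst z \<in> topspace M - p ` cball y0 (3*\<rho>/8)}"
  have fst_cont: "continuous_map ?X M fst" and snd_cont: "continuous_map ?X euclideanreal snd"
    by (auto intro: continuous_map_from_subtopology continuous_map_fst continuous_map_snd)
  have op: "openin ?X T1" "openin ?X T2"
  proof -
    have "openin M (p ` ball y0 (\<rho>/2))" using half_ball_Dom pos by (intro p_open) auto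
    then show "openin ?X T1"
      unfolding T1_def by (rule openin_continuous_map_preimage[OF fst_cont, unfolded topspace_tube])
    have "closedin M (p ` cball y0 (3*\<rho>/8))" using half_ball_Dom pos by (intro p_closed) auto
    then have "openin M (topspace M - p ` cball y0 (3*\<rho>/8))" by blast
    then show "openin ?X T2"
      unfolding T2_def by (rule openin_continuous_map_preimage[OF fst_cont, unfolded topspace_tube])
  qed
  have slide_T1: "slide z = (p (f (fst z) + shift (f (fst z)) (snd z) *\<^sub>R e), snd z)" if "z \<in> T1" for z
    using that by (simp add: T1_def slide_def)
  have T1_slice: "(f (fst z), snd z) \<in> slice" "fst z \<in> W" if "z \<in> T1" for z
  proof -
    have "z \<in> level_tube M U eps \<Lambda>" using that by (simp add: T1_def)
    then have "(f (fst z), snd z) \<in> slice \<and> fst z \<in> W"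
    proof (cases rule: slide_cases)
      case (inside y t)
      then show ?thesis using p_in by auto
    next
      case outside
      then show ?thesis using that by (simp add: T1_def)
    qed
    then show "(f (fst z), snd z) \<in> slice" "fst z \<in> W" by auto
  qed
  have slide_T2: "slide z = z" if z: "z \<in> T2" for z
  proof -
    have "z \<in> level_tube M U eps \<Lambda>" using z by (simp add: T2_def)
    then show ?thesis
    proof (cases rule: slide_cases)
      case (inside y t)
      then have "y \<notin> cball y0 (3*\<rho>/8)" using z by (auto simp: T2_def)
      then have "y \<notin> ball y0 (\<rho>/4)" using pos by auto
      then show ?thesis using inside shift_0[OF inside(2)] by simp
    qed
  qed
  have cont1: "continuous_map (subtopology ?X T1) (prod_topology M euclideanreal) slide"
  proof -
    have a: "continuous_map (subtopology ?X T1) (subtopology M W) fst"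
      using continuous_map_from_subtopology[OF fst_cont] T1_slice(2)
      by (auto simp: continuous_map_in_subtopology)
    have "continuous_map (subtopology ?X T1) (top_of_set slice) (\<lambda>z. (f (fst z), snd z))"
    proof -
      have "continuous_map (subtopology ?X T1) euclidean (\<lambda>z. f (fst z))"
        using continuous_map_compose[OF a f_cont] by (simp add: o_def continuous_map_in_subtopology)
      then have "continuous_map (subtopology ?X T1) (prod_topology euclidean euclideanreal) (\<lambda>z. (f (fst z), snd z))"
        using continuous_map_from_subtopology[OF snd_cont, of T1]
        by (simp add: continuous_map_pairwise o_def del: prod_topology_euclidean)
      then show ?thesis using T1_slice(1) by (auto simp: continuous_map_in_subtopology)
    qed
    moreover have "continuous_map (top_of_set slice) (top_of_set Dom) (\<lambda>z. fst z + shift (fst z) (snd z) *\<^sub>R e)"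
      using shifted_in_half_ball half_ball_Dom[of "\<rho>/2"] pos
      by (auto simp: continuous_map_in_subtopology intro!: continuous_intros shift_cont)
    ultimately have "continuous_map (subtopology ?X T1) (top_of_set Dom)
        ((\<lambda>z. fst z + shift (fst z) (snd z) *\<^sub>R e) \<circ> (\<lambda>z. (f (fst z), snd z)))"
      by (rule continuous_map_compose)
    from continuous_map_compose[OF this p_cont]
    have "continuous_map (subtopology ?X T1) M (\<lambda>z. p (f (fst z) + shift (f (fst z)) (snd z) *\<^sub>R e))"
      by (simp add: o_def)
    then have "continuous_map (subtopology ?X T1) (prod_topology M euclideanreal)
        (\<lambda>z. (p (f (fst z) + shift (f (fst z)) (snd z) *\<^sub>R e), snd z))"
      using continuous_map_from_subtopology[OF snd_cont] by (simp add: continuous_map_pairwise o_def)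
    then show ?thesis
      by (rule continuous_map_eq) (simp add: slide_T1)
  qed
  have cont2: "continuous_map (subtopology ?X T2) (prod_topology M euclideanreal) slide"
  proof (rule continuous_map_eq)
    show "continuous_map (subtopology ?X T2) (prod_topology M euclideanreal) (\<lambda>z. z)"
      by (intro continuous_map_from_subtopology) simp
  qed (simp add: slide_T2)
  show ?thesis
  proof (rule pasting_lemma[where I="{T1, T2}" and T="\<lambda>S. S" and f="\<lambda>_. slide"])
    fix z assume "z \<in> topspace ?X"
    then have z: "z \<in> level_tube M U eps \<Lambda>" by simp
    have "z \<in> T1 \<or> z \<in> T2"
    proof -
      have "p ` cball y0 (3*\<rho>/8) \<subseteq> p ` ball y0 (\<rho>/2)" using pos by (intro image_mono) auto
      then show ?thesis using z by (auto simp: T1_def T2_def level_tube_def)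
    qed
    then show "\<exists>j. j \<in> {T1, T2} \<and> z \<in> j \<and> slide z = slide z" by blast
  qed (use op cont1 cont2 in auto)
qed

lemma slide_homeomorphism:
  "\<exists>m m'. homeomorphic_maps (tube_topology M U eps \<Lambda>) (tube_topology M U eps \<Lambda>') m m' \<and>
     (\<forall>z\<in>level_tube M U eps \<Lambda>. snd (m z) = snd z)"
proof -
  interpret F: slide_box M W f p Dom U y0 e \<rho> c eps w \<Lambda>' \<Lambda> by (rule flipped)
  have "homeomorphic_maps (tube_topology M U eps \<Lambda>) (tube_topology M U eps \<Lambda>') slide F.slide"
    unfolding homeomorphic_maps_def topspace_tube
  proof (intro conjI ballI)
    show "continuous_map (tube_topology M U eps \<Lambda>) (tube_topology M U eps \<Lambda>') slide"
      using slide_cont slide_in(1) unfolding continuous_map_in_subtopology topspace_tube by blast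
    show "continuous_map (tube_topology M U eps \<Lambda>') (tube_topology M U eps \<Lambda>) F.slide"
      using F.slide_cont F.slide_in(1) unfolding continuous_map_in_subtopology topspace_tube by blast
  qed (fact slide_inverse, fact F.slide_inverse)
  then show ?thesis using slide_in(2) by blast
qed

end

section \<open>Twice differentiable functions\<close>

text \<open>Differentiability of the gradient is what the null set argument for images in higher
  dimension consumes; asking for it on a neighbourhood makes the condition open. The gradient,
  rather than the derivative as a linear map, keeps second derivatives within vector valued
  functions.\<close>

definition twice_diff :: "('b::euclidean_space \<Rightarrow> real) \<Rightarrow> 'b \<Rightarrow> bool" where
  "twice_diff q y \<longleftrightarrow> (\<exists>S G. open S \<and> y \<in> S \<and>
     (\<forall>z\<in>S. (q has_derivative (\<lambda>h. G z \<bullet> h)) (at z) \<and> G differentiable (at z)))"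

definition grad :: "('b::euclidean_space \<Rightarrow> real) \<Rightarrow> 'b \<Rightarrow> 'b" where
  "grad q y = (SOME g. (q has_derivative (\<lambda>h. g \<bullet> h)) (at y))"

lemma grad_eq:
  assumes "(q has_derivative (\<lambda>h. g \<bullet> h)) (at y)" shows "grad q y = g"
proof -
  have "(q has_derivative (\<lambda>h. grad q y \<bullet> h)) (at y)"
    unfolding grad_def by (rule someI[of "\<lambda>g. (q has_derivative (\<lambda>h. g \<bullet> h)) (at y)", OF assms])
  then have "(\<lambda>h. grad q y \<bullet> h) = (\<lambda>h. g \<bullet> h)"
    using assms by (rule has_derivative_unique)
  then show ?thesis
    by (metis euclidean_eqI)
qed

lemma twice_diffI:
  assumes "open S" "y \<in> S" "\<And>z. z \<in> S \<Longrightarrow> (q has_derivative (\<lambda>h. G z \<bullet> h)) (at z)"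
    "\<And>z. z \<in> S \<Longrightarrow> G differentiable (at z)"
  shows "twice_diff q y"
  using assms unfolding twice_diff_def by blast

lemma twice_diff_grad:
  assumes "twice_diff q y"
  shows "(q has_derivative (\<lambda>h. grad q y \<bullet> h)) (at y)" "grad q differentiable (at y)"
proof -
  obtain S G where S: "open S" "y \<in> S" "\<And>z. z \<in> S \<Longrightarrow> (q has_derivative (\<lambda>h. G z \<bullet> h)) (at z)"
    "\<And>z. z \<in> S \<Longrightarrow> G differentiable (at z)"
    using assms unfolding twice_diff_def by blast
  have eq: "grad q z = G z" if "z \<in> S" for z using grad_eq S(3) that by blast
  show "(q has_derivative (\<lambda>h. grad q y \<bullet> h)) (at y)" using S(3)[OF S(2)] eq[OF S(2)] by simp
  obtain G' where "(G has_derivative G') (at y)" using S(4)[OF S(2)] by (auto simp: differentiable_def)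
  then have "(grad q has_derivative G') (at y)"
    by (rule has_derivative_transform_within_open[OF _ S(1,2)]) (simp add: eq)
  then show "grad q differentiable (at y)" by (auto simp: differentiable_def)
qed

lemma twice_diff_open:
  assumes "twice_diff q y" shows "\<exists>S. open S \<and> y \<in> S \<and> (\<forall>z\<in>S. twice_diff q z)"
  using assms unfolding twice_diff_def by meson

lemma twice_diff_cong:
  assumes "twice_diff q y" "open S" "y \<in> S" "\<And>z. z \<in> S \<Longrightarrow> q z = q' z"
  shows "twice_diff q' y" "grad q' y = grad q y"
proof -
  obtain T where T: "open T" "y \<in> T" "\<And>z. z \<in> T \<Longrightarrow> twice_diff q z" using twice_diff_open[OF assms(1)] by blast
  have d: "(q' has_derivative (\<lambda>h. grad q z \<bullet> h)) (at z)" if "z \<in> S \<inter> T" for z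
    by (rule has_derivative_transform_within_open[OF twice_diff_grad(1)[OF T(3)] assms(2)])
      (use that assms(4) in auto)
  show "twice_diff q' y"
    by (rule twice_diffI[of "S \<inter> T" _ _ "grad q"]) (use assms T d in \<open>auto intro: twice_diff_grad(2)\<close>)
  show "grad q' y = grad q y" using d[of y] assms(3) T(2) by (intro grad_eq) auto
qed

lemma twice_diff_pair:
  assumes "twice_diff q y" "twice_diff q' y"
  shows "\<exists>S. open S \<and> y \<in> S \<and> (\<forall>z\<in>S. twice_diff q z) \<and> (\<forall>z\<in>S. twice_diff q' z)"
proof -
  obtain S where S: "open S" "y \<in> S" "\<And>z. z \<in> S \<Longrightarrow> twice_diff q z" using twice_diff_open[OF assms(1)] by blast
  obtain T where T: "open T" "y \<in> T" "\<And>z. z \<in> T \<Longrightarrow> twice_diff q' z" using twice_diff_open[OF assms(2)] by blast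
  show ?thesis by (rule exI[of _ "S \<inter> T"]) (use S T in auto)
qed

lemma twice_diff_differentiable: "twice_diff q y \<Longrightarrow> q differentiable (at y)"
  using twice_diff_grad(1) differentiableI by blast

lemma twice_diff_isCont: "twice_diff q y \<Longrightarrow> isCont q y"
  using twice_diff_differentiable differentiable_imp_continuous_within by blast

lemma twice_diff_isCont_grad: "twice_diff q y \<Longrightarrow> isCont (grad q) y"
  using twice_diff_grad(2) differentiable_imp_continuous_within by blast

lemma twice_diff_const [simp]: "twice_diff (\<lambda>_. c) y"
  by (rule twice_diffI[of UNIV _ _ "\<lambda>_. 0"]) auto

lemma twice_diff_inner [simp]: "twice_diff (\<lambda>y. a \<bullet> y) y"
  by (rule twice_diffI[of UNIV _ _ "\<lambda>_. a"]) (auto intro!: derivative_eq_intros)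

lemma twice_diff_add:
  assumes "twice_diff q y" "twice_diff q' y"
  shows "twice_diff (\<lambda>z. q z + q' z) y" "grad (\<lambda>z. q z + q' z) y = grad q y + grad q' y"
proof -
  obtain S where S: "open S" "y \<in> S" "\<And>z. z \<in> S \<Longrightarrow> twice_diff q z" "\<And>z. z \<in> S \<Longrightarrow> twice_diff q' z"
    using twice_diff_pair[OF assms] by blast
  have d: "((\<lambda>z. q z + q' z) has_derivative (\<lambda>h. (grad q z + grad q' z) \<bullet> h)) (at z)" if "z \<in> S" for z
    using S(3,4)[OF that, THEN twice_diff_grad(1)] by (auto intro!: derivative_eq_intros simp: inner_add_left)
  show "twice_diff (\<lambda>z. q z + q' z) y"
    by (rule twice_diffI[of S _ _ "\<lambda>z. grad q z + grad q' z"]) (use S d in \<open>auto intro!: differentiable_add twice_diff_grad(2)\<close>)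
  show "grad (\<lambda>z. q z + q' z) y = grad q y + grad q' y" using d[OF S(2)] by (rule grad_eq)
qed

lemma twice_diff_mult:
  assumes "twice_diff q y" "twice_diff q' y"
  shows "twice_diff (\<lambda>z. q z * q' z) y" "grad (\<lambda>z. q z * q' z) y = q y *\<^sub>R grad q' y + q' y *\<^sub>R grad q y"
proof -
  obtain S where S: "open S" "y \<in> S" "\<And>z. z \<in> S \<Longrightarrow> twice_diff q z" "\<And>z. z \<in> S \<Longrightarrow> twice_diff q' z"
    using twice_diff_pair[OF assms] by blast
  have d: "((\<lambda>z. q z * q' z) has_derivative (\<lambda>h. (q z *\<^sub>R grad q' z + q' z *\<^sub>R grad q z) \<bullet> h)) (at z)" if "z \<in> S" for z
    using S(3,4)[OF that, THEN twice_diff_grad(1)]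
    by (auto intro!: derivative_eq_intros simp: inner_add_left)
  show "twice_diff (\<lambda>z. q z * q' z) y"
    by (rule twice_diffI[of S _ _ "\<lambda>z. q z *\<^sub>R grad q' z + q' z *\<^sub>R grad q z"])
      (use S d in \<open>auto intro!: differentiable_add differentiable_scaleR twice_diff_grad(2) twice_diff_differentiable\<close>)
  show "grad (\<lambda>z. q z * q' z) y = q y *\<^sub>R grad q' y + q' y *\<^sub>R grad q y" using d[OF S(2)] by (rule grad_eq)
qed

lemma twice_diff_minus: "twice_diff q y \<Longrightarrow> twice_diff (\<lambda>z. - q z) y"
  using twice_diff_mult(1)[of "\<lambda>_. -1" y q] by simp

lemma twice_diff_diff: "twice_diff q y \<Longrightarrow> twice_diff q' y \<Longrightarrow> twice_diff (\<lambda>z. q z - q' z) y"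
  using twice_diff_add(1)[of q y "\<lambda>z. - q' z"] twice_diff_minus[of q' y] by simp

lemma twice_diff_sum:
  assumes "\<And>i. i \<in> I \<Longrightarrow> twice_diff (q i) y" shows "twice_diff (\<lambda>z. \<Sum>i\<in>I. q i z) y"
  using assms by (induction I rule: infinite_finite_induct) (auto intro: twice_diff_add)

lemma twice_diff_compose_real:
  assumes q: "twice_diff q y"
    and \<psi>: "open J" "q y \<in> J" "\<And>s. s \<in> J \<Longrightarrow> (\<psi> has_real_derivative \<psi>1 s) (at s)"
      "\<And>s. s \<in> J \<Longrightarrow> \<psi>1 differentiable (at s)"
  shows "twice_diff (\<lambda>z. \<psi> (q z)) y" "grad (\<lambda>z. \<psi> (q z)) y = \<psi>1 (q y) *\<^sub>R grad q y"
proof -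
  obtain S where S: "open S" "y \<in> S" "\<And>z. z \<in> S \<Longrightarrow> twice_diff q z" using twice_diff_open[OF q] by blast
  have "continuous_on S q" by (intro continuous_at_imp_continuous_on ballI twice_diff_isCont S(3))
  then have op: "open (S \<inter> q -` J)" using S(1) \<psi>(1) by (simp add: continuous_open_preimage)
  have d: "((\<lambda>z. \<psi> (q z)) has_derivative (\<lambda>h. (\<psi>1 (q z) *\<^sub>R grad q z) \<bullet> h)) (at z)" if "z \<in> S \<inter> q -` J" for z
  proof -
    have "(\<psi> has_derivative (\<lambda>h. \<psi>1 (q z) * h)) (at (q z))"
      using \<psi>(3)[of "q z"] that by (simp add: has_field_derivative_def)
    moreover have "(q has_derivative (\<lambda>h. grad q z \<bullet> h)) (at z)"
      using that by (intro twice_diff_grad(1) S(3)) simp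
    ultimately have "((\<lambda>z. \<psi> (q z)) has_derivative (\<lambda>h. \<psi>1 (q z) * (grad q z \<bullet> h))) (at z)"
      by (rule has_derivative_compose[rotated])
    then show ?thesis by simp
  qed
  have d1: "(\<lambda>z. \<psi>1 (q z)) differentiable (at z)" if "z \<in> S \<inter> q -` J" for z
    by (rule differentiable_compose[OF \<psi>(4) twice_diff_differentiable[OF S(3)]]) (use that in auto)
  show "twice_diff (\<lambda>z. \<psi> (q z)) y"
    by (rule twice_diffI[of "S \<inter> q -` J" _ _ "\<lambda>z. \<psi>1 (q z) *\<^sub>R grad q z"])
      (use S op d d1 \<psi>(2) in \<open>auto intro!: differentiable_scaleR twice_diff_grad(2)\<close>)
  show "grad (\<lambda>z. \<psi> (q z)) y = \<psi>1 (q y) *\<^sub>R grad q y" using d[of y] S(2) \<psi>(2) by (intro grad_eq) auto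
qed

lemma twice_diff_inverse:
  assumes "twice_diff q y" "q y \<noteq> 0" shows "twice_diff (\<lambda>z. inverse (q z)) y"
proof (rule twice_diff_compose_real(1)[OF assms(1), of "- {0}" inverse "\<lambda>s. - (inverse s ^ 2)"])
  fix s :: real assume "s \<in> - {0}"
  then show "(inverse has_real_derivative - ((inverse s)\<^sup>2)) (at s)"
    by (auto intro!: derivative_eq_intros simp: power2_eq_square)
  show "(\<lambda>s. - ((inverse s)\<^sup>2)) differentiable at s"
    using \<open>s \<in> - {0}\<close> by (auto intro!: derivative_intros)
qed (use assms(2) in auto)

lemma twice_diff_divide:
  "twice_diff q y \<Longrightarrow> twice_diff q' y \<Longrightarrow> q' y \<noteq> 0 \<Longrightarrow> twice_diff (\<lambda>z. q z / q' z) y"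
  unfolding divide_inverse by (intro twice_diff_mult(1) twice_diff_inverse)

text \<open>The chain rule for inner functions given by components, applied to transition maps. Of
  the gradient only its vanishing is carried from one chart to another, so no Jacobian has to be
  inverted.\<close>

lemma twice_diff_compose:
  fixes \<tau> :: "'c::euclidean_space \<Rightarrow> 'b::euclidean_space"
  assumes q: "twice_diff q (\<tau> y)" and \<tau>: "\<And>b. b \<in> Basis \<Longrightarrow> twice_diff (\<lambda>z. \<tau> z \<bullet> b) y"
  shows "twice_diff (\<lambda>z. q (\<tau> z)) y" "grad q (\<tau> y) = 0 \<Longrightarrow> grad (\<lambda>z. q (\<tau> z)) y = 0"
proof -
  define S where "S b = (SOME S. open S \<and> y \<in> S \<and> (\<forall>z\<in>S. twice_diff (\<lambda>z. \<tau> z \<bullet> b) z))" for b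
  have S: "open (S b)" "y \<in> S b" "\<And>z. z \<in> S b \<Longrightarrow> twice_diff (\<lambda>z. \<tau> z \<bullet> b) z" if "b \<in> Basis" for b
  proof -
    have "\<exists>S. open S \<and> y \<in> S \<and> (\<forall>z\<in>S. twice_diff (\<lambda>z. \<tau> z \<bullet> b) z)" using twice_diff_open[OF \<tau>[OF that]] .
    from someI_ex[OF this] show "open (S b)" "y \<in> S b" "\<And>z. z \<in> S b \<Longrightarrow> twice_diff (\<lambda>z. \<tau> z \<bullet> b) z"
      unfolding S_def by blast+
  qed
  define V where "V = (\<Inter>b\<in>Basis. S b)"
  have V: "open V" "y \<in> V" "\<And>z b. z \<in> V \<Longrightarrow> b \<in> Basis \<Longrightarrow> twice_diff (\<lambda>z. \<tau> z \<bullet> b) z"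
    using S by (auto simp: V_def)
  define g where "g b = grad (\<lambda>z. \<tau> z \<bullet> b)" for b
  have \<tau>d: "(\<tau> has_derivative (\<lambda>h. \<Sum>b\<in>Basis. (g b z \<bullet> h) *\<^sub>R b)) (at z)" if "z \<in> V" for z
    unfolding has_derivative_componentwise_within[of \<tau> _ z UNIV]
    using twice_diff_grad(1)[OF V(3)[OF that]] by (simp add: g_def)
  have gd: "g b differentiable (at z)" if "z \<in> V" "b \<in> Basis" for z b
    using twice_diff_grad(2)[OF V(3)[OF that]] by (simp add: g_def)
  obtain T where T: "open T" "\<tau> y \<in> T" "\<And>z. z \<in> T \<Longrightarrow> twice_diff q z" using twice_diff_open[OF q] by blast
  have "continuous_on V \<tau>"
    using \<tau>d has_derivative_continuous by (intro continuous_at_imp_continuous_on) blast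
  then have op: "open (V \<inter> \<tau> -` T)" using V(1) T(1) by (simp add: continuous_open_preimage)
  let ?G = "\<lambda>z. \<Sum>b\<in>Basis. (grad q (\<tau> z) \<bullet> b) *\<^sub>R g b z"
  have d: "((\<lambda>z. q (\<tau> z)) has_derivative (\<lambda>h. ?G z \<bullet> h)) (at z)" if "z \<in> V \<inter> \<tau> -` T" for z
  proof -
    have "((\<lambda>z. q (\<tau> z)) has_derivative (\<lambda>h. grad q (\<tau> z) \<bullet> (\<Sum>b\<in>Basis. (g b z \<bullet> h) *\<^sub>R b))) (at z)"
      by (rule has_derivative_compose[OF \<tau>d twice_diff_grad(1)[OF T(3)]]) (use that in auto)
    then show ?thesis by (simp add: inner_sum_right inner_sum_left mult.commute)
  qed
  have "?G differentiable (at z)" if "z \<in> V \<inter> \<tau> -` T" for z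
  proof -
    have "(\<lambda>z. grad q (\<tau> z)) differentiable (at z)"
      by (rule differentiable_compose[OF twice_diff_grad(2)[OF T(3)] differentiableI[OF \<tau>d]]) (use that in auto)
    then show ?thesis using gd that by (intro differentiable_sum) (auto intro!: derivative_intros)
  qed
  then show "twice_diff (\<lambda>z. q (\<tau> z)) y"
    by (intro twice_diffI[of "V \<inter> \<tau> -` T" _ _ ?G]) (use V T op d in auto)
  show "grad (\<lambda>z. q (\<tau> z)) y = 0" if "grad q (\<tau> y) = 0"
    using d[of y] V(2) T(2) that by (intro grad_eq) simp
qed

lemma twice_diff_minus_grad:
  assumes "twice_diff q y" "twice_diff q' y"
  shows "grad (\<lambda>z. q z - q' z) y = grad q y - grad q' y"
proof -
  have "grad (\<lambda>z. - q' z) y = - grad q' y"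
    using twice_diff_mult(2)[of "\<lambda>_. -1" y q'] assms(2) grad_eq[of "\<lambda>_. -1" 0 y] by simp
  then show ?thesis
    using twice_diff_add(2)[OF assms(1) twice_diff_minus[OF assms(2)]] by simp
qed

lemma grad_const [simp]: "grad (\<lambda>_. c) y = 0"
  by (rule grad_eq) simp

lemma grad_affine: "grad (\<lambda>z. a \<bullet> z + c) y = a"
  by (rule grad_eq) (auto intro!: derivative_eq_intros)

lemma twice_diff_affine: "twice_diff (\<lambda>z. a \<bullet> z + c) y"
  by (intro twice_diff_add twice_diff_inner twice_diff_const)

section \<open>A bump function on the unit ball\<close>

definition bump :: "'b::euclidean_space \<Rightarrow> real" where
  "bump y = (max 0 (1 - y \<bullet> y)) ^ 3"

text \<open>Used for powers 3 and 2: the cube is the least power of the positive part whose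
  derivative is again differentiable at 0, which explains the exponent in
  \<open>bump\<close>.\<close>

lemma pos_part_power_deriv:
  assumes "n \<ge> 2" shows "((\<lambda>s. max 0 s ^ n) has_real_derivative real n * max 0 s ^ (n - 1)) (at s)"
proof -
  consider "s < 0" | "s = 0" | "s > (0::real)" by linarith
  then show ?thesis
  proof cases
    case 1
    have "((\<lambda>s. 0) has_real_derivative 0) (at s)" by simp
    then have "((\<lambda>s. max 0 s ^ n) has_real_derivative 0) (at s)"
      by (rule has_field_derivative_transform_within_open[of _ _ _ "{..<0}"]) (use 1 assms in auto)
    moreover have "real n * max 0 s ^ (n - 1) = 0" using 1 assms by simp
    ultimately show ?thesis by (simp only:)
  next
    case 2
    have "((\<lambda>h. max 0 h ^ n / h) \<longlongrightarrow> 0) (at (0::real))"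
    proof (rule Lim_null_comparison)
      show "\<forall>\<^sub>F h in at 0. norm (max 0 h ^ n / h) \<le> \<bar>h\<bar> ^ (n - 1)"
      proof (intro always_eventually allI)
        fix h :: real
        have "\<bar>max 0 h ^ n / h\<bar> \<le> \<bar>h\<bar> ^ n / \<bar>h\<bar>"
          by (auto simp: abs_mult power_abs intro!: divide_right_mono power_mono)
        also have "\<dots> = \<bar>h\<bar> ^ (n - 1)" if "h \<noteq> 0" using that assms by (cases n) auto
        finally show "norm (max 0 h ^ n / h) \<le> \<bar>h\<bar> ^ (n - 1)" by (cases "h = 0") (use assms in auto)
      qed
      show "((\<lambda>h. \<bar>h\<bar> ^ (n - 1)) \<longlongrightarrow> 0) (at (0::real))"
        using assms by (auto intro!: tendsto_eq_intros)
    qed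
    moreover obtain m where "n = Suc (Suc m)"
      using assms by (metis Suc_le_D numeral_2_eq_2 Suc_le_mono)
    ultimately show ?thesis unfolding 2 DERIV_def by simp
  next
    case 3
    have "((\<lambda>s. s ^ n) has_real_derivative real n * s ^ (n - 1)) (at s)"
      by (auto intro!: derivative_eq_intros)
    then have "((\<lambda>s. max 0 s ^ n) has_real_derivative real n * s ^ (n - 1)) (at s)"
      by (rule has_field_derivative_transform_within_open[of _ _ _ "{0<..}"]) (use 3 in auto)
    then show ?thesis using 3 by simp
  qed
qed

lemma twice_diff_bump: "twice_diff bump (y :: 'b::euclidean_space)" and grad_bump: "1 \<le> norm y \<Longrightarrow> grad bump y = 0"
proof -
  let ?q = "\<lambda>y::'b. 1 - y \<bullet> y"
  have q: "twice_diff ?q y"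
    by (rule twice_diffI[of UNIV _ _ "\<lambda>y. (- 2) *\<^sub>R y"]) (auto intro!: derivative_eq_intros simp: inner_commute)
  have d: "((\<lambda>s. max 0 s ^ 3) has_real_derivative 3 * max 0 s ^ 2) (at s)"
    "((\<lambda>s. 3 * max 0 s ^ 2) differentiable (at s))" for s :: real
    using pos_part_power_deriv[of 3 s] DERIV_cmult[OF pos_part_power_deriv[of 2 s], of 3]
    unfolding has_field_derivative_def by (auto simp: differentiable_def)
  show "twice_diff bump y"
    unfolding bump_def by (rule twice_diff_compose_real(1)[OF q open_UNIV _ d]) simp
  show "grad bump y = 0" if "1 \<le> norm y"
  proof -
    have "1 \<le> y \<bullet> y" using that by (simp add: dot_square_norm)
    then show ?thesis
      unfolding bump_def using twice_diff_compose_real(2)[OF q open_UNIV _ d] by simp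
  qed
qed

lemma bump_nonneg: "0 \<le> bump y" by (simp add: bump_def)

lemma bump_pos_iff: "0 < bump y \<longleftrightarrow> norm y < 1"
proof -
  have "norm y < 1 \<longleftrightarrow> y \<bullet> y < 1"
    using abs_square_less_1[of "norm y"] by (simp add: dot_square_norm)
  then show ?thesis by (auto simp: bump_def zero_less_power_eq max_def)
qed

lemma bump_0: "1 \<le> norm y \<Longrightarrow> bump y = 0"
  using bump_pos_iff[of y] bump_nonneg[of y] by linarith

lemma bump_le_1: "bump y \<le> 1"
  unfolding bump_def by (intro power_le_one) auto

section \<open>Multivalued functions with regular integer levels\<close>

text \<open>The charts have balls of radius 2 as images, yet their unit balls already cover.
  Functions supported in closed unit balls therefore extend by zero to all of
  \<open>M\<close>.\<close>

locale chart_system =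
  fixes M :: "'a topology" and I :: "'i set" and W :: "'i \<Rightarrow> 'a set"
    and f :: "'i \<Rightarrow> 'a \<Rightarrow> 'b::euclidean_space" and p :: "'i \<Rightarrow> 'b \<Rightarrow> 'a"
  assumes comp: "compact_space M" and finI: "finite I"
    and charts: "\<And>i. i \<in> I \<Longrightarrow> open_chart M (W i) (f i) (p i) (ball 0 2)"
    and cover: "\<And>x. x \<in> topspace M \<Longrightarrow> \<exists>i\<in>I. x \<in> W i \<and> norm (f i x) < 1"
    and trans: "\<And>i j y b. i \<in> I \<Longrightarrow> j \<in> I \<Longrightarrow> y \<in> ball 0 2 \<Longrightarrow> p i y \<in> W j \<Longrightarrow> b \<in> Basis \<Longrightarrow>
        twice_diff (\<lambda>z. f j (p i z) \<bullet> b) y"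
begin

definition localize :: "'i \<Rightarrow> ('b \<Rightarrow> real) \<Rightarrow> 'a \<Rightarrow> real" where
  "localize i q x = (if x \<in> W i then q (f i x) else 0)"

text \<open>The image of the compact support is closed in the Hausdorff space, so a point outside
  \<open>W i\<close> has a neighbourhood missing it.\<close>

lemma localize_zero_near:
  assumes i: "i \<in> I" and K: "compact K" "K \<subseteq> ball 0 2" "\<And>y. y \<notin> K \<Longrightarrow> q y = 0"
    and j: "j \<in> I" "y \<in> ball 0 2" "p j y \<notin> W i"
  shows "\<exists>S. open S \<and> y \<in> S \<and> (\<forall>z\<in>S. localize i q (p j z) = 0)"
proof -
  interpret i: open_chart M "W i" "f i" "p i" "ball 0 2" by (rule charts[OF i])
  interpret j: open_chart M "W j" "f j" "p j" "ball 0 2" by (rule charts[OF j(1)])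
  let ?V = "topspace M - p i ` K"
  have "openin M ?V" using i.p_closed[OF K(1,2)] by blast
  then have "open {z \<in> ball 0 2. p j z \<in> ?V}" by (rule j.p_vimage_open)
  moreover have "p i ` K \<subseteq> W i" using i.p_in(1) K(2) by (intro image_subsetI) (metis subsetD)
  then have "p j y \<in> ?V" using j(3) j.p_in(2)[OF j(2)] by blast
  moreover have "localize i q (p j z) = 0" if "p j z \<in> ?V" for z
  proof (cases "p j z \<in> W i")
    case True
    then have "f i (p j z) \<notin> K" using that by (metis DiffD2 i.pf image_eqI)
    then show ?thesis using K(3) by (simp add: localize_def)
  qed (simp add: localize_def)
  ultimately show ?thesis using j(2) by (intro exI[of _ "{z \<in> ball 0 2. p j z \<in> ?V}"]) auto
qed

text \<open>At points of \<open>W i\<close> the function is \<open>q\<close> after a transition map;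
  near all other points it is zero.\<close>

lemma localize_smooth:
  assumes i: "i \<in> I" and K: "compact K" "K \<subseteq> ball 0 2" "\<And>y. y \<notin> K \<Longrightarrow> q y = 0"
    and q: "\<And>y. twice_diff q y" and j: "j \<in> I" "y \<in> ball 0 2"
  shows "twice_diff (\<lambda>z. localize i q (p j z)) y"
    and "(p j y \<in> W i \<Longrightarrow> grad q (f i (p j y)) = 0) \<Longrightarrow> grad (\<lambda>z. localize i q (p j z)) y = 0"
proof -
  interpret i: open_chart M "W i" "f i" "p i" "ball 0 2" by (rule charts[OF i])
  interpret j: open_chart M "W j" "f j" "p j" "ball 0 2" by (rule charts[OF j(1)])
  have "twice_diff (\<lambda>z. localize i q (p j z)) y \<and>
     ((p j y \<in> W i \<longrightarrow> grad q (f i (p j y)) = 0) \<longrightarrow> grad (\<lambda>z. localize i q (p j z)) y = 0)"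
  proof (cases "p j y \<in> W i")
    case True
    let ?S = "{z \<in> ball 0 2. p j z \<in> W i}"
    note c = twice_diff_compose[OF q trans[OF j(1) i j(2) True]]
    have S: "open ?S" "y \<in> ?S" "\<And>z. z \<in> ?S \<Longrightarrow> q (f i (p j z)) = localize i q (p j z)"
      using j.p_vimage_open[OF i.W] j(2) True by (auto simp: localize_def)
    show ?thesis using twice_diff_cong[OF c(1) S] c(2) True by simp
  next
    case False
    have "\<exists>S. open S \<and> y \<in> S \<and> (\<forall>z\<in>S. localize i q (p j z) = 0)"
      by (rule localize_zero_near[OF i K j False])
    then obtain S where S: "open S" "y \<in> S" "\<forall>z\<in>S. localize i q (p j z) = 0" by blast
    then have "z \<in> S \<Longrightarrow> 0 = localize i q (p j z)" for z by simp
    from twice_diff_cong[OF twice_diff_const S(1,2) this] show ?thesis by simp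
  qed
  then show "twice_diff (\<lambda>z. localize i q (p j z)) y"
    "(p j y \<in> W i \<Longrightarrow> grad q (f i (p j y)) = 0) \<Longrightarrow> grad (\<lambda>z. localize i q (p j z)) y = 0" by blast+
qed

definition chart_smooth :: "('a \<Rightarrow> real) \<Rightarrow> bool" where
  "chart_smooth h \<longleftrightarrow> (\<forall>i\<in>I. \<forall>y\<in>ball 0 2. twice_diff (\<lambda>z. h (p i z)) y)"

lemma chart_smooth_localize:
  "\<lbrakk>i \<in> I; compact K; K \<subseteq> ball 0 2; \<And>y. y \<notin> K \<Longrightarrow> q y = 0; \<And>y. twice_diff q y\<rbrakk> \<Longrightarrow> chart_smooth (localize i q)"
  unfolding chart_smooth_def using localize_smooth(1) by blast

lemma continuous_in_charts:
  assumes i: "i \<in> I" and h: "\<And>y. y \<in> ball 0 2 \<Longrightarrow> twice_diff (\<lambda>z. h (p i z)) y"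
  shows "continuous_map (subtopology M (W i)) euclideanreal h"
proof -
  interpret i: open_chart M "W i" "f i" "p i" "ball 0 2" by (rule charts[OF i])
  have "continuous_on (ball 0 2) (\<lambda>z. h (p i z))"
    by (intro continuous_at_imp_continuous_on ballI twice_diff_isCont h)
  then have "continuous_map (top_of_set (ball 0 2)) euclideanreal (\<lambda>z. h (p i z))" by simp
  from continuous_map_compose[OF i.f_cont this]
  show ?thesis by (rule continuous_map_eq) auto
qed

lemma chart_smooth_continuous:
  assumes "chart_smooth h" shows "continuous_map M euclideanreal h"
proof (rule pasting_lemma[where I=I and T=W and f="\<lambda>_. h"])
  show "openin M (W i)" if "i \<in> I" for i using charts[OF that] by (simp add: open_chart_def)
  show "continuous_map (subtopology M (W i)) euclideanreal h" if "i \<in> I" for i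
    using continuous_in_charts[OF that] assms that by (simp add: chart_smooth_def)
  show "\<exists>j. j \<in> I \<and> x \<in> W j \<and> h x = h x" if "x \<in> topspace M" for x using cover[OF that] by blast
qed auto

section \<open>A partition of unity\<close>

lemma bump_support: "y \<notin> cball 0 1 \<Longrightarrow> bump y = 0"
  by (rule bump_0) simp

definition weight :: "'i \<Rightarrow> 'a \<Rightarrow> real" where
  "weight i x = localize i bump x / (\<Sum>j\<in>I. localize j bump x)"

lemma localize_bump_nonneg: "0 \<le> localize i bump x"
  by (simp add: localize_def bump_nonneg)

lemma total_bump_pos: "x \<in> topspace M \<Longrightarrow> 0 < (\<Sum>j\<in>I. localize j bump x)"
  using cover[of x] finI localize_bump_nonneg
  by (auto intro!: sum_pos2 simp: localize_def bump_pos_iff)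

lemma sum_weight: "x \<in> topspace M \<Longrightarrow> (\<Sum>i\<in>I. weight i x) = 1"
  using total_bump_pos[of x] by (simp add: weight_def flip: sum_divide_distrib)

lemma chart_smooth_weight:
  assumes "i \<in> I" shows "chart_smooth (weight i)"
  unfolding chart_smooth_def weight_def
proof (intro ballI)
  fix j y assume j: "j \<in> I" "y \<in> ball (0::'b) 2"
  have "p j y \<in> topspace M" using open_chart.p_in(2)[OF charts[OF j(1)] j(2)] .
  moreover have "twice_diff (\<lambda>z. localize i bump (p j z)) y" if "i \<in> I" for i
    by (rule localize_smooth(1)[where K="cball 0 1", OF that]) (use j in \<open>auto simp: twice_diff_bump bump_0\<close>)
  ultimately show "twice_diff (\<lambda>z. localize i bump (p j z) / (\<Sum>j'\<in>I. localize j' bump (p j z))) y"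
    using assms total_bump_pos[of "p j y"] by (intro twice_diff_divide twice_diff_sum) auto
qed

section \<open>Functions with locally constant integer jumps\<close>

context
  fixes g :: "'i \<Rightarrow> 'a \<Rightarrow> int"
begin

definition locally_constant_jumps :: bool where
  "locally_constant_jumps \<longleftrightarrow> (\<forall>i\<in>I. \<forall>j\<in>I. \<forall>V. path_connectedin M V \<longrightarrow> V \<subseteq> W i \<inter> W j \<longrightarrow>
     (\<forall>x\<in>V. \<forall>y\<in>V. g i x - g j x = g i y - g j y))"

text \<open>A small ball in the chart is path connected and stays inside both domains.\<close>

lemma jump_locally_constant:
  assumes g: "locally_constant_jumps"
    and "i \<in> I" "j \<in> I" "y \<in> ball 0 2" "p i y \<in> W j"
  shows "\<exists>S. open S \<and> y \<in> S \<and> S \<subseteq> ball 0 2 \<and>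
     (\<forall>z\<in>S. p i z \<in> W j \<and> g j (p i z) - g i (p i z) = g j (p i y) - g i (p i y))"
proof -
  interpret i: open_chart M "W i" "f i" "p i" "ball 0 2" by (rule charts[OF assms(2)])
  interpret j: open_chart M "W j" "f j" "p j" "ball 0 2" by (rule charts[OF assms(3)])
  have "open {z \<in> ball 0 2. p i z \<in> W j}" by (rule i.p_vimage_open[OF j.W])
  then obtain r where r: "r > 0" "ball y r \<subseteq> {z \<in> ball 0 2. p i z \<in> W j}"
    using assms(4,5) open_contains_ball by (metis (mono_tags, lifting) mem_Collect_eq)
  have pc: "path_connectedin M (p i ` ball y r)"
    using i.p_cont by (rule path_connectedin_continuous_map_image)
      (use r in \<open>auto simp: path_connectedin_subtopology convex_imp_path_connected\<close>)
  have sub: "p i ` ball y r \<subseteq> W j \<inter> W i" using r(2) i.p_in(1) by blast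
  show ?thesis
  proof (intro exI[of _ "ball y r"] conjI ballI)
    fix z assume z: "z \<in> ball y r"
    then show "p i z \<in> W j" using r by blast
    show "g j (p i z) - g i (p i z) = g j (p i y) - g i (p i y)"
      using g pc sub z r(1) assms(2,3) unfolding locally_constant_jumps_def by (meson centre_in_ball imageI)
  qed (use r in auto)
qed

definition branch :: "('a \<Rightarrow> real) \<Rightarrow> 'i \<Rightarrow> 'b \<Rightarrow> real" where
  "branch U i y = U (p i y) - real_of_int (g i (p i y))"

definition smooth_branches :: "('a \<Rightarrow> real) \<Rightarrow> bool" where
  "smooth_branches U \<longleftrightarrow> (\<forall>i\<in>I. \<forall>y\<in>ball 0 2. twice_diff (branch U i) y)"

text \<open>The weights sum to 1, so subtracting \<open>g i\<close> turns each summand into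
  \<open>weight j\<close> times \<open>g j - g i\<close>. That difference is locally constant on the
  overlap with \<open>W j\<close>, and near points outside \<open>W j\<close> the weight
  vanishes.\<close>

lemma smooth_branches_partition:
  assumes g: "locally_constant_jumps"
  shows "smooth_branches (\<lambda>x. \<Sum>j\<in>I. weight j x * real_of_int (g j x))"
  unfolding smooth_branches_def
proof (intro ballI)
  fix i y assume i: "i \<in> I" "y \<in> ball (0::'b) 2"
  interpret i: open_chart M "W i" "f i" "p i" "ball 0 2" by (rule charts[OF i(1)])
  let ?U = "\<lambda>x. \<Sum>j\<in>I. weight j x * real_of_int (g j x)"
  let ?t = "\<lambda>j z. weight j (p i z) * real_of_int (g j (p i z) - g i (p i z))"
  have eq: "(\<Sum>j\<in>I. ?t j z) = branch ?U i z" if "z \<in> ball 0 2" for z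
  proof -
    have "(\<Sum>j\<in>I. ?t j z) = (\<Sum>j\<in>I. weight j (p i z) * real_of_int (g j (p i z))) -
        (\<Sum>j\<in>I. weight j (p i z)) * real_of_int (g i (p i z))"
      by (simp add: right_diff_distrib sum_subtractf sum_distrib_right)
    then show ?thesis using sum_weight[OF i.p_in(2)[OF that]] by (simp add: branch_def)
  qed
  have "twice_diff (?t j) y" if j: "j \<in> I" for j
  proof (cases "p i y \<in> W j")
    case True
    obtain S where S: "open S" "y \<in> S" "\<And>z. z \<in> S \<Longrightarrow> g j (p i z) - g i (p i z) = g j (p i y) - g i (p i y)"
      using jump_locally_constant[OF g i(1) j i(2) True] by blast
    have "twice_diff (\<lambda>z. weight j (p i z) * real_of_int (g j (p i y) - g i (p i y))) y"
      using chart_smooth_weight[OF j] i by (intro twice_diff_mult twice_diff_const) (simp add: chart_smooth_def)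
    then show ?thesis using S(1,2) by (rule twice_diff_cong(1)) (simp only: S(3))
  next
    case False
    have sub: "cball (0::'b) 1 \<subseteq> ball 0 2" by auto
    have "\<exists>S. open S \<and> y \<in> S \<and> (\<forall>z\<in>S. localize j bump (p i z) = 0)"
      by (rule localize_zero_near[OF j compact_cball sub bump_support i False])
    then obtain S where S: "open S" "y \<in> S" "\<forall>z\<in>S. localize j bump (p i z) = 0"
      by blast
    show ?thesis
      by (rule twice_diff_cong(1)[OF twice_diff_const[of 0] S(1,2)]) (use S(3) in \<open>simp add: weight_def\<close>)
  qed
  then have "twice_diff (\<lambda>z. \<Sum>j\<in>I. ?t j z) y" by (rule twice_diff_sum)
  then show "twice_diff (branch ?U i) y"
    by (rule twice_diff_cong(1)[OF _ open_ball i(2)]) (rule eq)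
qed

lemma smooth_branches_minus:
  assumes "smooth_branches U" "chart_smooth h"
  shows "smooth_branches (\<lambda>x. U x - h x)"
    and "i \<in> I \<Longrightarrow> y \<in> ball 0 2 \<Longrightarrow> grad (branch (\<lambda>x. U x - h x) i) y = grad (branch U i) y - grad (\<lambda>z. h (p i z)) y"
proof -
  have eq: "branch (\<lambda>x. U x - h x) i = (\<lambda>z. branch U i z - h (p i z))" for i
    by (auto simp: branch_def)
  show "smooth_branches (\<lambda>x. U x - h x)"
    using assms unfolding smooth_branches_def chart_smooth_def eq by (auto intro: twice_diff_diff)
  show "grad (branch (\<lambda>x. U x - h x) i) y = grad (branch U i) y - grad (\<lambda>z. h (p i z)) y" if "i \<in> I" "y \<in> ball 0 2"
    unfolding eq using assms that by (intro twice_diff_minus_grad) (auto simp: smooth_branches_def chart_smooth_def)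
qed

text \<open>One witnessing chart is enough: the box around the point is later built in that same
  chart, so a nonzero gradient is never transported.\<close>

definition regular_at :: "('a \<Rightarrow> real) \<Rightarrow> 'a \<Rightarrow> bool" where
  "regular_at U x \<longleftrightarrow> (U x \<in> \<int> \<longrightarrow> (\<exists>i\<in>I. x \<in> W i \<and> grad (branch U i) (f i x) \<noteq> 0))"

text \<open>Where the bump is positive, an integer level \<open>k\<close> of \<open>v - bump * (a \<bullet> y + c)\<close> has a critical point
  \<open>y\<close> only if \<open>(a, c) = (grad w y, w y - grad w y \<bullet> y)\<close> with \<open>w = (v - k) / bump\<close>, and these pairs
  form a null set as the image of a space of smaller dimension. Elsewhere bump and its gradient vanish.\<close>

lemma perturb_in_chart:
  assumes U: "smooth_branches U" and j: "j \<in> I"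
  shows "\<exists>h. chart_smooth h \<and> (\<forall>x\<in>topspace M. (x \<in> W j \<and> norm (f j x) < 1) \<or> regular_at U x \<longrightarrow> regular_at (\<lambda>x. U x - h x) x)"
proof -
  interpret j: open_chart M "W j" "f j" "p j" "ball 0 2" by (rule charts[OF j])
  define v where "v = branch U j"
  define w where "w k y = (v y - real_of_int k) / bump y" for k :: int and y
  define \<Phi> where "\<Phi> k y = (grad (w k) y, w k y - grad (w k) y \<bullet> y)" for k y
  have v: "twice_diff v y" if "y \<in> ball 0 2" for y using U j that by (simp add: v_def smooth_branches_def)
  have w: "twice_diff (w k) y" if "norm y < 1" for k y
    unfolding w_def using v[of y] that bump_pos_iff[of y]
    by (intro twice_diff_divide twice_diff_diff twice_diff_bump twice_diff_const) auto
  have "\<Phi> k differentiable_on ball 0 1" for k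
    unfolding differentiable_on_def
  proof
    fix y :: 'b assume "y \<in> ball 0 1"
    then have "twice_diff (w k) y" using w by simp
    then have "(\<lambda>y. (grad (w k) y, w k y - grad (w k) y \<bullet> y)) differentiable (at y)"
      by (intro differentiable_Pair differentiable_diff differentiable_inner twice_diff_grad(2) twice_diff_differentiable) auto
    then show "\<Phi> k differentiable at y within ball 0 1"
      unfolding \<Phi>_def[abs_def] by (rule differentiable_at_withinI)
  qed
  \<comment> \<open>The values of \<open>\<Phi> k\<close> have one real coordinate more than its
    arguments.\<close>
  then have "negligible (\<Phi> k ` ball 0 1)" for k
    by (intro negligible_differentiable_image_lowdim) simp_all
  then have "negligible (\<Union>k. \<Phi> k ` ball 0 1)" by (intro negligible_countable_Union) auto
  then have "(\<Union>k. \<Phi> k ` ball 0 1) \<noteq> UNIV" using non_negligible_UNIV by metis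
  then obtain ac where "ac \<notin> (\<Union>k. \<Phi> k ` ball 0 1)" by blast
  then obtain a c where "(a, c) \<notin> (\<Union>k. \<Phi> k ` ball 0 1)" by (cases ac) blast
  then have ac: "\<Phi> k y \<noteq> (a, c)" if "norm y < 1" for k y
    using that by (metis UN_I UNIV_I image_eqI mem_ball_0)
  define q where "q y = bump y * (a \<bullet> y + c)" for y
  have q: "twice_diff q y" for y
    unfolding q_def by (intro twice_diff_mult twice_diff_bump twice_diff_affine)
  have qg: "grad q y = (bump y) *\<^sub>R a + (a \<bullet> y + c) *\<^sub>R grad bump y" for y
    unfolding q_def using twice_diff_mult(2)[OF twice_diff_bump twice_diff_affine] by (simp add: grad_affine)
  have q0: "q y = 0" "grad q y = 0" if "1 \<le> norm y" for y
    using that by (simp_all add: qg) (simp_all add: q_def bump_0 grad_bump)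
  have supp: "y \<notin> cball 0 1 \<Longrightarrow> q y = 0" for y using q0(1)[of y] by simp
  define h where "h = localize j q"
  have h: "chart_smooth h"
    unfolding h_def by (rule chart_smooth_localize[where K="cball 0 1", OF j]) (use supp q in auto)
  have "regular_at (\<lambda>x. U x - h x) x" if x: "x \<in> topspace M" and or: "(x \<in> W j \<and> norm (f j x) < 1) \<or> regular_at U x" for x
    unfolding regular_at_def
  proof
    assume int: "U x - h x \<in> \<int>"
    show "\<exists>i\<in>I. x \<in> W i \<and> grad (branch (\<lambda>x. U x - h x) i) (f i x) \<noteq> 0"
    proof (cases "x \<in> W j \<and> norm (f j x) < 1")
      case True
      define y where "y = f j x"
      have y: "y \<in> ball 0 2" "norm y < 1" "p j y = x" using True by (auto simp: y_def)
      have "U x - h x - real_of_int (g j x) \<in> \<int>" using int by simp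
      moreover have "U x - h x - real_of_int (g j x) = v y - q y"
        using True y by (simp add: v_def branch_def h_def localize_def y_def)
      ultimately obtain k where k: "v y - q y = real_of_int k" by (auto elim: Ints_cases)
      have bp: "bump y > 0" using y(2) by (simp add: bump_pos_iff)
      have wk: "w k y = a \<bullet> y + c" using k bp by (simp add: w_def q_def field_simps)
      \<comment> \<open>Near \<open>y\<close> the perturbed branch is \<open>k\<close> plus the bump
        times a factor that vanishes at \<open>y\<close>, so by the product rule its gradient there
        is the bump times the gradient of that factor.\<close>
      have near: "branch (\<lambda>x. U x - h x) j z = k + bump z * (w k z - (a \<bullet> z + c))" if "z \<in> ball 0 1" for z
      proof -
        have "bump z > 0" "z \<in> ball 0 2" using that by (auto simp: bump_pos_iff)
        then show ?thesis
          using j.p_in(1)[of z] by (simp add: v_def branch_def h_def localize_def w_def q_def field_simps)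
      qed
      have s: "twice_diff (\<lambda>z. w k z - (a \<bullet> z + c)) y" by (intro twice_diff_diff w y(2) twice_diff_affine)
      have m: "twice_diff (\<lambda>z. bump z * (w k z - (a \<bullet> z + c))) y" by (intro twice_diff_mult twice_diff_bump s)
      have sg: "grad (\<lambda>z. w k z - (a \<bullet> z + c)) y = grad (w k) y - a"
        using twice_diff_minus_grad[OF w[OF y(2)] twice_diff_affine] by (simp add: grad_affine)
      have "grad (branch (\<lambda>x. U x - h x) j) y = grad (\<lambda>z. k + bump z * (w k z - (a \<bullet> z + c))) y"
        by (rule twice_diff_cong(2)[OF twice_diff_add(1)[OF twice_diff_const m] open_ball[of 0 1]]) (use y(2) near in auto)
      also have "\<dots> = bump y *\<^sub>R (grad (w k) y - a)"
        using twice_diff_add(2)[OF twice_diff_const m] twice_diff_mult(2)[OF twice_diff_bump s] wk sg by simp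
      finally have "grad (branch (\<lambda>x. U x - h x) j) y = 0 \<longleftrightarrow> grad (w k) y = a" using bp by simp
      moreover have "grad (w k) y \<noteq> a" using ac[OF y(2), of k] wk by (auto simp: \<Phi>_def)
      ultimately show ?thesis using j True by (auto simp: y_def)
    next
      case False
      \<comment> \<open>Here the old regularity is inherited: \<open>h\<close> vanishes at
        \<open>x\<close> together with its gradient, in whichever chart witnesses the
        regularity.\<close>
      have "h x = 0" using False q0(1) by (auto simp: h_def localize_def)
      then obtain i where i: "i \<in> I" "x \<in> W i" "grad (branch U i) (f i x) \<noteq> 0"
        using int or False by (auto simp: regular_at_def)
      interpret i: open_chart M "W i" "f i" "p i" "ball 0 2" by (rule charts[OF i(1)])
      have y: "f i x \<in> ball 0 2" using i.f_in[OF i(2)] .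
      have "grad (\<lambda>z. h (p i z)) (f i x) = 0"
        unfolding h_def
        by (rule localize_smooth(2)[where K="cball 0 1", OF j _ _ supp q i(1) y]) (use False q0(2) i in auto)
      then show ?thesis
        using i smooth_branches_minus(2)[OF U h i(1) y] by auto
    qed
  qed
  then show ?thesis using h by blast
qed

text \<open>What earlier charts have achieved survives by genericity rather than by smallness of the
  perturbation: the choice of \<open>a\<close> and \<open>c\<close> rules out every critical point
  of integer value in the current unit ball, and outside it \<open>h\<close> vanishes to first
  order.\<close>

lemma ex_regular_multivalued:
  assumes g: "locally_constant_jumps"
  obtains U where "smooth_branches U" "\<And>x. x \<in> topspace M \<Longrightarrow> regular_at U x"
proof -
  have "\<exists>U. smooth_branches U \<and> (\<forall>x\<in>topspace M. (\<exists>j\<in>J. x \<in> W j \<and> norm (f j x) < 1) \<longrightarrow> regular_at U x)"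
    if "J \<subseteq> I" for J
    using finite_subset[OF that finI] that
  proof (induction J rule: finite_induct)
    case empty
    then show ?case using smooth_branches_partition[OF g] by auto
  next
    case (insert j J)
    then obtain U where U: "smooth_branches U"
      "\<And>x. x \<in> topspace M \<Longrightarrow> (\<exists>j\<in>J. x \<in> W j \<and> norm (f j x) < 1) \<Longrightarrow> regular_at U x" by auto
    obtain h where h: "chart_smooth h"
      "\<And>x. x \<in> topspace M \<Longrightarrow> (x \<in> W j \<and> norm (f j x) < 1) \<or> regular_at U x \<Longrightarrow> regular_at (\<lambda>x. U x - h x) x"
      using perturb_in_chart[OF U(1), of j] insert.prems by auto
    show ?case
      using smooth_branches_minus(1)[OF U(1) h(1)] h(2) U(2)
      by (intro exI[of _ "\<lambda>x. U x - h x"]) auto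
  qed
  from this[OF order_refl] show thesis using that cover by blast
qed

end

end

section \<open>A collar of the integer level\<close>

context chart_system
begin

definition integer_level :: "('a \<Rightarrow> real) \<Rightarrow> 'a set" where
  "integer_level U = {x \<in> topspace M. U x \<in> \<int>}"

text \<open>A tuple, so that chart, direction, radius, slope bound and integer are chosen for all
  points at once. The bound 1/4 leaves the other quarter to the term \<open>t * \<Lambda>\<close>,
  so that \<open>k\<close> is the only integer that can occur in the box.\<close>

definition box_data :: "('i \<Rightarrow> 'a \<Rightarrow> int) \<Rightarrow> ('a \<Rightarrow> real) \<Rightarrow> 'a \<Rightarrow> 'i \<times> 'b \<times> real \<times> real \<times> int \<Rightarrow> bool" where
  "box_data g U x = (\<lambda>(i, e, \<rho>, c, k). i \<in> I \<and> x \<in> W i \<and> norm e = 1 \<and> 0 < \<rho> \<and> 0 < c \<and>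
     cball (f i x) \<rho> \<subseteq> ball 0 2 \<and> (\<forall>y\<in>cball (f i x) \<rho>. c \<le> grad (branch g U i) y \<bullet> e \<and>
       \<bar>branch g U i y - real_of_int k\<bar> < 1/4))"

context
  fixes g :: "'i \<Rightarrow> 'a \<Rightarrow> int" and U :: "'a \<Rightarrow> real"
  assumes smooth: "smooth_branches g U" and regular: "\<And>x. x \<in> topspace M \<Longrightarrow> regular_at g U x"
begin

lemma branch_continuous:
  assumes "i \<in> I"
  shows "continuous_map (subtopology M (W i)) euclideanreal (\<lambda>x. U x - real_of_int (g i x))"
  using assms smooth unfolding smooth_branches_def branch_def by (intro continuous_in_charts) auto

lemma branch_vimage_open:
  assumes i: "i \<in> I" and h: "continuous_map (subtopology M (W i)) euclideanreal h" and "open S"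
  shows "openin M {x \<in> W i. h x \<in> S}"
proof -
  interpret i: open_chart M "W i" "f i" "p i" "ball 0 2" by (rule charts[OF i])
  have "topspace (subtopology M (W i)) = W i" using openin_subset[OF i.W] by auto
  moreover have "openin (subtopology M (W i)) {x \<in> topspace (subtopology M (W i)). h x \<in> S}"
    using assms by (intro openin_continuous_map_preimage) auto
  ultimately show ?thesis using openin_trans_full[OF _ i.W] by metis
qed

text \<open>\<open>U\<close> itself may be discontinuous. Its branches are continuous and differ
  from it by integers, so the complement of the level can be seen to be open through them.\<close>

lemma integer_level_compact: "compactin M (integer_level U)"
proof (rule closedin_compact_space[OF comp])
  have "topspace M - integer_level U = (\<Union>i\<in>I. {x \<in> W i. U x - real_of_int (g i x) \<in> - \<int>})"
  proof (intro equalityI subsetI)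
    fix x assume x: "x \<in> topspace M - integer_level U"
    then obtain i where i: "i \<in> I" "x \<in> W i" using cover by blast
    have "U x \<notin> \<int>" using x by (simp add: integer_level_def)
    then have "U x - real_of_int (g i x) \<notin> \<int>" by (metis Ints_add Ints_of_int diff_add_cancel)
    then show "x \<in> (\<Union>i\<in>I. {x \<in> W i. U x - real_of_int (g i x) \<in> - \<int>})" using i by blast
  next
    fix x assume "x \<in> (\<Union>i\<in>I. {x \<in> W i. U x - real_of_int (g i x) \<in> - \<int>})"
    then obtain i where i: "i \<in> I" "x \<in> W i" "U x - real_of_int (g i x) \<notin> \<int>" by auto
    then have "x \<in> topspace M" using open_chart.W[OF charts[OF i(1)]] openin_subset by blast
    moreover have "U x \<notin> \<int>" using i(3) by (meson Ints_diff Ints_of_int)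
    ultimately show "x \<in> topspace M - integer_level U" by (simp add: integer_level_def)
  qed
  moreover have "openin M {x \<in> W i. U x - real_of_int (g i x) \<in> - \<int>}" if "i \<in> I" for i
    using branch_vimage_open[OF that branch_continuous[OF that], of "- \<int>"] closed_Ints by (simp add: open_Compl)
  ultimately have "openin M (topspace M - integer_level U)" by auto
  then show "closedin M (integer_level U)" by (simp add: closedin_def integer_level_def)
qed

lemma ex_box:
  assumes x: "x \<in> integer_level U" shows "\<exists>b. box_data g U x b"
proof -
  obtain i where i: "i \<in> I" "x \<in> W i" "grad (branch g U i) (f i x) \<noteq> 0"
    using x regular[of x] by (auto simp: integer_level_def regular_at_def)
  interpret i: open_chart M "W i" "f i" "p i" "ball 0 2" by (rule charts[OF i(1)])
  define v where "v = branch g U i"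
  define y0 where "y0 = f i x"
  define G where "G = grad v y0"
  have y0: "y0 \<in> ball 0 2" using i.f_in[OF i(2)] by (simp add: y0_def)
  have td: "twice_diff v y0" using smooth i(1) y0 by (simp add: smooth_branches_def v_def)
  have nG: "norm G > 0" using i(3) by (simp add: G_def v_def y0_def)
  have "v y0 \<in> \<int>" using x i(2) by (simp add: v_def branch_def y0_def integer_level_def)
  then obtain k where k: "v y0 = real_of_int k" by (auto elim: Ints_cases)
  \<comment> \<open>In the direction of the gradient the slope at \<open>y0\<close> is
    \<open>norm G\<close>; half of it remains a lower bound nearby.\<close>
  let ?e = "sgn G"
  have "isCont (\<lambda>y. grad v y \<bullet> ?e) y0" by (intro continuous_intros twice_diff_isCont_grad td)
  then have "((\<lambda>y. grad v y \<bullet> ?e) \<longlongrightarrow> grad v y0 \<bullet> ?e) (nhds y0)"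
    unfolding isCont_def using tendsto_at_iff_tendsto_nhds[of "\<lambda>y. grad v y \<bullet> ?e" y0] by simp
  moreover have "G \<bullet> ?e = norm G"
    using nG by (simp add: sgn_div_norm dot_square_norm power2_eq_square field_simps)
  then have "norm G / 2 < grad v y0 \<bullet> ?e" using nG by (simp add: G_def)
  ultimately have "\<forall>\<^sub>F y in nhds y0. norm G / 2 < grad v y \<bullet> ?e"
    by (rule order_tendstoD(1))
  moreover have "\<forall>\<^sub>F y in nhds y0. dist (v y) (v y0) < 1/4"
    using twice_diff_isCont[OF td] tendstoD[of v "v y0" "nhds y0" "1/4"]
    by (simp add: isCont_def tendsto_at_iff_tendsto_nhds)
  moreover have "\<forall>\<^sub>F y in nhds y0. y \<in> ball 0 2" using y0 by (intro eventually_nhds_in_open) auto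
  ultimately have "\<forall>\<^sub>F y in nhds y0. norm G / 2 < grad v y \<bullet> ?e \<and> dist (v y) (v y0) < 1/4 \<and> y \<in> ball 0 2"
    by eventually_elim simp
  then obtain d where d: "d > 0" "\<And>y. dist y y0 < d \<Longrightarrow> norm G / 2 < grad v y \<bullet> ?e \<and> dist (v y) (v y0) < 1/4 \<and> y \<in> ball 0 2"
    unfolding eventually_nhds_metric by blast
  have "\<forall>y\<in>cball y0 (d/2). norm G / 2 \<le> grad v y \<bullet> ?e \<and> \<bar>v y - real_of_int k\<bar> < 1/4 \<and> y \<in> ball 0 2"
  proof
    fix y assume "y \<in> cball y0 (d/2)"
    then have "dist y y0 < d" using d(1) by (simp add: dist_commute)
    then show "norm G / 2 \<le> grad v y \<bullet> ?e \<and> \<bar>v y - real_of_int k\<bar> < 1/4 \<and> y \<in> ball 0 2"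
      using d(2)[of y] k by (simp add: dist_real_def)
  qed
  moreover have "norm ?e = 1" using nG by (simp add: norm_sgn)
  ultimately have "box_data g U x (i, ?e, d/2, norm G / 2, k)"
    using i d(1) nG by (auto simp: box_data_def v_def y0_def)
  then show ?thesis by blast
qed

text \<open>As \<open>t * N x\<close> is below 1/4, the integer in the definition of the tube can
  only be \<open>round (U x)\<close>, so \<open>t\<close> is the function \<tau> of \<open>x\<close>
  and the tube is a graph. A point of the tube with \<open>N x = 0\<close> would lie on the integer
  level, where \<open>N\<close> is positive; hence the division is legitimate.\<close>

lemma tube_projection:
  assumes N: "continuous_map M euclideanreal N" "\<forall>x\<in>integer_level U. 0 < N x"
    and bound: "\<And>x. x \<in> topspace M \<Longrightarrow> 0 \<le> N x \<and> eps * N x \<le> 1/4" and eps: "0 < eps"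
  defines "R \<equiv> fst ` level_tube M U eps N" and "\<tau> \<equiv> \<lambda>x. (U x - round (U x)) / N x"
  shows "openin M R" and "homeomorphic_maps (tube_topology M U eps N) (subtopology M R) fst (\<lambda>x. (x, \<tau> x))"
    and "\<And>x t. (x, t) \<in> level_tube M U eps N \<Longrightarrow> 0 < N x"
proof -
  have small: "\<bar>t * N x\<bar> < 1/4" if "x \<in> topspace M" "\<bar>t\<bar> < eps" "N x > 0" for x t
  proof -
    have "\<bar>t * N x\<bar> < eps * N x" using that by (simp add: abs_mult)
    then show ?thesis using bound[OF that(1)] by linarith
  qed
  show pos: "0 < N x" if "(x, t) \<in> level_tube M U eps N" for x t
  proof (rule ccontr)
    assume "\<not> 0 < N x"
    moreover have x: "x \<in> topspace M" "U x - t * N x \<in> \<int>" using that by (auto simp: level_tube_def)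
    ultimately have "N x = 0" using bound[of x] by simp
    then have "x \<in> integer_level U" using x by (simp add: integer_level_def)
    with N(2) have "0 < N x" by blast
    with \<open>N x = 0\<close> show False by simp
  qed
  have round_eq: "round (U x) = n" if "\<bar>U x - real_of_int n\<bar> < 1/4" for x n
    using that by (intro round_unique') simp
  have \<tau>_eq: "\<tau> x = t" if "(x, t) \<in> level_tube M U eps N" for x t
  proof -
    have x: "x \<in> topspace M" "\<bar>t\<bar> < eps" "U x - t * N x \<in> \<int>" using that by (auto simp: level_tube_def)
    then obtain n where n: "U x - t * N x = real_of_int n" by (auto elim: Ints_cases)
    have "\<bar>U x - real_of_int n\<bar> < 1/4" using small[OF x(1,2) pos[OF that]] n by (simp add: algebra_simps)
    then have "round (U x) = n" by (rule round_eq)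
    then show ?thesis using n pos[OF that] by (simp add: \<tau>_def field_simps)
  qed
  \<comment> \<open>On \<open>V (i, n)\<close> the rounded value is \<open>g i x + n\<close>, so
    \<tau> is a quotient of continuous functions there; these open sets make up
    \<open>R\<close>.\<close>
  define V where "V = (\<lambda>(i, n). {x \<in> W i. eps * N x - \<bar>U x - real_of_int (g i x) - real_of_int n\<bar> \<in> {0<..}})"
  have contW: "continuous_map (subtopology M (W i)) euclideanreal (\<lambda>x. U x - real_of_int (g i x) - real_of_int n)" if "i \<in> I" for i n
    by (rule continuous_map_diff[OF branch_continuous[OF that]]) simp
  have V_open: "openin M (V (i, n))" if "i \<in> I" for i n
    unfolding V_def prod.case
  proof (intro branch_vimage_open that)
    show "continuous_map (subtopology M (W i)) euclideanreal
        (\<lambda>x. eps * N x - \<bar>U x - real_of_int (g i x) - real_of_int n\<bar>)"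
      by (intro continuous_map_diff[OF _ continuous_map_real_abs[OF contW[OF that]]] continuous_map_real_mult_left
          continuous_map_from_subtopology N(1))
  qed simp
  have V_in: "x \<in> W i" "x \<in> topspace M" "0 < N x" "\<bar>U x - real_of_int (g i x) - real_of_int n\<bar> < eps * N x" "round (U x) = g i x + n"
    if "x \<in> V (i, n)" "i \<in> I" for x i n
  proof -
    show xW: "x \<in> W i" and lt: "\<bar>U x - real_of_int (g i x) - real_of_int n\<bar> < eps * N x" using that by (auto simp: V_def)
    show xM: "x \<in> topspace M" using xW open_chart.W[OF charts[OF that(2)]] openin_subset by blast
    show "0 < N x" using lt eps bound[OF xM] by (cases "N x = 0") auto
    have "\<bar>U x - real_of_int (g i x + n)\<bar> < 1/4"
      using lt bound[OF xM] unfolding of_int_add by linarith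
    then show "round (U x) = g i x + n" by (rule round_eq)
  qed
  have V_tube: "(x, \<tau> x) \<in> level_tube M U eps N" if x: "x \<in> V (i, n)" "i \<in> I" for x i n
  proof -
    note v = V_in[OF x]
    have "U x - \<tau> x * N x = real_of_int (g i x + n)" using v(3,5) by (simp add: \<tau>_def)
    moreover have "\<bar>\<tau> x\<bar> < eps" using v(3,4,5) by (simp add: \<tau>_def abs_divide field_simps)
    ultimately show ?thesis using v(2) by (simp add: level_tube_def)
  qed
  have R_V: "R = (\<Union>z\<in>I \<times> UNIV. V z)"
  proof (intro equalityI subsetI)
    fix x assume "x \<in> R"
    then obtain t where t: "(x, t) \<in> level_tube M U eps N" by (auto simp: R_def)
    then have x: "x \<in> topspace M" "\<bar>t\<bar> < eps" "U x - t * N x \<in> \<int>" by (auto simp: level_tube_def)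
    then obtain n where n: "U x - t * N x = real_of_int n" by (auto elim: Ints_cases)
    obtain i where i: "i \<in> I" "x \<in> W i" using cover[OF x(1)] by blast
    have "U x - real_of_int (g i x) - real_of_int (n - g i x) = t * N x" using n by simp
    moreover have "\<bar>t * N x\<bar> < eps * N x" using x(2) pos[OF t] by (simp add: abs_mult)
    ultimately have "x \<in> V (i, n - g i x)" using i by (simp add: V_def)
    then show "x \<in> (\<Union>z\<in>I \<times> UNIV. V z)" using i by blast
  next
    fix x assume "x \<in> (\<Union>z\<in>I \<times> UNIV. V z)"
    then obtain i n where "i \<in> I" "x \<in> V (i, n)" by auto
    then show "x \<in> R" using V_tube unfolding R_def by (metis fst_conv image_eqI)
  qed
  show "openin M R" unfolding R_V using V_open by auto
  have \<tau>_cont: "continuous_map (subtopology M R) euclideanreal \<tau>"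
  proof (rule pasting_lemma[where I="I \<times> UNIV" and T=V and f="\<lambda>_. \<tau>"])
    fix z :: "'i \<times> int" assume z: "z \<in> I \<times> UNIV"
    obtain i n where z': "z = (i, n)" "i \<in> I" using z by auto
    have sub: "V z \<subseteq> R" using R_V z by blast
    then show "openin (subtopology M R) (V z)"
      using V_open[OF z'(2), of n] unfolding z'(1) by (simp add: openin_subset_topspace_eq openin_subtopology_alt) (metis inf.absorb2 inf_commute image_eqI mem_Collect_eq)
    have VW: "V z \<subseteq> W i" using z' V_in(1) by blast
    have "continuous_map (subtopology M (V z)) euclideanreal (\<lambda>x. (U x - real_of_int (g i x) - real_of_int n) / N x)"
    proof (rule continuous_map_real_divide)
      show "continuous_map (subtopology M (V z)) euclideanreal (\<lambda>x. U x - real_of_int (g i x) - real_of_int n)"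
        using continuous_map_from_subtopology_mono[OF contW[OF z'(2)] VW] .
      show "continuous_map (subtopology M (V z)) euclideanreal N" using N(1) by (rule continuous_map_from_subtopology)
      show "N x \<noteq> 0" if "x \<in> topspace (subtopology M (V z))" for x
        using that V_in(3)[OF _ z'(2), of x n] z'(1) by auto
    qed
    then have "continuous_map (subtopology M (V z)) euclideanreal \<tau>"
      by (rule continuous_map_eq) (use V_in(5)[OF _ z'(2), of _ n] z'(1) in \<open>simp add: \<tau>_def algebra_simps\<close>)
    then show "continuous_map (subtopology (subtopology M R) (V z)) euclideanreal \<tau>"
      using sub by (simp add: subtopology_subtopology inf.absorb2)
  next
    fix x assume "x \<in> topspace (subtopology M R)"
    then have "x \<in> R" by simp
    then show "\<exists>j. j \<in> I \<times> UNIV \<and> x \<in> V j \<and> \<tau> x = \<tau> x" unfolding R_V by blast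
  qed auto
  show "homeomorphic_maps (tube_topology M U eps N) (subtopology M R) fst (\<lambda>x. (x, \<tau> x))"
    unfolding homeomorphic_maps_def topspace_tube
  proof (intro conjI ballI)
    show "continuous_map (tube_topology M U eps N) (subtopology M R) fst"
      using continuous_map_from_subtopology[OF continuous_map_fst]
      by (simp add: continuous_map_in_subtopology R_def)
    have "continuous_map (subtopology M R) (prod_topology M euclideanreal) (\<lambda>x. (x, \<tau> x))"
      using \<tau>_cont by (simp add: continuous_map_pairwise o_def continuous_map_from_subtopology)
    moreover have "(\<lambda>x. (x, \<tau> x)) \<in> topspace (subtopology M R) \<rightarrow> level_tube M U eps N"
      using V_tube unfolding R_V by auto
    ultimately show "continuous_map (subtopology M R) (tube_topology M U eps N) (\<lambda>x. (x, \<tau> x))"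
      by (simp add: continuous_map_in_subtopology)
    show "(fst z, \<tau> (fst z)) = z" if "z \<in> level_tube M U eps N" for z
      using \<tau>_eq[of "fst z" "snd z"] that by (simp add: prod_eq_iff)
  qed auto
qed

text \<open>The tube of weight 0 is carried, by one slide box per added bump, to the tube of a
  weight positive on the level, and that tube projects homeomorphically to an open set. All these
  maps respect \<open>t\<close>, from which the height conditions are read off.\<close>

lemma ex_open_collar:
  "\<exists>T h k. open_collar M T h k \<and>
    (\<forall>s\<in>T. \<forall>r. -2 < r \<longrightarrow> r < 2 \<longrightarrow> (\<exists>n::int. \<bar>U (h (s, r)) - n\<bar> < 1/2 \<and>
       (0 \<le> r \<longleftrightarrow> n \<le> U (h (s, r))) \<and> (r = 0 \<longleftrightarrow> U (h (s, r)) = n))) \<and>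
    (\<forall>x\<in>topspace M. U x \<in> \<int> \<longrightarrow> x \<in> h ` (T \<times> {0}))"
proof -
  let ?S = "integer_level U"
  have "\<forall>x\<in>?S. \<exists>b. box_data g U x b" using ex_box by blast
  then obtain b where b: "\<forall>x\<in>?S. box_data g U x (b x)" by (rule bchoice[THEN exE])
  define ix where "ix x = fst (b x)" for x
  define e where "e x = fst (snd (b x))" for x
  define \<rho> where "\<rho> x = fst (snd (snd (b x)))" for x
  define c where "c x = fst (snd (snd (snd (b x))))" for x
  define k where "k x = snd (snd (snd (snd (b x))))" for x
  have bx: "b x = (ix x, e x, \<rho> x, c x, k x)" for x by (simp add: ix_def e_def \<rho>_def c_def k_def)
  have box: "ix x \<in> I" "x \<in> W (ix x)" "norm (e x) = 1" "0 < \<rho> x" "0 < c x" "cball (f (ix x) x) (\<rho> x) \<subseteq> ball 0 2"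
    "\<And>y. y \<in> cball (f (ix x) x) (\<rho> x) \<Longrightarrow> c x \<le> grad (branch g U (ix x)) y \<bullet> e x"
    "\<And>y. y \<in> cball (f (ix x) x) (\<rho> x) \<Longrightarrow> \<bar>branch g U (ix x) y - real_of_int (k x)\<bar> < 1/4"
    if "x \<in> ?S" for x
  proof -
    have "box_data g U x (ix x, e x, \<rho> x, c x, k x)" using b that bx by metis
    then show "ix x \<in> I" "x \<in> W (ix x)" "norm (e x) = 1" "0 < \<rho> x" "0 < c x" "cball (f (ix x) x) (\<rho> x) \<subseteq> ball 0 2"
      "\<And>y. y \<in> cball (f (ix x) x) (\<rho> x) \<Longrightarrow> c x \<le> grad (branch g U (ix x)) y \<bullet> e x"
      "\<And>y. y \<in> cball (f (ix x) x) (\<rho> x) \<Longrightarrow> \<bar>branch g U (ix x) y - real_of_int (k x)\<bar> < 1/4"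
      unfolding box_data_def prod.case by blast+
  qed
  define y0 where "y0 x = f (ix x) x" for x
  let ?B = "\<lambda>x. cball (y0 x) (\<rho> x)" and ?Q = "\<lambda>x. cball (y0 x) (\<rho> x / 4)" and ?q = "\<lambda>x. ball (y0 x) (\<rho> x / 4)"
  define v where "v x = branch g U (ix x)" for x
  \<comment> \<open>The bump is rescaled to radius \<open>\<rho> x / 4\<close>, the region in which
    a slide box allows its two weights to differ.\<close>
  define q where "q x y = bump ((4 / \<rho> x) *\<^sub>R (y - y0 x))" for x y
  define \<mu> where "\<mu> x = localize (ix x) (q x)" for x
  have ball_Dom: "?q x \<subseteq> ball 0 2" "?Q x \<subseteq> ball 0 2" if "x \<in> ?S" for x
    using box(6)[OF that] box(4)[OF that] by (auto simp: y0_def subset_iff)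
  have q_td: "twice_diff (q x) y" for x y
  proof -
    have "twice_diff (\<lambda>y. (4 / \<rho> x) *\<^sub>R (y - y0 x) \<bullet> b) y" for b
    proof -
      have eq: "(\<lambda>y. (4 / \<rho> x) *\<^sub>R (y - y0 x) \<bullet> b) = (\<lambda>y. ((4 / \<rho> x) *\<^sub>R b) \<bullet> y + (- (4 / \<rho> x) * (y0 x \<bullet> b)))"
        by (auto simp: algebra_simps inner_commute)
      show ?thesis unfolding eq by (rule twice_diff_affine)
    qed
    then show ?thesis unfolding q_def[abs_def] by (rule twice_diff_compose(1)[OF twice_diff_bump])
  qed
  have q_pos: "0 < q x y \<longleftrightarrow> y \<in> ?q x" if "x \<in> ?S" for x y
    using box(4)[OF that] unfolding q_def bump_pos_iff norm_scaleR
    by (simp add: dist_norm norm_minus_commute field_simps)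
  have q_nonneg: "0 \<le> q x y" and q_le: "q x y \<le> 1" for x y by (simp_all add: q_def bump_nonneg bump_le_1)
  have \<mu>_smooth: "chart_smooth (\<mu> x)" if x: "x \<in> ?S" for x
  proof -
    have z: "q x y = 0" if "y \<notin> ?Q x" for y
      using that q_pos[OF x, of y] q_nonneg[of x y] by (auto simp: order_less_le)
    show ?thesis unfolding \<mu>_def
      by (rule chart_smooth_localize[OF box(1)[OF x] compact_cball ball_Dom(2)[OF x]]) (erule z, rule q_td)
  qed
  have \<mu>_bounds: "0 \<le> \<mu> x z" "\<mu> x z \<le> 1" for x z by (simp_all add: \<mu>_def localize_def q_nonneg q_le)
  have \<mu>_pos: "0 < \<mu> x z \<longleftrightarrow> z \<in> W (ix x) \<and> f (ix x) z \<in> ?q x" if "x \<in> ?S" for x z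
    using q_pos[OF that] by (simp add: \<mu>_def localize_def del: mem_ball)
  have \<mu>_zero: "\<mu> x z = 0" if x: "x \<in> ?S" and "z \<notin> p (ix x) ` ?q x" for x z
  proof -
    interpret i: open_chart M "W (ix x)" "f (ix x)" "p (ix x)" "ball 0 2" by (rule charts[OF box(1)[OF x]])
    have "\<not> 0 < \<mu> x z" using \<mu>_pos[OF x] that(2) i.pf by (metis image_eqI)
    then show ?thesis using \<mu>_bounds(1)[of x z] by linarith
  qed
  have \<mu>_self: "0 < \<mu> x x" if "x \<in> ?S" for x
    using \<mu>_pos[OF that] box(2)[OF that] box(4)[OF that] by (simp add: y0_def)
  obtain X0 where X0: "finite X0" "X0 \<subseteq> ?S" "\<And>x. x \<in> ?S \<Longrightarrow> \<exists>x0\<in>X0. 0 < \<mu> x0 x"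
  proof -
    let ?V = "\<lambda>x. {z \<in> topspace M. \<mu> x z \<in> {0<..}}"
    have op: "openin M (?V x)" if "x \<in> ?S" for x
      using chart_smooth_continuous[OF \<mu>_smooth[OF that]] by (rule openin_continuous_map_preimage) simp
    have "?S \<subseteq> \<Union>(?V ` ?S)" using \<mu>_self by (auto simp: integer_level_def)
    then obtain \<F> where F: "finite \<F>" "\<F> \<subseteq> ?V ` ?S" "?S \<subseteq> \<Union>\<F>"
      using integer_level_compact op unfolding compactin_def by (metis (no_types, lifting) imageE)
    then obtain X0 where "finite X0" "X0 \<subseteq> ?S" "\<F> = ?V ` X0" by (meson finite_subset_image)
    then show thesis using F(3) by (intro that[of X0]) auto
  qed
  define m where "m = real (card X0)"
  have m: "0 \<le> m" by (simp add: m_def)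
  define N where "N J z = (\<Sum>x\<in>J. \<mu> x z)" for J z
  have N_smooth: "chart_smooth (N J)" if "J \<subseteq> X0" for J
    unfolding chart_smooth_def N_def using \<mu>_smooth X0(2) that
    by (intro ballI twice_diff_sum) (auto simp: chart_smooth_def)
  have N_bounds: "0 \<le> N J z" "N J z \<le> m" if "J \<subseteq> X0" for J z
  proof -
    show "0 \<le> N J z" unfolding N_def by (intro sum_nonneg \<mu>_bounds)
    have "N J z \<le> real (card J) * 1" unfolding N_def by (intro sum_bounded_above \<mu>_bounds)
    also have "\<dots> \<le> m" using that X0(1) by (simp add: m_def card_mono)
    finally show "N J z \<le> m" .
  qed
  \<comment> \<open>One bound serves all intermediate weights: there are finitely many, each with a
    continuous gradient on the compact ball.\<close>
  have "\<exists>L\<ge>0. \<forall>J\<subseteq>X0. \<forall>y\<in>?B x. \<bar>grad (\<lambda>z. N J (p (ix x) z)) y \<bullet> e x\<bar> \<le> L" if x: "x \<in> X0" for x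
  proof -
    have xS: "x \<in> ?S" using x X0(2) by blast
    have "\<exists>L. \<forall>y\<in>?B x. \<bar>grad (\<lambda>z. N J (p (ix x) z)) y \<bullet> e x\<bar> \<le> L" if J: "J \<subseteq> X0" for J
    proof -
      have "continuous_on (?B x) (\<lambda>y. grad (\<lambda>z. N J (p (ix x) z)) y \<bullet> e x)"
      proof (intro continuous_on_inner continuous_on_const continuous_at_imp_continuous_on ballI twice_diff_isCont_grad)
        fix y assume "y \<in> ?B x"
        then have "y \<in> ball 0 2" using box(6)[OF xS] by (auto simp: y0_def)
        then show "twice_diff (\<lambda>z. N J (p (ix x) z)) y"
          using N_smooth[OF J] box(1)[OF xS] by (simp add: chart_smooth_def)
      qed
      then have "compact ((\<lambda>y. grad (\<lambda>z. N J (p (ix x) z)) y \<bullet> e x) ` ?B x)"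
        by (intro compact_continuous_image compact_cball)
      then have "bounded ((\<lambda>y. grad (\<lambda>z. N J (p (ix x) z)) y \<bullet> e x) ` ?B x)"
        by (rule compact_imp_bounded)
      then show ?thesis unfolding bounded_iff by auto
    qed
    then obtain L where L: "\<And>J y. J \<subseteq> X0 \<Longrightarrow> y \<in> ?B x \<Longrightarrow> \<bar>grad (\<lambda>z. N J (p (ix x) z)) y \<bullet> e x\<bar> \<le> L J"
      by metis
    have fin: "finite (L ` Pow X0)" using X0(1) by simp
    show ?thesis
    proof (intro exI[of _ "max 0 (Max (L ` Pow X0))"] conjI allI impI ballI)
      fix J y assume "J \<subseteq> X0" "y \<in> ?B x"
      then show "\<bar>grad (\<lambda>z. N J (p (ix x) z)) y \<bullet> e x\<bar> \<le> max 0 (Max (L ` Pow X0))"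
        using L[of J y] Max_ge[OF fin, of "L J"] by (simp add: le_max_iff_disj)
    qed simp
  qed
  then obtain L where L: "\<And>x. x \<in> X0 \<Longrightarrow> 0 \<le> L x"
    "\<And>x J y. x \<in> X0 \<Longrightarrow> J \<subseteq> X0 \<Longrightarrow> y \<in> ?B x \<Longrightarrow> \<bar>grad (\<lambda>z. N J (p (ix x) z)) y \<bullet> e x\<bar> \<le> L x"
    by metis
  \<comment> \<open>The first bound gives \<open>eps * N J z \<le> 1/4\<close>. The second is the
    condition of a slide box of slope \<open>c x / 2\<close>. The third lets the term with
    \<open>t\<close> use up at most half of the slope \<open>c x\<close>. The summands 1 keep the
    denominators positive.\<close>
  define eps where "eps = Min (insert (1 / (4 * (m + 1))) ((\<lambda>x. min (c x * \<rho> x / 16) (c x / (2 * (L x + 1)))) ` X0))"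
  have "eps \<le> min (c x * \<rho> x / 16) (c x / (2 * (L x + 1)))" if "x \<in> X0" for x
    unfolding eps_def using X0(1) that by (intro Min_le) auto
  moreover have "eps \<le> 1 / (4 * (m + 1))" unfolding eps_def using X0(1) by (intro Min_le) auto
  ultimately have eps_le: "eps \<le> 1 / (4 * (m + 1))" "\<And>x. x \<in> X0 \<Longrightarrow> eps \<le> c x * \<rho> x / 16" "\<And>x. x \<in> X0 \<Longrightarrow> eps \<le> c x / (2 * (L x + 1))"
    by simp_all
  let ?T = "tube_topology M U eps" and ?L = "level_tube M U eps" and ?Z = "(\<lambda>_. 0) :: 'a \<Rightarrow> real"
  have eps_pos: "0 < eps"
    unfolding eps_def using X0(1,2) m L(1) box(4,5) by (auto simp: subset_iff add_nonneg_pos)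
  have eps_N: "eps * N J z \<le> 1/4" if "J \<subseteq> X0" for J z
  proof -
    have "eps * N J z \<le> 1 / (4 * (m + 1)) * m" using eps_le(1) N_bounds[OF that] eps_pos m by (intro mult_mono) auto
    also have "\<dots> \<le> 1/4" using m by (simp add: field_simps)
    finally show ?thesis .
  qed
  \<comment> \<open>In the box, both \<open>v - k\<close> and \<open>t * N\<close> have size at most
    1/4, the former strictly. An integer difference between them must be 0.\<close>
  have level: "U (p (ix x) y) - t * N J (p (ix x) y) \<in> \<int> \<longleftrightarrow> v x y - real_of_int (k x) = t * N J (p (ix x) y)"
    if x: "x \<in> X0" and J: "J \<subseteq> X0" and y: "y \<in> ?B x" and t: "\<bar>t\<bar> < eps" for x J y t
  proof -
    have xS: "x \<in> ?S" using x X0(2) by blast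
    let ?z = "p (ix x) y"
    have vU: "v x y = U ?z - real_of_int (g (ix x) ?z)" by (simp add: v_def branch_def)
    have "\<bar>t * N J ?z\<bar> \<le> eps * N J ?z" using t N_bounds(1)[OF J] by (simp add: abs_mult mult_right_mono)
    then have small: "\<bar>t * N J ?z\<bar> \<le> 1/4" using eps_N[OF J, of ?z] by linarith
    have near: "\<bar>v x y - real_of_int (k x)\<bar> < 1/4" using box(8)[OF xS] y by (simp add: v_def y0_def)
    show ?thesis
    proof
      assume "U ?z - t * N J ?z \<in> \<int>"
      then have "U ?z - t * N J ?z - real_of_int (g (ix x) ?z + k x) \<in> \<int>" by (rule Ints_diff[OF _ Ints_of_int])
      then obtain n where "U ?z - t * N J ?z - real_of_int (g (ix x) ?z + k x) = real_of_int n" by (elim Ints_cases)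
      then have n: "v x y - real_of_int (k x) - t * N J ?z = real_of_int n" using vU by simp
      then have "\<bar>real_of_int n\<bar> < 1" using near small by linarith
      then have "n = 0" by linarith
      then show "v x y - real_of_int (k x) = t * N J ?z" using n by simp
    next
      assume "v x y - real_of_int (k x) = t * N J ?z"
      then have "U ?z - t * N J ?z = real_of_int (g (ix x) ?z + k x)" using vU by simp
      then show "U ?z - t * N J ?z \<in> \<int>" by (metis Ints_of_int)
    qed
  qed
  have slope: "(v x y - real_of_int (k x)) - t * N J (p (ix x) y) + c x / 2 * r \<le>
      (v x (y + r *\<^sub>R e x) - real_of_int (k x)) - t * N J (p (ix x) (y + r *\<^sub>R e x))"
    if x: "x \<in> X0" and J: "J \<subseteq> X0" and y: "y \<in> ?B x" "y + r *\<^sub>R e x \<in> ?B x"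
      and r: "0 \<le> r" and t: "\<bar>t\<bar> < eps" for x J y r t
  proof -
    have xS: "x \<in> ?S" using x X0(2) by blast
    let ?n = "\<lambda>z. N J (p (ix x) z)"
    \<comment> \<open>The claim is that \<phi> does not decrease. Its derivative is at least
      \<open>c x - c x / 2 - c x / 2\<close>, where one half pays for the weight and the other for
      the claimed slope.\<close>
    define \<phi> where "\<phi> s = v x (y + s *\<^sub>R e x) - t * ?n (y + s *\<^sub>R e x) - c x / 2 * s" for s
    have "\<phi> 0 \<le> \<phi> r"
    proof (rule DERIV_nonneg_imp_nondecreasing[OF r])
      fix s assume s: "0 \<le> s" "s \<le> r"
      let ?y = "y + s *\<^sub>R e x"
      have in_ball: "?y \<in> ?B x"
      proof (cases "r = 0")
        case False
        have "?y = (1 - s / r) *\<^sub>R y + (s / r) *\<^sub>R (y + r *\<^sub>R e x)" using False by (simp add: algebra_simps)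
        then show ?thesis
          using convexD[OF convex_cball y, of "1 - s/r" "s/r"] s False r by simp
      qed (use s y in auto)
      then have Dom: "?y \<in> ball 0 2" using box(6)[OF xS] by (auto simp: y0_def)
      have l: "((\<lambda>s. y + s *\<^sub>R e x) has_derivative (\<lambda>h. h *\<^sub>R e x)) (at s)" by (auto intro!: derivative_eq_intros)
      have tv: "twice_diff (v x) ?y" using smooth box(1)[OF xS] Dom by (simp add: v_def smooth_branches_def)
      have tn: "twice_diff ?n ?y" using N_smooth[OF J] box(1)[OF xS] Dom by (simp add: chart_smooth_def)
      have dv: "((\<lambda>s. v x (y + s *\<^sub>R e x)) has_real_derivative grad (v x) ?y \<bullet> e x) (at s)"
        by (rule has_derivative_imp_has_field_derivative[OF has_derivative_compose[OF l twice_diff_grad(1)[OF tv]]]) simp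
      have dn: "((\<lambda>s. ?n (y + s *\<^sub>R e x)) has_real_derivative grad ?n ?y \<bullet> e x) (at s)"
        by (rule has_derivative_imp_has_field_derivative[OF has_derivative_compose[OF l twice_diff_grad(1)[OF tn]]]) simp
      have "(\<phi> has_real_derivative (grad (v x) ?y \<bullet> e x - t * (grad ?n ?y \<bullet> e x) - c x / 2)) (at s)"
        unfolding \<phi>_def[abs_def] by (rule derivative_eq_intros dv dn refl | simp)+
      moreover have "0 \<le> grad (v x) ?y \<bullet> e x - t * (grad ?n ?y \<bullet> e x) - c x / 2"
      proof -
        have "\<bar>t * (grad ?n ?y \<bullet> e x)\<bar> \<le> eps * L x"
          unfolding abs_mult using t L(2)[OF x J in_ball] eps_pos by (intro mult_mono) auto
        also have "\<dots> \<le> c x / (2 * (L x + 1)) * L x" using eps_le(3)[OF x] L(1)[OF x] by (rule mult_right_mono)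
        also have "\<dots> \<le> c x / 2" using L(1)[OF x] box(5)[OF xS] by (simp add: field_simps)
        finally have "\<bar>t * (grad ?n ?y \<bullet> e x)\<bar> \<le> c x / 2" .
        moreover have "c x \<le> grad (v x) ?y \<bullet> e x" using box(7)[OF xS] in_ball by (simp add: v_def y0_def)
        ultimately show ?thesis by linarith
      qed
      ultimately show "\<exists>d. (\<phi> has_real_derivative d) (at s) \<and> 0 \<le> d" by blast
    qed
    then show ?thesis by (simp add: \<phi>_def)
  qed
  have step: "\<exists>\<psi> \<psi>'. homeomorphic_maps (?T (N J)) (?T (N (insert x J))) \<psi> \<psi>' \<and>
     (\<forall>z\<in>?L (N J). snd (\<psi> z) = snd z)" if J: "J \<subseteq> X0" and x: "x \<in> X0" "x \<notin> J" for J x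
  proof -
    have xS: "x \<in> ?S" using x X0(2) by blast
    interpret i: open_chart M "W (ix x)" "f (ix x)" "p (ix x)" "ball 0 2" by (rule charts[OF box(1)[OF xS]])
    have ins: "N (insert x J) z = N J z + \<mu> x z" for z
      using x(2) finite_subset[OF J X0(1)] by (simp add: N_def)
    have J': "insert x J \<subseteq> X0" using J x by simp
    \<comment> \<open>The available slope is \<open>c x / 2\<close>, the other half of
      \<open>c x\<close> having been spent on the weight.\<close>
    have "slide_box M (W (ix x)) (f (ix x)) (p (ix x)) (ball 0 2) U (y0 x) (e x) (\<rho> x) (c x / 2) eps
        (\<lambda>y. v x y - real_of_int (k x)) (N J) (N (insert x J))"
    proof (intro slide_box.intro slide_box_axioms.intro)
      show "continuous_on (ball 0 2) (\<lambda>y. v x y - real_of_int (k x))"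
        using smooth box(1)[OF xS]
        by (intro continuous_intros continuous_at_imp_continuous_on ballI twice_diff_isCont)
          (simp add: v_def smooth_branches_def)
      show "N J z = N (insert x J) z" if "z \<notin> p (ix x) ` ?q x" for z
        using \<mu>_zero[OF xS that] ins by simp
      show "\<bar>N J z - N (insert x J) z\<bar> \<le> 1" for z using \<mu>_bounds[of x z] ins by simp
      show "?B x \<subseteq> ball 0 2" using box(6)[OF xS] by (simp add: y0_def)
      show "eps \<le> c x / 2 * \<rho> x / 8" using eps_le(2)[OF x(1)] by simp
    qed (use box(3-5)[OF xS] chart_smooth_continuous[OF N_smooth] J J' level[OF x(1)] slope[OF x(1)] i.open_chart_axioms in auto)
    then show ?thesis by (rule slide_box.slide_homeomorphism)
  qed
  have tube: "\<exists>\<psi> \<psi>'. homeomorphic_maps (?T ?Z) (?T (N J)) \<psi> \<psi>' \<and>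
     (\<forall>z\<in>?L ?Z. snd (\<psi> z) = snd z)" if "J \<subseteq> X0" for J
    using finite_subset[OF that X0(1)] that
  proof (induction J rule: finite_induct)
    case empty
    have "N {} = ?Z" by (auto simp: N_def)
    then show ?case
      by (intro exI[of _ "\<lambda>z. z"]) (simp add: homeomorphic_maps_def)
  next
    case (insert x J)
    then obtain \<psi> \<psi>' where a: "homeomorphic_maps (?T ?Z) (?T (N J)) \<psi> \<psi>'"
      "\<And>z. z \<in> ?L ?Z \<Longrightarrow> snd (\<psi> z) = snd z" by auto
    obtain \<theta> \<theta>' where b: "homeomorphic_maps (?T (N J)) (?T (N (insert x J))) \<theta> \<theta>'"
      "\<And>z. z \<in> ?L (N J) \<Longrightarrow> snd (\<theta> z) = snd z"
      using step[of J x] insert by auto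
    have "\<psi> z \<in> ?L (N J)" if "z \<in> ?L ?Z" for z
      using a(1) that unfolding homeomorphic_maps_def continuous_map_def topspace_tube by blast
    then have "\<forall>z\<in>?L ?Z. snd ((\<theta> \<circ> \<psi>) z) = snd z" using a(2) b(2) by simp
    then show ?case
      using homeomorphic_maps_compose[OF conjI[OF a(1) b(1)]] by blast
  qed
  obtain \<psi> \<psi>' where \<psi>: "homeomorphic_maps (?T ?Z) (?T (N X0)) \<psi> \<psi>'"
      "\<And>z. z \<in> ?L ?Z \<Longrightarrow> snd (\<psi> z) = snd z"
    using tube[OF order_refl] by blast
  have Npos: "\<forall>x\<in>?S. 0 < N X0 x"
  proof
    fix x assume "x \<in> ?S"
    then obtain x0 where "x0 \<in> X0" "0 < \<mu> x0 x" using X0(3) by blast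
    then show "0 < N X0 x" unfolding N_def using X0(1) \<mu>_bounds(1) by (intro sum_pos2) auto
  qed
  let ?N = "N X0" and ?\<tau> = "\<lambda>x. (U x - round (U x)) / N X0 x"
  have Ncont: "continuous_map M euclideanreal ?N" by (rule chart_smooth_continuous[OF N_smooth[OF order_refl]])
  define R where "R = fst ` ?L ?N"
  have bound: "0 \<le> ?N x \<and> eps * ?N x \<le> 1/4" for x using N_bounds(1)[OF order_refl] eps_N[OF order_refl] by blast
  note proj = tube_projection[OF Ncont Npos bound eps_pos, folded R_def]
  have lt0: "?L ?Z = ?S \<times> {-eps<..<eps}"
    by (auto simp: level_tube_def integer_level_def abs_less_iff)
  have lower: "- (eps * 2) < x * eps" if "-2 < x" for x
    using mult_strict_right_mono[OF that eps_pos] by simp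
  have scale: "homeomorphic_maps (top_of_set {-2<..<2}) (top_of_set {-eps<..<eps}) (\<lambda>r. r * (eps/2)) (\<lambda>t. t / (eps/2))"
    using eps_pos lower by (auto simp: homeomorphic_maps_def continuous_map_in_subtopology field_simps intro!: continuous_intros)
  have A: "homeomorphic_maps (cylinder M ?S) (?T ?Z)
      (\<lambda>(s, r). (s, r * (eps/2))) (\<lambda>(s, t). (s, t / (eps/2)))"
    using scale homeomorphic_maps_id[of "subtopology M ?S" "subtopology M ?S"] unfolding lt0 subtopology_Times
    by (simp add: homeomorphic_maps_prod id_def)
  define h where "h = fst \<circ> (\<psi> \<circ> (\<lambda>(s, r). (s, r * (eps/2))))"
  define h' where "h' = ((\<lambda>(s, t). (s, t / (eps/2))) \<circ> \<psi>') \<circ> (\<lambda>x. (x, ?\<tau> x))"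
  have hom: "homeomorphic_maps (cylinder M ?S) (subtopology M R) h h'"
    unfolding h_def h'_def
    by (rule homeomorphic_maps_compose[OF conjI[OF homeomorphic_maps_compose[OF conjI[OF A \<psi>(1)]] proj(2)]])
  have Stop: "?S \<subseteq> topspace M" by (auto simp: integer_level_def)
  have "h ` topspace (cylinder M ?S) = topspace (subtopology M R)"
    using hom homeomorphic_imp_surjective_map homeomorphic_maps_map by blast
  moreover have "R \<subseteq> topspace M" using proj(1) by (rule openin_subset)
  ultimately have R: "h ` (?S \<times> {-2<..<2}) = R" using Stop by (simp add: inf.absorb2)
  have image: "\<psi> (s, r * (eps/2)) = (h (s, r), r * (eps/2)) \<and> (h (s, r), r * (eps/2)) \<in> ?L ?N"
    if "s \<in> ?S" "-2 < r" "r < 2" for s r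
  proof -
    have z: "(s, r * (eps/2)) \<in> ?L ?Z"
      using that eps_pos lower[of r] by (simp add: lt0 field_simps)
    then have "\<psi> (s, r * (eps/2)) \<in> ?L ?N"
      using \<psi>(1) unfolding homeomorphic_maps_def continuous_map_def topspace_tube by blast
    moreover have "\<psi> (s, r * (eps/2)) = (h (s, r), r * (eps/2))"
      using \<psi>(2)[OF z] by (simp add: h_def prod_eq_iff)
    ultimately show ?thesis by simp
  qed
  show ?thesis
  proof (rule exI[of _ ?S], rule exI[of _ h], rule exI[of _ h'], intro conjI ballI allI impI)
    show "open_collar M ?S h h'"
      unfolding open_collar_def R using integer_level_compact proj(1) hom by blast
  next
    fix s and r :: real assume sr: "s \<in> ?S" "-2 < r" "r < 2"
    let ?x = "h (s, r)"
    have lt: "(?x, r * (eps/2)) \<in> ?L ?N" using image[OF sr] by blast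
    then have pos: "0 < ?N ?x" by (rule proj(3))
    obtain n where n: "U ?x - r * (eps/2) * ?N ?x = real_of_int n" and x: "\<bar>r * (eps/2)\<bar> < eps"
      using lt by (auto simp: level_tube_def elim: Ints_cases)
    \<comment> \<open>\<open>U\<close> exceeds the integer \<open>n\<close> by \<open>r * d\<close>.
      With \<open>d\<close> at most 1/8 and \<open>r\<close> between -2 and 2 this stays below 1/2
      in size.\<close>
    define d where "d = eps / 2 * ?N ?x"
    have d: "0 < d" "d \<le> 1/8" using eps_pos pos bound[of ?x] by (simp_all add: d_def)
    have U: "U ?x = real_of_int n + r * d" using n by (simp add: d_def algebra_simps)
    have "\<bar>r * d\<bar> < 2 * (1/4)" unfolding abs_mult using sr d by (intro mult_strict_mono) auto
    then show "\<exists>n::int. \<bar>U ?x - n\<bar> < 1/2 \<and> (0 \<le> r \<longleftrightarrow> n \<le> U ?x) \<and> (r = 0 \<longleftrightarrow> U ?x = n)"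
      using d(1) by (intro exI[of _ n]) (simp add: U zero_le_mult_iff)
  next
    fix x assume "x \<in> topspace M" "U x \<in> \<int>"
    then have "(x, 0) \<in> ?L ?N" using eps_pos by (simp add: level_tube_def)
    then have "x \<in> R" unfolding R_def by force
    then obtain s r where sr: "s \<in> ?S" "-2 < r" "r < 2" "x = h (s, r)" using R by auto
    have lt: "(x, r * (eps/2)) \<in> ?L ?N" using image[OF sr(1-3)] sr(4) by simp
    \<comment> \<open>Over one \<open>x\<close> there is only one value of \<open>t\<close>, so 0
      and \<open>r * (eps/2)\<close> coincide.\<close>
    have "(x, ?\<tau> x) = (x, 0)" "(x, ?\<tau> x) = (x, r * (eps/2))"
      using proj(2) \<open>(x, 0) \<in> ?L ?N\<close> lt unfolding homeomorphic_maps_def topspace_tube by fastforce+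
    then have "r = 0" using eps_pos by simp
    then show "x \<in> h ` (?S \<times> {0})" using sr by blast
  qed
qed

end

end

section \<open>Normalised charts of a smooth manifold\<close>

lemma homeomorphic_maps_inv_into:
  assumes "homeomorphic_map X Y f" shows "homeomorphic_maps X Y f (inv_into (topspace X) f)"
proof -
  obtain g where g: "homeomorphic_maps X Y f g" using assms homeomorphic_map_maps by blast
  have "g y = inv_into (topspace X) f y" if y: "y \<in> topspace Y" for y
  proof (rule inv_into_f_eq[symmetric])
    show "inj_on f (topspace X)" using assms by (rule homeomorphic_imp_injective_map)
    show "g y \<in> topspace X" using g y by (auto simp: homeomorphic_maps_def continuous_map_def Pi_iff)
    show "f (g y) = y" using g y by (simp add: homeomorphic_maps_def)
  qed
  then show ?thesis using g homeomorphic_maps_eq by metis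
qed

text \<open>Order two of \<open>C_k_on\<close> makes each directional derivative differentiable, and
  the gradient of a component is a finite combination of those along the basis.\<close>

lemma twice_diff_component:
  fixes \<tau> :: "'b::euclidean_space \<Rightarrow> 'c::euclidean_space"
  assumes "smooth_on T \<tau>" "open T" "y \<in> T"
  shows "twice_diff (\<lambda>z. \<tau> z \<bullet> b) y"
proof -
  have "C_k_on (Suc (Suc 0)) T \<tau>" using assms(1) unfolding smooth_on_def by blast
  then have d: "\<And>z. z \<in> T \<Longrightarrow> \<tau> differentiable (at z)"
    and dd: "\<And>z v. z \<in> T \<Longrightarrow> (\<lambda>x. frechet_derivative \<tau> (at x) v) differentiable (at z)"
    by auto
  let ?G = "\<lambda>z. \<Sum>v\<in>Basis. (frechet_derivative \<tau> (at z) v \<bullet> b) *\<^sub>R v"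
  show ?thesis
  proof (rule twice_diffI[OF assms(2,3), of _ ?G])
    fix z assume z: "z \<in> T"
    let ?D = "frechet_derivative \<tau> (at z)"
    have D: "(\<tau> has_derivative ?D) (at z)" using d[OF z] frechet_derivative_works by blast
    then interpret D: linear ?D by (rule has_derivative_linear)
    have "(\<lambda>h. ?D h \<bullet> b) = (\<lambda>h. ?G z \<bullet> h)"
    proof
      fix h
      have "?D h = ?D (\<Sum>v\<in>Basis. (h \<bullet> v) *\<^sub>R v)" by (simp only: euclidean_representation)
      also have "\<dots> = (\<Sum>v\<in>Basis. (h \<bullet> v) *\<^sub>R ?D v)" by (simp add: D.sum D.scaleR)
      finally show "?D h \<bullet> b = ?G z \<bullet> h"
        by (simp add: inner_sum_left inner_sum_right inner_commute mult.commute)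
    qed
    moreover have "((\<lambda>z. \<tau> z \<bullet> b) has_derivative (\<lambda>h. ?D h \<bullet> b)) (at z)"
      by (rule has_derivative_inner_left[OF D])
    ultimately show "((\<lambda>z. \<tau> z \<bullet> b) has_derivative (\<lambda>h. ?G z \<bullet> h)) (at z)" by (simp only:)
    show "?G differentiable (at z)"
      by (intro differentiable_sum ballI differentiable_scaleR differentiable_inner dd[OF z] differentiable_const) simp
  qed
qed

lemma chart_preimage_open:
  assumes c: "chart_of M c" and V: "openin M V"
  shows "open (snd c ` (fst c \<inter> V))"
proof -
  have U: "openin M (fst c)" "open (snd c ` fst c)"
    "homeomorphic_map (subtopology M (fst c)) (top_of_set (snd c ` fst c)) (snd c)"
    using c by (auto simp: chart_of_def split: prod.splits)
  have "openin (subtopology M (fst c)) (fst c \<inter> V)" using V by (simp add: openin_subtopology_Int2)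
  then have "openin (top_of_set (snd c ` fst c)) (snd c ` (fst c \<inter> V))"
    using homeomorphic_imp_open_map[OF U(3)] by (simp add: open_map_def)
  then show ?thesis using U(2) by (rule openin_open_trans)
qed

text \<open>Restriction and affine rescaling: the ball of radius \<open>2 * r\<close> about
  \<open>y0\<close> becomes the ball of radius 2 about the origin.\<close>

lemma normalized_chart:
  fixes c :: "('a, 'n::finite) chart"
  assumes haus: "Hausdorff_space M" and c: "chart_of M c" and r: "0 < r"
    and ball: "ball y0 (2 * r) \<subseteq> snd c ` fst c"
  defines "f \<equiv> \<lambda>z. (1 / r) *\<^sub>R (snd c z - y0)" and "p \<equiv> \<lambda>y. inv_into (fst c) (snd c) (y0 + r *\<^sub>R y)"
  shows "open_chart M {z \<in> fst c. f z \<in> ball 0 2} f p (ball 0 2)"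
proof -
  let ?U = "fst c" and ?W = "{z \<in> fst c. f z \<in> ball 0 2}"
  have U: "openin M ?U" "homeomorphic_map (subtopology M ?U) (top_of_set (snd c ` ?U)) (snd c)"
    using c by (auto simp: chart_of_def split: prod.splits)
  have top: "topspace (subtopology M ?U) = ?U" using openin_subset[OF U(1)] by auto
  have hm: "homeomorphic_maps (subtopology M ?U) (top_of_set (snd c ` ?U)) (snd c) (inv_into ?U (snd c))"
    using homeomorphic_maps_inv_into[OF U(2)] unfolding top .
  have sc: "continuous_map (subtopology M ?U) euclidean (snd c)"
    using hm by (simp add: homeomorphic_maps_def continuous_map_in_subtopology)
  have "continuous_map euclidean euclidean (\<lambda>y. (1 / r) *\<^sub>R (y - y0))"
    by (simp add: continuous_map_iff_continuous2 continuous_intros)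
  from continuous_map_compose[OF sc this]
  have fc: "continuous_map (subtopology M ?U) euclidean f" by (simp add: f_def o_def)
  have aff: "y0 + r *\<^sub>R y \<in> snd c ` ?U" if "y \<in> ball 0 2" for y
  proof (rule subsetD[OF ball])
    have "norm (r *\<^sub>R y) < 2 * r" using that r by (simp add: mult.commute)
    then show "y0 + r *\<^sub>R y \<in> ball y0 (2 * r)" by (simp add: dist_norm)
  qed
  have pU: "p y \<in> ?U" and sp: "snd c (p y) = y0 + r *\<^sub>R y" if "y \<in> ball 0 2" for y
    using aff[OF that] by (simp_all add: p_def inv_into_into f_inv_into_f)
  have fp: "f (p y) = y" if "y \<in> ball 0 2" for y using sp[OF that] r by (simp add: f_def)
  have pf: "p (f z) = z" if "z \<in> ?U" for z
  proof -
    have "y0 + r *\<^sub>R f z = snd c z" using r by (simp add: f_def)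
    moreover have "inj_on (snd c) ?U" using homeomorphic_imp_injective_map[OF U(2)] top by simp
    ultimately show ?thesis using that by (simp add: p_def)
  qed
  have "openin (subtopology M ?U) {z \<in> topspace (subtopology M ?U). f z \<in> ball 0 2}"
    by (rule openin_continuous_map_preimage[OF fc]) simp
  then have Wopen: "openin M ?W" unfolding top using openin_trans_full[OF _ U(1)] by blast
  have "continuous_map (top_of_set (ball 0 2)) (top_of_set (snd c ` ?U)) (\<lambda>y. y0 + r *\<^sub>R y)"
    using aff by (auto simp: continuous_map_in_subtopology intro!: continuous_intros)
  moreover have "continuous_map (top_of_set (snd c ` ?U)) M (inv_into ?U (snd c))"
    using hm by (simp add: homeomorphic_maps_def continuous_map_in_subtopology)
  ultimately have "continuous_map (top_of_set (ball 0 2)) M (inv_into ?U (snd c) \<circ> (\<lambda>y. y0 + r *\<^sub>R y))"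
    by (rule continuous_map_compose)
  then have pc: "continuous_map (top_of_set (ball 0 2)) M p" by (simp add: p_def o_def)
  have "homeomorphic_maps (subtopology M ?W) (top_of_set (ball 0 2)) f p"
    unfolding homeomorphic_maps_def
  proof (intro conjI ballI)
    have "?W \<subseteq> ?U" by blast
    then have "continuous_map (subtopology M ?W) euclidean f"
      by (rule continuous_map_from_subtopology_mono[OF fc])
    then show "continuous_map (subtopology M ?W) (top_of_set (ball 0 2)) f"
      by (auto simp: continuous_map_in_subtopology)
    show "continuous_map (top_of_set (ball 0 2)) (subtopology M ?W) p"
      using pc pU fp by (auto simp: continuous_map_in_subtopology simp del: mem_ball)
    show "p (f z) = z" if "z \<in> topspace (subtopology M ?W)" for z using that pf by simp
    show "f (p y) = y" if "y \<in> topspace (top_of_set (ball 0 2))" for y using that fp by simp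
  qed
  then show ?thesis using haus Wopen by (simp add: open_chart_def)
qed

text \<open>A normalised chart is centred at every point, and the points index the charts. By
  compactness finitely many of their unit balls cover the manifold.\<close>

lemma ex_chart_system:
  fixes M :: "'a topology" and A :: "('a, 'n::finite) chart set"
  assumes "closed_oriented_smooth_manifold M A"
  obtains I :: "'a set" and W and f :: "'a \<Rightarrow> 'a \<Rightarrow> real ^ 'n" and p where "chart_system M I W f p"
proof -
  have haus: "Hausdorff_space M" and comp: "compact_space M" and atlas: "smooth_atlas M A"
    using assms by (auto simp: closed_oriented_smooth_manifold_def oriented_smooth_manifold_def)
  have charts: "\<And>c. c \<in> A \<Longrightarrow> chart_of M c"
    and smooth: "\<And>c d. c \<in> A \<Longrightarrow> d \<in> A \<Longrightarrow> smooth_on (transition_dom c d) (transition_map c d)"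
    using atlas by (auto simp: smooth_atlas_def)
  let ?P = "\<lambda>x cr. fst cr \<in> A \<and> x \<in> fst (fst cr) \<and> 0 < snd cr \<and> ball (snd (fst cr) x) (2 * snd cr) \<subseteq> snd (fst cr) ` fst (fst cr)"
  have "\<forall>x\<in>topspace M. \<exists>cr. ?P x cr"
  proof
    fix x assume "x \<in> topspace M"
    then have "x \<in> (\<Union>c\<in>A. fst c)" using atlas unfolding smooth_atlas_def by simp
    then obtain c where c: "c \<in> A" "x \<in> fst c" by blast
    have "open (snd c ` fst c)" using charts[OF c(1)] by (auto simp: chart_of_def split: prod.splits)
    then obtain d where d: "0 < d" "ball (snd c x) d \<subseteq> snd c ` fst c"
      using c(2) open_contains_ball by blast
    then show "\<exists>cr. ?P x cr"
      \<comment> \<open>The radius is halved because the normalised chart takes up a ball of twice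
        its radius.\<close>
      using c by (intro exI[of _ "(c, d / 2)"]) simp
  qed
  then obtain cr where cr: "\<forall>x\<in>topspace M. ?P x (cr x)"
    by (rule bchoice[THEN exE])
  define c where "c x = fst (cr x)" for x
  define r where "r x = snd (cr x)" for x
  define y0 where "y0 x = snd (c x) x" for x
  define f where "f x z = (1 / r x) *\<^sub>R (snd (c x) z - y0 x)" for x z
  define p where "p x y = inv_into (fst (c x)) (snd (c x)) (y0 x + r x *\<^sub>R y)" for x y
  define W where "W x = {z \<in> fst (c x). f x z \<in> ball 0 2}" for x
  have c: "c x \<in> A" "x \<in> fst (c x)" "0 < r x" "ball (y0 x) (2 * r x) \<subseteq> snd (c x) ` fst (c x)" if "x \<in> topspace M" for x
    using cr that by (simp_all add: c_def r_def y0_def)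
  have oc: "open_chart M (W x) (f x) (p x) (ball 0 2)" if "x \<in> topspace M" for x
    using normalized_chart[OF haus charts[OF c(1)[OF that]] c(3,4)[OF that]]
    unfolding W_def f_def[abs_def] p_def[abs_def] .
  have trans: "twice_diff (\<lambda>z. f j (p i z) \<bullet> b) y"
    if ij: "i \<in> topspace M" "j \<in> topspace M" and y: "y \<in> ball 0 2" "p i y \<in> W j" for i j y b
  proof -
    interpret i: open_chart M "W i" "f i" "p i" "ball 0 2" by (rule oc[OF ij(1)])
    let ?\<tau> = "transition_map (c i) (c j)" and ?T = "transition_dom (c i) (c j)"
    have "openin M (fst (c j))" using charts[OF c(1)[OF ij(2)]] by (auto simp: chart_of_def split: prod.splits)
    then have T: "open ?T"
      unfolding transition_dom_def by (rule chart_preimage_open[OF charts[OF c(1)[OF ij(1)]]])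
    have "norm (r i *\<^sub>R y) < 2 * r i" using y(1) c(3)[OF ij(1)] by (simp add: mult.commute)
    then have "y0 i + r i *\<^sub>R y \<in> snd (c i) ` fst (c i)"
      using c(4)[OF ij(1)] by (auto simp: dist_norm)
    then have "snd (c i) (p i y) = y0 i + r i *\<^sub>R y" by (simp add: p_def f_inv_into_f)
    moreover have "p i y \<in> fst (c i) \<inter> fst (c j)" using y(2) i.p_in(1)[OF y(1)] by (auto simp: W_def)
    ultimately have yT: "y0 i + r i *\<^sub>R y \<in> ?T"
      unfolding transition_dom_def by (metis image_eqI)
    have "twice_diff (\<lambda>w. ?\<tau> w \<bullet> b) (y0 i + r i *\<^sub>R y)"
      by (rule twice_diff_component[OF smooth[OF c(1)[OF ij(1)] c(1)[OF ij(2)]] T yT])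
    moreover have "twice_diff (\<lambda>z. (y0 i + r i *\<^sub>R z) \<bullet> b') y" for b'
    proof -
      have eq: "(\<lambda>z. (y0 i + r i *\<^sub>R z) \<bullet> b') = (\<lambda>z. (r i *\<^sub>R b') \<bullet> z + y0 i \<bullet> b')"
        by (auto simp: algebra_simps inner_commute)
      show ?thesis unfolding eq by (rule twice_diff_affine)
    qed
    ultimately have "twice_diff (\<lambda>z. ?\<tau> (y0 i + r i *\<^sub>R z) \<bullet> b) y"
      by (rule twice_diff_compose(1))
    then have "twice_diff (\<lambda>z. (1 / r j) * (?\<tau> (y0 i + r i *\<^sub>R z) \<bullet> b - y0 j \<bullet> b)) y"
      by (intro twice_diff_mult twice_diff_diff twice_diff_const)
    moreover have "(\<lambda>z. f j (p i z) \<bullet> b) = (\<lambda>z. (1 / r j) * (?\<tau> (y0 i + r i *\<^sub>R z) \<bullet> b - y0 j \<bullet> b))"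
      by (auto simp: f_def p_def transition_map_def algebra_simps)
    ultimately show ?thesis by simp
  qed
  let ?O = "\<lambda>x. {z \<in> W x. norm (f x z) < 1}"
  have opO: "openin M (?O x)" if "x \<in> topspace M" for x
  proof -
    interpret i: open_chart M "W x" "f x" "p x" "ball 0 2" by (rule oc[OF that])
    have "?O x = p x ` ball 0 1"
    proof (intro equalityI subsetI)
      fix z assume "z \<in> ?O x"
      then show "z \<in> p x ` ball 0 1" using i.pf[of z] by (intro image_eqI[of _ _ "f x z"]) auto
    next
      fix z assume "z \<in> p x ` ball 0 1"
      then obtain y where "norm y < 1" "z = p x y" by auto
      then show "z \<in> ?O x" using i.p_in(1)[of y] by simp
    qed
    moreover have "openin M (p x ` ball 0 1)" by (rule i.p_open) auto
    ultimately show ?thesis by simp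
  qed
  have "x \<in> ?O x" if "x \<in> topspace M" for x using c(2)[OF that] by (simp add: W_def f_def y0_def)
  then have "topspace M \<subseteq> \<Union>(?O ` topspace M)" by blast
  then obtain \<F> where F: "finite \<F>" "\<F> \<subseteq> ?O ` topspace M" "topspace M \<subseteq> \<Union>\<F>"
    using comp opO unfolding compact_space_alt by (metis (no_types, lifting) imageE)
  have "\<exists>I\<subseteq>topspace M. finite I \<and> \<F> = ?O ` I" by (rule finite_subset_image[OF F(1,2)])
  then obtain I where I: "finite I" "I \<subseteq> topspace M" "\<F> = ?O ` I" by blast
  have "chart_system M I W f p"
  proof (rule chart_system.intro[OF comp I(1)])
    show "open_chart M (W i) (f i) (p i) (ball 0 2)" if "i \<in> I" for i using oc I(2) that by blast
    show "\<exists>i\<in>I. x \<in> W i \<and> norm (f i x) < 1" if "x \<in> topspace M" for x using F(3) that unfolding I(3) by blast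
    show "twice_diff (\<lambda>z. f j (p i z) \<bullet> b) y" if "i \<in> I" "j \<in> I" "y \<in> ball 0 2" "p i y \<in> W j" for i j y b
      using trans[of i j y b] I(2) that by blast
  qed
  then show thesis by (rule that)
qed

section \<open>Contractible chart domains and local connectedness\<close>

context chart_system
begin

lemma W_open: "i \<in> I \<Longrightarrow> openin M (W i)"
  using charts open_chart.W by blast

lemma W_contractible:
  assumes "i \<in> I" shows "contractible_space (subtopology M (W i))"
proof -
  have "subtopology M (W i) homeomorphic_space top_of_set (ball (0::'b) 2)"
    using open_chart.hom[OF charts[OF assms]] unfolding homeomorphic_space_def by blast
  moreover have "contractible_space (top_of_set (ball (0::'b) 2))"
    by (simp add: convex_imp_contractible)
  ultimately show ?thesis using homeomorphic_space_contractibility by blast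
qed

lemma W_connected: "i \<in> I \<Longrightarrow> connectedin M (W i)"
  using contractible_imp_connected_space[OF W_contractible] openin_subset[OF W_open] by (simp add: connectedin_def)

lemma locally_connected: "locally_connected_space M"
  unfolding locally_connected_space_def neighbourhood_base_of
proof (intro allI impI)
  fix V x assume V: "openin M V \<and> x \<in> V"
  then obtain i where i: "i \<in> I" "x \<in> W i" using cover[of x] openin_subset by blast
  interpret i: open_chart M "W i" "f i" "p i" "ball 0 2" by (rule charts[OF i(1)])
  have "open {y \<in> ball 0 2. p i y \<in> V}" using V by (intro i.p_vimage_open) simp
  moreover have "f i x \<in> {y \<in> ball 0 2. p i y \<in> V}" using V i(2) i.f_in[OF i(2)] by simp
  ultimately obtain d where d: "0 < d" "ball (f i x) d \<subseteq> {y \<in> ball 0 2. p i y \<in> V}"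
    using open_contains_ball by blast
  let ?B = "p i ` ball (f i x) d"
  have "openin M ?B" using d(2) by (intro i.p_open) auto
  moreover have "connectedin M ?B"
    using i.p_cont by (rule connectedin_continuous_map_image)
      (use d(2) in \<open>auto simp: connectedin_subtopology convex_connected\<close>)
  moreover have "p i (f i x) \<in> ?B" using d(1) by simp
  then have "x \<in> ?B" using i.pf[OF i(2)] by simp
  moreover have "?B \<subseteq> V" using d(2) by blast
  ultimately show "\<exists>U Va. openin M U \<and> connectedin M Va \<and> x \<in> U \<and> U \<subseteq> Va \<and> Va \<subseteq> V" by blast
qed

end

section \<open>The attractor\<close>

theorem theorem25:
  fixes M :: "'a topology" and A :: "('a, 'n::finite) chart set"
  assumes "closed_oriented_smooth_manifold M A"
    and "connected_space M"
    and "\<not> trivial_group (cohomology_group 1 M)"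
  shows "\<exists>\<phi> K. continuous_flow M \<phi> \<and> K \<subseteq> topspace M \<and> connectedin M K \<and>
           isolated_attractor M \<phi> K \<and> global_attractor M \<phi> K \<and>
           \<not> stable_set M \<phi> K \<and> no_external_explosions M \<phi> K"
proof -
  have haus: "Hausdorff_space M"
    using assms(1) by (simp add: closed_oriented_smooth_manifold_def oriented_smooth_manifold_def)
  obtain I :: "'a set" and W and f :: "'a \<Rightarrow> 'a \<Rightarrow> real ^ 'n" and p where "chart_system M I W f p"
    using ex_chart_system[OF assms(1)] .
  then interpret chart_system M I W f p .
  have cov: "topspace M \<subseteq> (\<Union>i\<in>I. W i)" using cover by blast
  obtain g :: "'a \<Rightarrow> 'a \<Rightarrow> int" where
    g: "\<And>i j V x y. \<lbrakk>i \<in> I; j \<in> I; path_connectedin M V; V \<subseteq> W i \<inter> W j; x \<in> V; y \<in> V\<rbrakk>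
        \<Longrightarrow> g i x - g j x = g i y - g j y"
    and nontriv: "\<And>b. \<exists>i\<in>I. \<exists>x\<in>W i. \<exists>y\<in>W i. b x + g i x \<noteq> b y + g i y"
    using ex_local_primitives[OF assms(3) W_open cov W_contractible] by metis
  have jumps: "locally_constant_jumps g"
    unfolding locally_constant_jumps_def by (intro ballI allI impI g)
  obtain U where U: "smooth_branches g U" "\<And>x. x \<in> topspace M \<Longrightarrow> regular_at g U x"
    using ex_regular_multivalued[OF jumps] by metis
  obtain T h k where coll: "open_collar M T h k"
    and height: "\<And>s r. s \<in> T \<Longrightarrow> -2 < r \<Longrightarrow> r < 2 \<Longrightarrow>
        \<exists>n::int. \<bar>U (h (s, r)) - n\<bar> < 1/2 \<and> (0 \<le> r \<longleftrightarrow> n \<le> U (h (s, r))) \<and> (r = 0 \<longleftrightarrow> U (h (s, r)) = n)"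
    and level: "\<And>x. x \<in> topspace M \<Longrightarrow> U x \<in> \<int> \<Longrightarrow> x \<in> h ` (T \<times> {0})"
    using ex_open_collar[OF U] by blast
  obtain C where "C \<noteq> {}" "open_collar M C h k" "connectedin M (topspace M - h ` (C \<times> {-1<..<1}))"
    by (rule nonseparating_component[OF comp haus assms(2) locally_connected coll W_open W_connected
          branch_continuous[OF U] nontriv height level])
  then show ?thesis
    using collar_complement_attractor[OF comp haus] by blast
qed

end
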